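(* Let $U$ and $U_0$ be two unitary operators on an infinite dimensional separable Hilbert space $\mathcal{H}$ such that $U-U_0\in\mathcal{B}_2(\mathcal{H})$. Let $A\in\mathcal{B}_2(\mathcal{H})$ be a self-adjoint operator with $U=e^{iA}U_0$ and denote $U_s=e^{isA}U_0$, $s\in\mathbb{R}$. Then for every $\Phi\in\mathcal{A}_{\mathbb{T}}$, $$\Phi(U)-\Phi(U_0)-\frac{d}{ds}\Phi(U_s)\Big|_{s=0}\in\mathcal{B}_1(\mathcal{H}),$$ and there exists a function $\eta\in L^1([0,2\pi])$, unique up to an additive constant, such that for every $\Phi\in\mathcal{A}_{\mathbb{T}}$ $$\operatorname{Tr}\Big\{\Phi(U)-\Phi(U_0)-\frac{d}{ds}\Phi(U_s)\Big|_{s=0}\Big\}=\int_{0}^{2\pi}\frac{d^2}{dt^2}\big\{\Phi(e^{it})\big\}\,\eta(t)\,dt .$$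
   Context: $\mathcal{B}_1(\mathcal{H})$ and $\mathcal{B}_2(\mathcal{H})$ denote the trace class and Hilbert-Schmidt class operators on $\mathcal{H}$, and $\operatorname{Tr}$ is the trace. $\mathbb{T}$ is the unit circle, and $$\mathcal{A}_{\mathbb{T}}:=\Big\{\Phi:\mathbb{T}\to\mathbb{C}\ \Big|\ \Phi(z)=\sum_{n=-\infty}^{\infty}a_nz^n\ \text{ with }\ \sum_{n=-\infty}^{\infty}n^2|a_n|<\infty\Big\}.$$ For unitary $V$, $\Phi(V)=\sum_{n\in\mathbb{Z}}a_nV^n$ (operator norm convergent). The derivative $\frac{d}{ds}\Phi(U_s)$ is taken in operator norm. Whenever $U-U_0\in\mathcal{B}_2(\mathcal{H})$, a self-adjoint $A\in\mathcal{B}_2(\mathcal{H})$ with $U=e^{iA}U_0$ exists. *)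

theory Defs
  imports "HOL-Analysis.Analysis"
begin

class complex_vector = real_vector +
  fixes scaleC :: "complex \<Rightarrow> 'a \<Rightarrow> 'a" (infixr "*\<^sub>C" 75)
  assumes scaleC_add_right: "c *\<^sub>C (x + y) = c *\<^sub>C x + c *\<^sub>C y"
    and scaleC_add_left: "(c + d) *\<^sub>C x = c *\<^sub>C x + d *\<^sub>C x"
    and scaleC_scaleC: "c *\<^sub>C (d *\<^sub>C x) = (c * d) *\<^sub>C x"
    and scaleR_scaleC: "r *\<^sub>R x = complex_of_real r *\<^sub>C x"

global_interpretation complex_vector: vector_space "scaleC :: complex \<Rightarrow> 'a \<Rightarrow> 'a::complex_vector"
  defines cspan = complex_vector.span
proof
  show "1 *\<^sub>C x = x" for x :: 'a
    using scaleR_scaleC[of 1 x] by simp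
qed (rule scaleC_add_right scaleC_add_left scaleC_scaleC)+

(* The real inner product of the library is the real part of the complex one, so that norm
   and topology are those induced by cinner.  cinner is linear in its first argument. *)
class complex_hilbert = complex_vector + real_inner + complete_space +
  fixes cinner :: "'a \<Rightarrow> 'a \<Rightarrow> complex"
  assumes cinner_commute: "cinner x y = cnj (cinner y x)"
    and cinner_add_left: "cinner (x + y) z = cinner x z + cinner y z"
    and cinner_scaleC_left: "cinner (c *\<^sub>C x) y = c * cinner x y"
    and inner_cinner: "inner x y = Re (cinner x y)"

subclass (in complex_hilbert) banach ..

(* For a normed space, perfect_space says precisely that the space is not {0}; this is what makes
   the bounded operators an algebra with 0 \<noteq> 1. *)
class nonzero_complex_hilbert = complex_hilbert + perfect_space

lemma cinner_self: "cinner x x = complex_of_real ((norm x)\<^sup>2)" for x :: "'a::complex_hilbert"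
proof (rule complex_eqI)
  show "Re (cinner x x) = Re (complex_of_real ((norm x)\<^sup>2))"
    by (simp add: inner_cinner[symmetric] power2_norm_eq_inner)
  show "Im (cinner x x) = Im (complex_of_real ((norm x)\<^sup>2))"
    using arg_cong[OF cinner_commute[of x x], of Im] by simp
qed

lemma norm_scaleC: "norm (c *\<^sub>C x) = cmod c * norm x" for x :: "'a::complex_hilbert"
proof -
  have "cinner (c *\<^sub>C x) (c *\<^sub>C x) = c * cnj (c * cinner x x)"
    by (subst cinner_scaleC_left, subst cinner_commute, subst cinner_scaleC_left) simp
  also have "\<dots> = complex_of_real ((cmod c * norm x)\<^sup>2)"
    by (simp add: cinner_self power_mult_distrib complex_norm_square mult.assoc del: of_real_power)
  finally have "(norm (c *\<^sub>C x))\<^sup>2 = (cmod c * norm x)\<^sup>2"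
    unfolding cinner_self of_real_eq_iff .
  then show ?thesis
    by (simp add: power2_eq_iff_nonneg)
qed

lemma bounded_linear_scaleC: "bounded_linear (\<lambda>x. c *\<^sub>C (x::'a::complex_hilbert))"
  by (rule bounded_linear_intro[where K = "cmod c"])
     (simp_all add: scaleC_add_right scaleR_scaleC scaleC_scaleC norm_scaleC mult.commute)


typedef (overloaded) 'a bop =
  "{T :: 'a::complex_hilbert \<Rightarrow>\<^sub>L 'a. \<forall>c x. blinfun_apply T (c *\<^sub>C x) = c *\<^sub>C blinfun_apply T x}"
  morphisms blinfun_of_bop bop_of_blinfun
  by (rule exI[of _ 0]) simp

setup_lifting type_definition_bop

lift_definition bop_apply :: "'a::complex_hilbert bop \<Rightarrow> 'a \<Rightarrow> 'a" (infixr "*\<^sub>V" 75)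
  is blinfun_apply .

instantiation bop :: (complex_hilbert) real_normed_vector
begin

lift_definition zero_bop :: "'a bop" is 0 by simp
lift_definition plus_bop :: "'a bop \<Rightarrow> 'a bop \<Rightarrow> 'a bop" is "(+)"
  by (simp add: blinfun.add_left scaleC_add_right)
lift_definition uminus_bop :: "'a bop \<Rightarrow> 'a bop" is uminus
  by (simp add: blinfun.minus_left)
lift_definition minus_bop :: "'a bop \<Rightarrow> 'a bop \<Rightarrow> 'a bop" is "(-)"
  by (simp add: blinfun.diff_left complex_vector.scale_right_diff_distrib)
lift_definition scaleR_bop :: "real \<Rightarrow> 'a bop \<Rightarrow> 'a bop" is "(*\<^sub>R)"
  by (simp add: blinfun.scaleR_left scaleR_scaleC scaleC_scaleC mult.commute)
lift_definition norm_bop :: "'a bop \<Rightarrow> real" is norm .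

definition sgn_bop :: "'a bop \<Rightarrow> 'a bop" where "sgn_bop T = inverse (norm T) *\<^sub>R T"
definition dist_bop :: "'a bop \<Rightarrow> 'a bop \<Rightarrow> real" where "dist_bop S T = norm (S - T)"
definition uniformity_bop :: "('a bop \<times> 'a bop) filter"
  where "uniformity_bop = (INF e\<in>{0<..}. principal {(x, y). dist x y < e})"
definition open_bop :: "'a bop set \<Rightarrow> bool"
  where "open_bop S = (\<forall>x\<in>S. \<forall>\<^sub>F (x', y) in uniformity. x' = x \<longrightarrow> y \<in> S)"

instance
proof
  fix R S T :: "'a bop" and r s :: real
  show "R + S + T = R + (S + T)" by transfer (rule add.assoc)
  show "R + S = S + R" by transfer (rule add.commute)
  show "0 + R = R" by transfer simp
  show "- R + R = 0" by transfer simp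
  show "R - S = R + - S" by transfer simp
  show "r *\<^sub>R (R + S) = r *\<^sub>R R + r *\<^sub>R S" by transfer (rule scaleR_add_right)
  show "(r + s) *\<^sub>R R = r *\<^sub>R R + s *\<^sub>R R" by transfer (rule scaleR_add_left)
  show "r *\<^sub>R s *\<^sub>R R = (r * s) *\<^sub>R R" by transfer simp
  show "1 *\<^sub>R R = R" by transfer simp
  show "sgn R = inverse (norm R) *\<^sub>R R" by (rule sgn_bop_def)
  show "dist R S = norm (R - S)" by (rule dist_bop_def)
  show "(norm R = 0) = (R = 0)" by transfer simp
  show "norm (R + S) \<le> norm R + norm S" by transfer (rule norm_triangle_ineq)
  show "norm (r *\<^sub>R R) = \<bar>r\<bar> * norm R" by transfer simp
qed (rule uniformity_bop_def open_bop_def)+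

end

instantiation bop :: (complex_hilbert) complex_vector
begin

lift_definition scaleC_bop :: "complex \<Rightarrow> 'a bop \<Rightarrow> 'a bop"
  is "\<lambda>c T. Blinfun (\<lambda>x. c *\<^sub>C blinfun_apply T x)"
  by (simp add: bounded_linear_Blinfun_apply scaleC_scaleC mult.commute
      bounded_linear_compose[OF bounded_linear_scaleC blinfun.bounded_linear_right])

instance
proof
  have scaleC_blinfun: "blinfun_apply (Blinfun (\<lambda>x. c *\<^sub>C blinfun_apply T x)) x = c *\<^sub>C blinfun_apply T x"
    for c x and T :: "'a \<Rightarrow>\<^sub>L 'a"
    by (simp add: bounded_linear_Blinfun_apply
        bounded_linear_compose[OF bounded_linear_scaleC blinfun.bounded_linear_right])
  fix R S :: "'a bop" and r :: real and c d :: complex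
  show "c *\<^sub>C (R + S) = c *\<^sub>C R + c *\<^sub>C S"
    by transfer (rule blinfun_eqI, simp only: scaleC_blinfun,
        simp only: blinfun.add_left scaleC_blinfun scaleC_add_right)
  show "(c + d) *\<^sub>C R = c *\<^sub>C R + d *\<^sub>C R"
    by transfer (rule blinfun_eqI, simp only: scaleC_blinfun,
        simp only: blinfun.add_left scaleC_blinfun scaleC_add_left)
  show "c *\<^sub>C d *\<^sub>C R = (c * d) *\<^sub>C R"
    by transfer (auto intro!: blinfun_eqI simp: scaleC_blinfun scaleC_scaleC)
  show "r *\<^sub>R R = complex_of_real r *\<^sub>C R"
    by transfer (auto intro!: blinfun_eqI simp: scaleC_blinfun blinfun.scaleR_left scaleR_scaleC)
qed

end

lemma bop_eqI: "(\<And>x. S *\<^sub>V x = T *\<^sub>V x) \<Longrightarrow> S = T"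
  by transfer (rule blinfun_eqI)

lemma bop_apply_scaleC: "T *\<^sub>V (c *\<^sub>C x) = c *\<^sub>C (T *\<^sub>V x)"
  by transfer simp

lemma bop_scaleC_apply: "(c *\<^sub>C T) *\<^sub>V x = c *\<^sub>C (T *\<^sub>V x)"
  by transfer (simp add: bounded_linear_Blinfun_apply
      bounded_linear_compose[OF bounded_linear_scaleC blinfun.bounded_linear_right])

instance bop :: (complex_hilbert) banach
proof
  fix X :: "nat \<Rightarrow> 'a bop"
  assume "Cauchy X"
  have dist_bop: "dist S T = dist (blinfun_of_bop S) (blinfun_of_bop T)" for S T :: "'a bop"
    unfolding dist_norm by transfer simp
  have "Cauchy (\<lambda>n. blinfun_of_bop (X n))"
    using \<open>Cauchy X\<close> unfolding Cauchy_def dist_bop .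
  then obtain L where L: "(\<lambda>n. blinfun_of_bop (X n)) \<longlonglongrightarrow> L"
    using Cauchy_convergent_iff convergent_def by blast
  have pointwise: "(\<lambda>n. blinfun_apply (blinfun_of_bop (X n)) x) \<longlonglongrightarrow> blinfun_apply L x" for x
    by (intro tendsto_intros L)
  have "blinfun_apply L (c *\<^sub>C x) = c *\<^sub>C blinfun_apply L x" for c x
  proof (rule LIMSEQ_unique[OF pointwise])
    have "blinfun_apply (blinfun_of_bop (X n)) (c *\<^sub>C x)
        = c *\<^sub>C blinfun_apply (blinfun_of_bop (X n)) x" for n
      using blinfun_of_bop[of "X n"] by simp
    then show "(\<lambda>n. blinfun_apply (blinfun_of_bop (X n)) (c *\<^sub>C x)) \<longlonglongrightarrow> c *\<^sub>C blinfun_apply L x"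
      using bounded_linear.tendsto[OF bounded_linear_scaleC pointwise] by simp
  qed
  then have "blinfun_of_bop (bop_of_blinfun L) = L"
    by (simp add: bop_of_blinfun_inverse)
  then have "X \<longlonglongrightarrow> bop_of_blinfun L"
    using L unfolding tendsto_iff dist_bop by simp
  then show "convergent X"
    unfolding convergent_def by blast
qed

instantiation bop :: (nonzero_complex_hilbert) real_normed_algebra_1
begin

lift_definition one_bop :: "'a bop" is id_blinfun by simp
lift_definition times_bop :: "'a bop \<Rightarrow> 'a bop \<Rightarrow> 'a bop" is "(o\<^sub>L)" by simp

instance
proof
  fix R S T :: "'a bop" and r :: real
  show "R * S * T = R * (S * T)" by transfer (auto intro: blinfun_eqI)
  show "1 * R = R" by transfer (auto intro: blinfun_eqI)
  show "R * 1 = R" by transfer (auto intro: blinfun_eqI)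
  show "(R + S) * T = R * T + S * T"
    by transfer (auto intro!: blinfun_eqI simp: blinfun.add_left)
  show "R * (S + T) = R * S + R * T"
    by transfer (auto intro!: blinfun_eqI simp: blinfun.add_left blinfun.add_right)
  show "r *\<^sub>R R * S = r *\<^sub>R (R * S)"
    by transfer (auto intro!: blinfun_eqI simp: blinfun.scaleR_left)
  show "R * r *\<^sub>R S = r *\<^sub>R (R * S)"
    by transfer (auto intro!: blinfun_eqI simp: blinfun.scaleR_left blinfun.scaleR_right)
  show "norm (R * S) \<le> norm R * norm S" by transfer (rule norm_blinfun_compose)
  show norm_1: "norm (1 :: 'a bop) = 1"
    by transfer (rule norm_blinfun_id)
  show "(0 :: 'a bop) \<noteq> 1"
    using norm_1 by (metis norm_zero zero_neq_one)
qed

end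

lemma bop_times_apply: "(S * T) *\<^sub>V x = S *\<^sub>V (T *\<^sub>V x)"
  by transfer simp

lemma bop_one_apply: "1 *\<^sub>V x = x"
  by transfer simp


definition bop_adj :: "'a::complex_hilbert bop \<Rightarrow> 'a bop" where
  "bop_adj T = (THE S. \<forall>x y. cinner (T *\<^sub>V x) y = cinner x (S *\<^sub>V y))"

definition selfadjoint_bop :: "'a::complex_hilbert bop \<Rightarrow> bool" where
  "selfadjoint_bop T \<longleftrightarrow> bop_adj T = T"

definition unitary_bop :: "'a::nonzero_complex_hilbert bop \<Rightarrow> bool" where
  "unitary_bop V \<longleftrightarrow> bop_adj V * V = 1 \<and> V * bop_adj V = 1"

definition positive_bop :: "'a::complex_hilbert bop \<Rightarrow> bool" where
  "positive_bop T \<longleftrightarrow> (\<forall>x. cinner (T *\<^sub>V x) x \<in> \<real>\<^sub>\<ge>\<^sub>0)"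

definition bop_abs :: "'a::nonzero_complex_hilbert bop \<Rightarrow> 'a bop" where
  "bop_abs T = (THE P. positive_bop P \<and> P * P = bop_adj T * T)"

definition is_onb :: "'a::complex_hilbert set \<Rightarrow> bool" where
  "is_onb B \<longleftrightarrow> (\<forall>x\<in>B. \<forall>y\<in>B. cinner x y = (if x = y then 1 else 0)) \<and> closure (cspan B) = UNIV"

(* As usual, the choice of the orthonormal basis in the next three definitions is immaterial. *)

definition hilbert_schmidt :: "'a::nonzero_complex_hilbert bop \<Rightarrow> bool" where
  "hilbert_schmidt T \<longleftrightarrow> (\<exists>B. is_onb B \<and> (\<lambda>e. (norm (T *\<^sub>V e))\<^sup>2) summable_on B)"

definition trace_class :: "'a::nonzero_complex_hilbert bop \<Rightarrow> bool" where
  "trace_class T \<longleftrightarrow> (\<exists>B. is_onb B \<and> (\<lambda>e. cinner (bop_abs T *\<^sub>V e) e) summable_on B)"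

definition bop_trace :: "'a::nonzero_complex_hilbert bop \<Rightarrow> complex" where
  "bop_trace T = (\<Sum>\<^sub>\<infinity>e\<in>(SOME B. is_onb B). cinner (T *\<^sub>V e) e)"

(* Integer powers of a unitary operator, for which bop_adj V is the inverse of V. *)
definition unitary_powi :: "'a::nonzero_complex_hilbert bop \<Rightarrow> int \<Rightarrow> 'a bop" where
  "unitary_powi V n = (if n \<ge> 0 then V ^ nat n else bop_adj V ^ nat (- n))"


(* Functions on the unit circle are functions on the complex plane whose values off the circle
   are irrelevant.  The coefficients are determined by \<Phi>, being its Fourier coefficients. *)
definition has_circle_coeffs :: "(complex \<Rightarrow> complex) \<Rightarrow> (int \<Rightarrow> complex) \<Rightarrow> bool" where
  "has_circle_coeffs \<Phi> a \<longleftrightarrow>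
     (\<lambda>n. (real_of_int n)\<^sup>2 * cmod (a n)) summable_on UNIV \<and>
     (\<forall>z. cmod z = 1 \<longrightarrow> ((\<lambda>n. a n * z powi n) has_sum \<Phi> z) UNIV)"

definition circle_class :: "(complex \<Rightarrow> complex) set" where
  "circle_class = {\<Phi>. \<exists>a. has_circle_coeffs \<Phi> a}"

definition circle_coeffs :: "(complex \<Rightarrow> complex) \<Rightarrow> int \<Rightarrow> complex" where
  "circle_coeffs \<Phi> = (SOME a. has_circle_coeffs \<Phi> a)"

definition bop_fun :: "(complex \<Rightarrow> complex) \<Rightarrow> 'a::nonzero_complex_hilbert bop \<Rightarrow> 'a bop" where
  "bop_fun \<Phi> V = (\<Sum>\<^sub>\<infinity>n. circle_coeffs \<Phi> n *\<^sub>C unitary_powi V n)"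

end

theory Submission
  imports Defs
begin

text \<open>Let \<open>R\<^sub>n\<close> be the remainder for \<open>\<Phi>(z) = z\<^sup>n\<close>. By cyclicity of the trace and the fundamental
  theorem of calculus, \<open>Tr R\<^sub>n = i n \<integral>\<^sub>0\<^sup>1 Tr (A (U\<^sub>s\<^sup>n - U\<^sub>0\<^sup>n)) ds\<close>, and \<open>\<eta>\<close> must have the
  Fourier coefficients \<open>- Tr R\<^sub>n / n\<^sup>2\<close>. The difference \<open>f(U\<^sub>s) - f(U\<^sub>0)\<close> is the divided difference
  of \<open>f\<close>, a Laurent polynomial in the left multiplication by \<open>U\<^sub>s\<close> and the right multiplication by
  \<open>U\<^sub>0\<close>, applied to \<open>U\<^sub>s - U\<^sub>0\<close>. By transference to finite cyclic groups, its norm on the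
  Hilbert-Schmidt class is controlled by its supremum on the torus, so that Lipschitz functions on
  the circle are Lipschitz for the Hilbert-Schmidt norm and no spectral theorem is needed. Splitting
  \<open>A\<close> into a finite-rank part and a Hilbert-Schmidt-small part then splits the coefficients into an
  \<open>O(1/n)\<close> sequence and one that is small in the dual of the sup norm, whence the Fejer means of the
  coefficients are Cauchy in \<open>L\<^sup>1\<close>. Uniqueness is the Stone-Weierstrass theorem.\<close>

section \<open>Complex inner product and bounded operators\<close>

text \<open>A priori Tr R_n is only O(n^2), so the prescribed coefficients are merely bounded, and a
  bounded sequence need not come from an integrable function. Even a bound in the dual of the sup
  norm would only give a measure. But L^1 is closed among the measures, and this decides the shape
  of the proof: square summable coefficients give a function in L^2 of the circle, and what remains
  has arbitrarily small measure norm. The Lipschitz estimate enters through the powers of n: one of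
  the two in n^2 cancels against the factor n of Tr R_n, the other turns a test polynomial \<Sum>
  b_n e^(int) into its primitive f, so that \<Sum> b_n c_n becomes the integral over s of Tr (A
  (f(U_s) - f(U_0))). The Lipschitz constant of f is the sup norm of the test polynomial, up to the
  ratio of arc to chord. Since the derivative at 0 is in general only Hilbert-Schmidt, derivatives
  enter the trace only through differences. The formula leaves the coefficient at n = 0 free,
  because second derivatives kill constants; this is the additive constant.\<close>

lemma cinner_scaleC_right: "cinner x (c *\<^sub>C y) = cnj c * cinner x y"
  by (metis cinner_commute cinner_scaleC_left complex_cnj_mult)

text \<open>A phase \<open>c\<close> turns \<open>cinner x y\<close> into its modulus, which reduces
  the estimate to the real Cauchy-Schwarz inequality.\<close>

lemma cinner_bound: "cmod (cinner x y) \<le> norm x * norm (y::'a::complex_hilbert)"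
proof -
  define c where "c = cnj (sgn (cinner x y))"
  have "c * cinner x y = complex_of_real (cmod (cinner x y))"
    by (cases "cinner x y = 0")
       (simp_all add: c_def sgn_eq complex_norm_square[symmetric] power2_eq_square field_simps)
  then have "cmod (cinner x y) = inner (c *\<^sub>C x) y"
    by (simp add: inner_cinner cinner_scaleC_left)
  also have "\<dots> \<le> norm (c *\<^sub>C x) * norm y"
    by (rule norm_cauchy_schwarz)
  also have "\<dots> \<le> norm x * norm y"
    by (intro mult_right_mono) (auto simp: norm_scaleC c_def norm_sgn)
  finally show ?thesis .
qed

lemma bounded_bilinear_cinner: "bounded_bilinear (cinner :: 'a::complex_hilbert \<Rightarrow> _)"
proof (rule bounded_bilinear.intro)
  have add_right: "cinner x (y + z) = cinner x y + cinner x z" for x y z :: 'a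
    by (metis cinner_add_left cinner_commute complex_cnj_add)
  fix x y z :: 'a and r :: real
  show "cinner (x + y) z = cinner x z + cinner y z" by (rule cinner_add_left)
  show "cinner x (y + z) = cinner x y + cinner x z" by (rule add_right)
  show "cinner (r *\<^sub>R x) y = r *\<^sub>R cinner x y"
    by (simp add: scaleR_scaleC cinner_scaleC_left scaleR_conv_of_real)
  show "cinner x (r *\<^sub>R y) = r *\<^sub>R cinner x y"
    by (simp add: scaleR_scaleC cinner_scaleC_right scaleR_conv_of_real)
  show "\<exists>K. \<forall>a b. cmod (cinner a b) \<le> norm (a::'a) * norm b * K"
    by (rule exI[of _ 1]) (simp add: cinner_bound)
qed

global_interpretation cinner: bounded_bilinear "cinner :: 'a::complex_hilbert \<Rightarrow> 'a \<Rightarrow> complex"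
  by (rule bounded_bilinear_cinner)

lemma bounded_bilinear_bop_apply: "bounded_bilinear bop_apply"
proof (rule bounded_bilinear.intro)
  fix S T :: "'a bop" and x y :: 'a and r :: real
  show "(S + T) *\<^sub>V x = S *\<^sub>V x + T *\<^sub>V x" by transfer (rule blinfun.add_left)
  show "S *\<^sub>V (x + y) = S *\<^sub>V x + S *\<^sub>V y" by transfer (rule blinfun.add_right)
  show "(r *\<^sub>R S) *\<^sub>V x = r *\<^sub>R (S *\<^sub>V x)" by transfer (rule blinfun.scaleR_left)
  show "S *\<^sub>V (r *\<^sub>R x) = r *\<^sub>R (S *\<^sub>V x)" by transfer (rule blinfun.scaleR_right)
  have "norm (T *\<^sub>V x) \<le> norm T * norm x" for T :: "'a bop" and x
    by transfer (rule norm_blinfun)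
  then show "\<exists>K. \<forall>T x. norm (T *\<^sub>V x) \<le> norm (T::'a bop) * norm x * K"
    by (intro exI[of _ 1]) simp
qed

global_interpretation bop: bounded_bilinear "bop_apply :: 'a::complex_hilbert bop \<Rightarrow> 'a \<Rightarrow> 'a"
  by (rule bounded_bilinear_bop_apply)

lemma norm_bop_apply: "norm (T *\<^sub>V x) \<le> norm T * norm x"
  by transfer (rule norm_blinfun)

lemma norm_bop_le:
  assumes "0 \<le> K" "\<And>x. norm (T *\<^sub>V x) \<le> K * norm x"
  shows "norm T \<le> K"
  using assms by transfer (rule norm_blinfun_bound)

lemma contraction_apply: "norm T \<le> 1 \<Longrightarrow> norm (T *\<^sub>V x) \<le> norm x"
  by (rule order_trans[OF norm_bop_apply]) (simp add: mult_left_le_one_le)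

lemma bop_exists:
  assumes add: "\<And>x y. f (x + y) = f x + f y"
    and scale: "\<And>c x. f (c *\<^sub>C x) = c *\<^sub>C f x"
    and bound: "\<And>x::'a::complex_hilbert. norm (f x :: 'a) \<le> norm x * K"
  obtains T where "\<And>x. T *\<^sub>V x = f x"
proof
  have "bounded_linear f"
    by (rule bounded_linear_intro[where K = K]) (simp_all add: assms scaleR_scaleC)
  then have "blinfun_apply (Blinfun f) = f"
    by (rule bounded_linear_Blinfun_apply)
  then show "bop_of_blinfun (Blinfun f) *\<^sub>V x = f x" for x
    by (simp add: bop_apply_def bop_of_blinfun_inverse scale)
qed

lemma norm_scaleC_bop: "norm (c *\<^sub>C T) = cmod c * norm (T::'a::complex_hilbert bop)"
proof -
  have le: "norm (c *\<^sub>C T) \<le> cmod c * norm T" for c and T :: "'a bop"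
    by (rule norm_bop_le)
       (auto simp: bop_scaleC_apply norm_scaleC mult.assoc intro: mult_left_mono norm_bop_apply)
  show ?thesis
  proof (cases "c = 0")
    case True
    then show ?thesis using le[of 0 T] by simp
  next
    case False
    have "norm T = norm (inverse c *\<^sub>C c *\<^sub>C T)"
      using False by (simp add: scaleC_scaleC del: complex_vector.scale_scale)
    also have "\<dots> \<le> inverse (cmod c) * norm (c *\<^sub>C T)"
      using le[of "inverse c" "c *\<^sub>C T"] by (simp add: norm_inverse)
    finally have "cmod c * norm T \<le> norm (c *\<^sub>C T)"
      using False by (simp add: field_simps)
    then show ?thesis using le[of c T] by simp
  qed
qed

lemma scaleC_mult_left: "(c *\<^sub>C S) * T = c *\<^sub>C (S * T :: 'a::nonzero_complex_hilbert bop)"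
  by (rule bop_eqI) (simp add: bop_times_apply bop_scaleC_apply)

text \<open>Cancels one factor of a norm in estimates of the shape \<parallel>v\<parallel>^2 \<le> K
  \<parallel>v\<parallel>, which come from testing a vector against itself.\<close>

lemma le_of_power2_le_mult: "a\<^sup>2 \<le> K * a \<Longrightarrow> 0 \<le> K \<Longrightarrow> a \<le> (K::real)"
  by (metis linorder_not_le mult_le_cancel_right power2_eq_square order.strict_trans1)

lemma cinner_eqI: "(\<And>z. cinner z x = cinner z y) \<Longrightarrow> x = (y::'a::complex_hilbert)"
  by (metis cinner.diff_right cinner_self diff_self eq_iff_diff_eq_0 norm_eq_zero of_real_eq_0_iff
      power_eq_0_iff)

lemma Re_cinner_self: "Re (cinner x x) = (norm x)\<^sup>2"
  by (simp add: cinner_self)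

lemma power2_norm_add:
  "(norm (x + y))\<^sup>2 = (norm x)\<^sup>2 + 2 * Re (cinner x y) + (norm (y::'a::complex_hilbert))\<^sup>2"
  by (simp add: power2_norm_eq_inner inner_add_left inner_add_right inner_commute inner_cinner[of x y])

section \<open>Orthonormal bases and adjoints\<close>

text \<open>A single basis serves throughout. The final proof takes it to be the one that
  \<open>bop_trace\<close> chooses, so traces never have to be compared between two bases; only the
  Hilbert-Schmidt property is.\<close>

locale onb =
  fixes B :: "'h::nonzero_complex_hilbert set"
  assumes onb: "is_onb B"
begin

lemma cinner_basis: "e \<in> B \<Longrightarrow> f \<in> B \<Longrightarrow> cinner e f = (if e = f then 1 else 0)"
  using onb unfolding is_onb_def by blast

lemma norm_basis: "e \<in> B \<Longrightarrow> norm e = 1"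
proof -
  assume "e \<in> B"
  then have "(norm e)\<^sup>2 = 1"
    using cinner_basis[of e e] Re_cinner_self[of e] by simp
  then show ?thesis using norm_ge_zero[of e] by (auto simp: power2_eq_1_iff)
qed

lemma cinner_finite_sum:
  assumes "finite F" "F \<subseteq> B" "e \<in> B"
  shows "cinner (\<Sum>f\<in>F. c f *\<^sub>C f) e = (if e \<in> F then c e else 0)"
proof -
  have "cinner (\<Sum>f\<in>F. c f *\<^sub>C f) e = (\<Sum>f\<in>F. if f = e then c e else 0)"
    unfolding cinner.sum_left using assms
    by (intro sum.cong) (simp_all add: cinner_scaleC_left cinner_basis subset_iff)
  then show ?thesis using assms(1) by simp
qed

lemma norm_finite_sum:
  assumes "finite F" "F \<subseteq> B"
  shows "(norm (\<Sum>f\<in>F. c f *\<^sub>C f))\<^sup>2 = (\<Sum>f\<in>F. (cmod (c f))\<^sup>2)"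
proof -
  have "complex_of_real ((norm (\<Sum>f\<in>F. c f *\<^sub>C f))\<^sup>2) = (\<Sum>e\<in>F. cnj (c e) * c e)"
    using assms by (simp only: cinner_self[symmetric] cinner.sum_right cinner_scaleC_right)
      (intro sum.cong refl, subst cinner_finite_sum, auto)
  also have "\<dots> = complex_of_real (\<Sum>f\<in>F. (cmod (c f))\<^sup>2)"
    by (simp only: of_real_sum complex_norm_square mult.commute)
  finally show ?thesis by (simp only: of_real_eq_iff)
qed

text \<open>The component of \<open>x\<close> orthogonal to the span of \<open>F\<close>, for finite
  \<open>F\<close> inside the basis.\<close>

definition remainder :: "'h set \<Rightarrow> 'h \<Rightarrow> 'h" where
  "remainder F x = x - (\<Sum>e\<in>F. cinner x e *\<^sub>C e)"

lemma power2_norm_remainder: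
  assumes "finite F" "F \<subseteq> B"
  shows "(norm (remainder F x))\<^sup>2 = (norm x)\<^sup>2 - (\<Sum>e\<in>F. (cmod (cinner x e))\<^sup>2)"
proof -
  let ?p = "\<Sum>e\<in>F. cinner x e *\<^sub>C e"
  have "cinner (remainder F x) ?p = 0"
    using assms by (auto simp: cinner.sum_right cinner_scaleC_right remainder_def cinner.diff_left
        cinner_finite_sum subset_iff intro!: sum.neutral)
  then have "(norm x)\<^sup>2 = (norm (remainder F x))\<^sup>2 + (norm ?p)\<^sup>2"
    using power2_norm_add[of "remainder F x" ?p] by (simp add: remainder_def)
  then show ?thesis using norm_finite_sum[OF assms] by simp
qed

lemma norm_remainder_le:
  assumes "finite F" "F \<subseteq> B"
  shows "norm (remainder F x) \<le> norm x"
proof (rule power2_le_imp_le)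
  have "0 \<le> (\<Sum>e\<in>F. (cmod (cinner x e))\<^sup>2)" by (rule sum_nonneg) simp
  then show "(norm (remainder F x))\<^sup>2 \<le> (norm x)\<^sup>2"
    using power2_norm_remainder[OF assms, of x] by linarith
qed simp

lemma remainder_diff: "remainder F (x - y) = remainder F x - remainder F y"
  by (simp add: remainder_def cinner.diff_left complex_vector.scale_left_diff_distrib sum_subtractf)

lemma remainder_span:
  assumes "finite F" "G \<subseteq> F" "F \<subseteq> B"
  shows "remainder F (\<Sum>e\<in>G. c e *\<^sub>C e) = 0"
proof -
  have G: "finite G" "G \<subseteq> B" using assms finite_subset by auto
  have "(\<Sum>e\<in>F. cinner (\<Sum>e\<in>G. c e *\<^sub>C e) e *\<^sub>C e) = (\<Sum>e\<in>F. (if e \<in> G then c e else 0) *\<^sub>C e)"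
    using assms G by (intro sum.cong) (auto simp: cinner_finite_sum)
  also have "\<dots> = (\<Sum>e\<in>G. c e *\<^sub>C e)"
    using assms by (intro sum.mono_neutral_cong_right) auto
  finally show ?thesis by (simp add: remainder_def)
qed

text \<open>A point \<open>y\<close> of the span of \<open>F\<close> near \<open>x\<close> is
  annihilated by \<open>remainder G\<close> for every finite \<open>G\<close> containing
  \<open>F\<close>, and \<open>remainder G\<close> is a contraction, so the error at
  \<open>x\<close> is at most \<parallel>x - y\<parallel>.\<close>

lemma has_sum_basis: "((\<lambda>e. cinner x e *\<^sub>C e) has_sum x) B"
  unfolding has_sum_def tendsto_iff
proof safe
  fix \<epsilon> :: real assume "\<epsilon> > 0"
  have "x \<in> closure (cspan B)" using onb by (simp add: is_onb_def)
  then obtain y where y: "y \<in> cspan B" "dist y x < \<epsilon>"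
    using \<open>\<epsilon> > 0\<close> by (metis closure_approachable)
  from y(1) obtain F c where F: "finite F" "F \<subseteq> B" "y = (\<Sum>e\<in>F. c e *\<^sub>C e)"
    by (auto simp: complex_vector.span_explicit)
  show "\<forall>\<^sub>F G in finite_subsets_at_top B. dist (\<Sum>e\<in>G. cinner x e *\<^sub>C e) x < \<epsilon>"
    unfolding eventually_finite_subsets_at_top
  proof (intro exI[of _ F] conjI allI impI F)
    fix G assume G: "finite G \<and> F \<subseteq> G \<and> G \<subseteq> B"
    have "norm (remainder G x) = norm (remainder G (x - y))"
      using G F by (simp add: remainder_diff remainder_span)
    also have "\<dots> \<le> norm (x - y)" using G by (intro norm_remainder_le) auto
    finally show "dist (\<Sum>e\<in>G. cinner x e *\<^sub>C e) x < \<epsilon>"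
      using y(2) by (simp add: dist_norm remainder_def norm_minus_commute)
  qed
qed

lemma has_sum_cinner: "((\<lambda>e. cinner x e * cinner e y) has_sum cinner x y) B"
  using has_sum_bounded_linear[OF cinner.bounded_linear_left has_sum_basis, of x y]
  by (simp add: cinner_scaleC_left o_def)

lemma has_sum_norm: "((\<lambda>e. (cmod (cinner x e))\<^sup>2) has_sum (norm x)\<^sup>2) B"
proof -
  have "cinner x e * cinner e x = complex_of_real ((cmod (cinner x e))\<^sup>2)" for e
    by (metis cinner_commute complex_norm_square)
  then show ?thesis
    using has_sum_Re[OF has_sum_cinner[of x x]] by (simp only: Re_complex_of_real Re_cinner_self)
qed

text \<open>Riesz-Fischer: the partial sums form a Cauchy filter over the finite subsets of the
  basis, because their distances are governed by tails of the square sums, and the space is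
  complete.\<close>

lemma summable_basis_sum:
  assumes "(\<lambda>e. (cmod (c e))\<^sup>2) summable_on B"
  shows "(\<lambda>e. c e *\<^sub>C e) summable_on B"
proof -
  define S where "S = (\<lambda>F. \<Sum>e\<in>F. c e *\<^sub>C e)"
  have "\<exists>P. eventually P (finite_subsets_at_top B) \<and> (\<forall>F G. P F \<and> P G \<longrightarrow> dist (S F) (S G) < \<epsilon>)"
    if "\<epsilon> > 0" for \<epsilon>
  proof -
    \<comment> \<open>Half of (\<epsilon>/2)^2, since the approximation gives only \<le> while a
      strict inequality is wanted below.\<close>
    have pos: "(\<epsilon> / 2)\<^sup>2 / 2 > 0" using that by simp
    obtain F0 where F0: "finite F0" "F0 \<subseteq> B"
      "dist (\<Sum>e\<in>F0. (cmod (c e))\<^sup>2) (\<Sum>\<^sub>\<infinity>e\<in>B. (cmod (c e))\<^sup>2) \<le> (\<epsilon> / 2)\<^sup>2 / 2"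
      using has_sum_finite_approximation[OF has_sum_infsum[OF assms] pos] by blast
    have near: "dist (S F) (S F0) < \<epsilon> / 2" if F: "finite F" "F0 \<subseteq> F" "F \<subseteq> B" for F
    proof -
      have "S F - S F0 = S (F - F0)"
        unfolding S_def using F by (subst sum_diff) auto
      then have "(dist (S F) (S F0))\<^sup>2 = (\<Sum>e\<in>F - F0. (cmod (c e))\<^sup>2)"
        using F by (simp add: dist_norm S_def norm_finite_sum subset_iff)
      also have "\<dots> = (\<Sum>e\<in>F. (cmod (c e))\<^sup>2) - (\<Sum>e\<in>F0. (cmod (c e))\<^sup>2)"
        using F by (simp add: sum_diff)
      also have "(\<Sum>e\<in>F. (cmod (c e))\<^sup>2) \<le> (\<Sum>\<^sub>\<infinity>e\<in>B. (cmod (c e))\<^sup>2)"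
        using F assms by (intro finite_sum_le_infsum) auto
      finally have "(dist (S F) (S F0))\<^sup>2 < (\<epsilon> / 2)\<^sup>2" using F0(3) pos unfolding dist_real_def by linarith
      then show ?thesis by (rule power_less_imp_less_base) (use \<open>\<epsilon> > 0\<close> in simp)
    qed
    show ?thesis
    proof (intro exI[of _ "\<lambda>F. finite F \<and> F0 \<subseteq> F \<and> F \<subseteq> B"] conjI allI impI)
      show "\<forall>\<^sub>F F in finite_subsets_at_top B. finite F \<and> F0 \<subseteq> F \<and> F \<subseteq> B"
        unfolding eventually_finite_subsets_at_top using F0 by blast
      show "dist (S F) (S G) < \<epsilon>"
        if "(finite F \<and> F0 \<subseteq> F \<and> F \<subseteq> B) \<and> finite G \<and> F0 \<subseteq> G \<and> G \<subseteq> B" for F G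
        using dist_triangle_half_l[OF near near, of F G] that by blast
    qed
  qed
  then have "cauchy_filter (filtermap S (finite_subsets_at_top B))"
    by (simp add: cauchy_filter_metric_filtermap)
  moreover have "filtermap S (finite_subsets_at_top B) \<noteq> bot"
    by (simp add: filtermap_bot_iff)
  ultimately obtain l where "filtermap S (finite_subsets_at_top B) \<le> nhds l"
    using complete_uniform[where S = "UNIV :: 'h set"] complete_UNIV by auto
  then show ?thesis
    unfolding summable_on_def has_sum_def filterlim_def S_def by blast
qed

text \<open>The candidate for the adjoint at \<open>y\<close> has the coefficients
  \<open>c y e\<close>. Testing a partial sum \<open>v\<close> against itself gives
  \<parallel>v\<parallel>^2 \<le> \<parallel>y\<parallel> \<parallel>T\<parallel>
  \<parallel>v\<parallel>, which bounds the square sums. This takes the place of the Riesz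
  representation theorem.\<close>

lemma adj_exists: "\<exists>S. \<forall>x y. cinner (T *\<^sub>V x) y = cinner x (S *\<^sub>V (y::'h))"
proof -
  define c where "c = (\<lambda>y e. cinner y (T *\<^sub>V e))"
  define f where "f = (\<lambda>y. \<Sum>\<^sub>\<infinity>e\<in>B. c y e *\<^sub>C e)"
  have "(\<lambda>e. (cmod (c y e))\<^sup>2) summable_on B" for y
  proof (rule nonneg_bounded_partial_sums_imp_summable_on)
    show "\<forall>\<^sub>F F in finite_subsets_at_top B. (\<Sum>e\<in>F. (cmod (c y e))\<^sup>2) \<le> (norm T * norm y)\<^sup>2"
    proof (rule eventually_finite_subsets_at_top_weakI)
      fix F assume F: "finite F" "F \<subseteq> B"
      define v where "v = (\<Sum>e\<in>F. c y e *\<^sub>C e)"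
      have "complex_of_real ((norm v)\<^sup>2) = cinner y (T *\<^sub>V v)"
        unfolding v_def norm_finite_sum[OF F] of_real_sum complex_norm_square
        by (simp add: bop.sum_right bop_apply_scaleC cinner.sum_right cinner_scaleC_right c_def mult.commute)
      then have "(norm v)\<^sup>2 = cmod (cinner y (T *\<^sub>V v))"
        by (metis abs_power2 norm_of_real)
      also have "\<dots> \<le> norm y * (norm T * norm v)"
        by (rule order_trans[OF cinner_bound]) (simp add: mult_left_mono norm_bop_apply)
      finally have "norm v \<le> norm T * norm y"
        by - (rule le_of_power2_le_mult, simp_all add: mult_ac)
      then have "(norm v)\<^sup>2 \<le> (norm T * norm y)\<^sup>2" by (intro power_mono) auto
      then show "(\<Sum>e\<in>F. (cmod (c y e))\<^sup>2) \<le> (norm T * norm y)\<^sup>2"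
        unfolding v_def norm_finite_sum[OF F] .
    qed
  qed auto
  then have hs: "((\<lambda>e. c y e *\<^sub>C e) has_sum f y) B" for y
    unfolding f_def by (intro has_sum_infsum summable_basis_sum)
  have f: "cinner (T *\<^sub>V x) y = cinner x (f y)" for x y
  proof (rule has_sum_unique)
    show "((\<lambda>e. cinner x e * cinner (T *\<^sub>V e) y) has_sum cinner (T *\<^sub>V x) y) B"
      using has_sum_bounded_linear[OF bounded_linear_compose[OF cinner.bounded_linear_left[of y]
            bop.bounded_linear_right[of T]] has_sum_basis[of x]]
      by (simp add: bop_apply_scaleC cinner_scaleC_left o_def)
    show "((\<lambda>e. cinner x e * cinner (T *\<^sub>V e) y) has_sum cinner x (f y)) B"
      using has_sum_bounded_linear[OF cinner.bounded_linear_right[of x] hs[of y]]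
      by (simp add: cinner_scaleC_right c_def cinner_commute[of y] o_def mult.commute)
  qed
  have "norm (f y) \<le> norm y * norm T" for y
  proof -
    have "(norm (f y))\<^sup>2 = cmod (cinner (T *\<^sub>V f y) y)"
      by (simp add: f cinner_self del: of_real_power)
    also have "\<dots> \<le> norm T * norm (f y) * norm y"
      by (rule order_trans[OF cinner_bound]) (simp add: mult_right_mono norm_bop_apply)
    finally show ?thesis
      by - (rule le_of_power2_le_mult, simp_all add: mult_ac)
  qed
  then obtain S where "\<And>y. S *\<^sub>V y = f y"
  proof (rule bop_exists[rotated 2])
    show "f (x + y) = f x + f y" for x y
      by (rule cinner_eqI) (simp add: f[symmetric] cinner.add_right)
    show "f (k *\<^sub>C x) = k *\<^sub>C f x" for k x
      by (rule cinner_eqI) (simp add: f[symmetric] cinner_scaleC_right)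
  qed blast
  then show ?thesis using f by (intro exI[of _ S]) simp
qed

lemma cinner_adj: "cinner (T *\<^sub>V x) (y::'h) = cinner x (bop_adj T *\<^sub>V y)"
proof -
  have "\<exists>!S. \<forall>x y. cinner (T *\<^sub>V x) y = cinner x (S *\<^sub>V y)"
  proof (rule ex_ex1I[OF adj_exists])
    fix S S' assume "\<forall>x y. cinner (T *\<^sub>V x) y = cinner x (S *\<^sub>V y)"
      "\<forall>x y. cinner (T *\<^sub>V x) y = cinner x (S' *\<^sub>V y)"
    then show "S = S'" by (intro bop_eqI cinner_eqI) simp
  qed
  from theI'[OF this] show ?thesis unfolding bop_adj_def by blast
qed

section \<open>Algebra of adjoints and unitary operators\<close>

lemma cinner_adj': "cinner (bop_adj T *\<^sub>V x) (y::'h) = cinner x (T *\<^sub>V y)"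
  by (metis cinner_adj cinner_commute)

lemma adj_eqI: "(\<And>x y::'h. cinner (T *\<^sub>V x) y = cinner x (S *\<^sub>V y)) \<Longrightarrow> bop_adj T = S"
  by (intro bop_eqI cinner_eqI) (simp add: cinner_adj[symmetric])

lemma adj_adj [simp]: "bop_adj (bop_adj T) = (T :: 'h bop)"
  by (rule adj_eqI) (simp add: cinner_adj')

lemma adj_mult: "bop_adj (S * T) = bop_adj (T::'h bop) * bop_adj S"
  by (rule adj_eqI) (simp add: bop_times_apply cinner_adj)

lemma adj_add: "bop_adj (S + T) = bop_adj S + bop_adj (T::'h bop)"
  by (rule adj_eqI) (simp add: cinner_adj bop.add_left cinner.add_left cinner.add_right)

lemma adj_diff: "bop_adj (S - T) = bop_adj S - bop_adj (T::'h bop)"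
  by (rule adj_eqI) (simp add: cinner_adj bop.diff_left cinner.diff_left cinner.diff_right)

lemma adj_scaleC: "bop_adj (c *\<^sub>C T) = cnj c *\<^sub>C bop_adj (T::'h bop)"
  by (rule adj_eqI) (simp add: cinner_adj bop_scaleC_apply cinner_scaleC_left cinner_scaleC_right)

lemma adj_scaleR: "bop_adj (r *\<^sub>R T) = r *\<^sub>R bop_adj (T::'h bop)"
  by (simp add: scaleR_scaleC adj_scaleC)

lemma adj_one [simp]: "bop_adj 1 = (1::'h bop)"
  by (rule adj_eqI) (simp add: bop_one_apply)

lemma adj_zero [simp]: "bop_adj 0 = (0::'h bop)"
  by (rule adj_eqI) (simp add: bop.zero_left cinner.zero_left cinner.zero_right)

lemma adj_power: "bop_adj (T ^ n) = bop_adj (T::'h bop) ^ n"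
  by (induction n) (simp_all add: adj_mult power_commutes)

lemma norm_adj [simp]: "norm (bop_adj T) = norm (T::'h bop)"
proof -
  have "norm (bop_adj T) \<le> norm T" for T :: "'h bop"
  proof (rule norm_bop_le)
    fix x
    have "(norm (bop_adj T *\<^sub>V x))\<^sup>2 = cmod (cinner (T *\<^sub>V bop_adj T *\<^sub>V x) x)"
      by (simp add: cinner_adj cinner_self del: of_real_power)
    also have "\<dots> \<le> norm T * norm (bop_adj T *\<^sub>V x) * norm x"
      by (rule order_trans[OF cinner_bound]) (simp add: mult_right_mono norm_bop_apply)
    finally show "norm (bop_adj T *\<^sub>V x) \<le> norm T * norm x"
      by - (rule le_of_power2_le_mult, simp_all add: mult_ac)
  qed simp
  from this[of T] this[of "bop_adj T"] show ?thesis by simp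
qed

lemma bounded_linear_adj: "bounded_linear (bop_adj :: 'h bop \<Rightarrow> 'h bop)"
  by (rule bounded_linear_intro[where K = 1]) (simp_all add: adj_add adj_scaleR)

lemma norm_unitary_apply: "unitary_bop V \<Longrightarrow> norm (V *\<^sub>V x) = norm (x::'h)"
proof -
  assume "unitary_bop V"
  then have "cinner (V *\<^sub>V x) (V *\<^sub>V x) = cinner x x"
    by (simp add: cinner_adj bop_times_apply[symmetric] unitary_bop_def bop_one_apply)
  then have "(norm (V *\<^sub>V x))\<^sup>2 = (norm x)\<^sup>2" by (simp only: cinner_self of_real_eq_iff)
  then show ?thesis by (simp add: power2_eq_iff_nonneg)
qed

lemma norm_unitary: "unitary_bop V \<Longrightarrow> norm (V::'h bop) \<le> 1"
  by (rule norm_bop_le) (simp_all add: norm_unitary_apply)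

lemma unitary_adj: "unitary_bop V \<Longrightarrow> unitary_bop (bop_adj V :: 'h bop)"
  by (simp add: unitary_bop_def)

lemma unitary_mult: "unitary_bop V \<Longrightarrow> unitary_bop W \<Longrightarrow> unitary_bop (V * W :: 'h bop)"
  unfolding unitary_bop_def adj_mult by (metis (no_types, lifting) mult.assoc mult_1)

lemma unitary_one: "unitary_bop (1 :: 'h bop)"
  by (simp add: unitary_bop_def)

lemma unitary_power: "unitary_bop V \<Longrightarrow> unitary_bop (V ^ n :: 'h bop)"
  by (induction n) (simp_all add: unitary_one unitary_mult)

end

section \<open>Positive operators and the absolute value\<close>

lemma positive_bop_iff: "positive_bop P \<longleftrightarrow> (\<forall>x. 0 \<le> Re (cinner (P *\<^sub>V x) x) \<and> Im (cinner (P *\<^sub>V x) x) = 0)"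
  by (simp add: positive_bop_def complex_nonneg_Reals_iff)

lemma positive_Re_nonneg: "positive_bop P \<Longrightarrow> 0 \<le> Re (cinner (P *\<^sub>V x) x)"
  by (simp add: positive_bop_iff)

text \<open>Polarisation: real values of the form at \<open>x + y\<close> settle the imaginary part,
  those at \<open>x + \<i> *\<^sub>C y\<close> the real part.\<close>

lemma positive_hermitian:
  assumes "positive_bop P"
  shows "cinner (P *\<^sub>V x) y = cinner x (P *\<^sub>V y)"
proof -
  have im: "Im (cinner (P *\<^sub>V z) z) = 0" for z
    using assms by (simp add: positive_bop_iff)
  have "Im (cinner (P *\<^sub>V x) y) + Im (cinner (P *\<^sub>V y) x) = 0"
    using im[of "x + y"] im[of x] im[of y] by (simp add: bop.add_right cinner.add_left cinner.add_right)
  moreover have "Re (cinner (P *\<^sub>V y) x) = Re (cinner (P *\<^sub>V x) y)"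
    using im[of "x + \<i> *\<^sub>C y"] im[of x] im[of y]
    by (simp add: bop.add_right cinner.add_left cinner.add_right bop_apply_scaleC
        cinner_scaleC_left cinner_scaleC_right)
  ultimately have "cinner (P *\<^sub>V x) y = cnj (cinner (P *\<^sub>V y) x)"
    by (simp add: complex_eq_iff)
  then show ?thesis by (metis cinner_commute)
qed

text \<open>This is P^2 \<le> c P, obtained from positivity of the form at
  \<open>x - t *\<^sub>R z\<close> with t = 1/c.\<close>

lemma positive_norm_apply_le:
  assumes P: "positive_bop P" and c: "norm P \<le> c" "0 < c"
  shows "(norm (P *\<^sub>V x))\<^sup>2 \<le> c * Re (cinner (P *\<^sub>V x) x)"
proof -
  define t where "t = 1 / c"
  define z where "z = P *\<^sub>V x"
  have "0 \<le> Re (cinner (P *\<^sub>V (x - t *\<^sub>R z)) (x - t *\<^sub>R z))"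
    by (rule positive_Re_nonneg[OF P])
  also have "\<dots> = Re (cinner z x) - 2 * t * (norm z)\<^sup>2 + t\<^sup>2 * Re (cinner (P *\<^sub>V z) z)"
    by (simp add: bop.diff_right cinner.diff_left cinner.diff_right bop.scaleR_right cinner.scaleR_left
        cinner.scaleR_right positive_hermitian[OF P, of z x] z_def[symmetric] Re_cinner_self
        power2_eq_square algebra_simps)
  also have "Re (cinner (P *\<^sub>V z) z) \<le> c * (norm z)\<^sup>2"
  proof -
    have "Re (cinner (P *\<^sub>V z) z) \<le> norm (P *\<^sub>V z) * norm z"
      using complex_Re_le_cmod cinner_bound order_trans by blast
    also have "\<dots> \<le> (c * norm z) * norm z"
      using norm_bop_apply[of P z] c by (intro mult_right_mono) (auto elim!: order_trans intro: mult_right_mono)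
    finally show ?thesis by (simp add: power2_eq_square mult.assoc)
  qed
  finally have "0 \<le> Re (cinner z x) - 2 * t * (norm z)\<^sup>2 + t\<^sup>2 * (c * (norm z)\<^sup>2)"
    by (simp add: mult_left_mono)
  then have "0 \<le> c * (Re (cinner z x) - t * (norm z)\<^sup>2)"
    using c by (simp add: t_def power2_eq_square)
  then show ?thesis using c by (simp add: z_def t_def right_diff_distrib)
qed

text \<open>Expanding the square and applying P^2 \<le> c P gives the norm bound that a spectral
  theorem would read off from 0 \<le> P \<le> c.\<close>

lemma norm_shift_positive:
  assumes P: "positive_bop P" and c: "norm P \<le> c" "0 < c"
  shows "norm (c *\<^sub>R 1 - P) \<le> c"
proof (rule norm_bop_le)
  fix x
  have "(norm ((c *\<^sub>R 1 - P) *\<^sub>V x))\<^sup>2 = (norm (c *\<^sub>R x + - (P *\<^sub>V x)))\<^sup>2"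
    by (simp add: bop.diff_left bop.scaleR_left bop_one_apply)
  also have "\<dots> = c\<^sup>2 * (norm x)\<^sup>2 - 2 * c * Re (cinner (P *\<^sub>V x) x) + (norm (P *\<^sub>V x))\<^sup>2"
    unfolding power2_norm_add
    by (simp add: cinner.scaleR_left cinner.minus_right positive_hermitian[OF P] power_mult_distrib)
  also have "\<dots> \<le> c\<^sup>2 * (norm x)\<^sup>2 - c * Re (cinner (P *\<^sub>V x) x)"
    using positive_norm_apply_le[OF assms] by (simp add: algebra_simps)
  also have "\<dots> \<le> (c * norm x)\<^sup>2"
    using c positive_Re_nonneg[OF P, of x] by (simp add: power_mult_distrib)
  finally show "norm ((c *\<^sub>R 1 - P) *\<^sub>V x) \<le> c * norm x"
    using c by - (rule power2_le_imp_le, auto)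
qed (use c in simp)

lemma positive_scaleR: "positive_bop P \<Longrightarrow> 0 \<le> r \<Longrightarrow> positive_bop (r *\<^sub>R P)"
  by (simp add: positive_bop_iff bop.scaleR_left cinner.scaleR_left)

context onb
begin

lemma positive_adj_mult: "positive_bop (bop_adj T * (T :: 'h bop))"
  by (simp add: positive_bop_iff bop_times_apply cinner_adj' cinner_self)

lemma adj_positive: "positive_bop P \<Longrightarrow> bop_adj P = (P :: 'h bop)"
  by (rule adj_eqI) (rule positive_hermitian)

text \<open>The root of \<open>S = 1 - M\<close> is \<open>1 - Y\<close> with \<open>Y = (M + Y\<^sup>2) / 2\<close>; the fixed point iteration
  is majorised by the same iteration for the number 1 in place of \<open>M\<close>.\<close>

lemma sqrt_exists_contraction:
  fixes S :: "'h bop"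
  assumes S: "positive_bop S" "norm S \<le> 1"
  shows "\<exists>Q. positive_bop Q \<and> Q * Q = S \<and> (\<forall>C. S * C = C * S \<longrightarrow> Q * C = C * Q)"
proof -
  define M where "M = 1 - S"
  have M: "norm M \<le> 1" using norm_shift_positive[of S 1] S by (simp add: M_def)
  define Y where "Y = rec_nat (0 :: 'h bop) (\<lambda>_ Z. (1/2) *\<^sub>R (M + Z * Z))"
  define y where "y = rec_nat (0 :: real) (\<lambda>_ z. (1/2) * (1 + z * z))"
  have Y: "Y 0 = 0" "\<And>n. Y (Suc n) = (1/2) *\<^sub>R (M + Y n * Y n)" by (simp_all add: Y_def)
  have y: "y 0 = 0" "\<And>n. y (Suc n) = (1/2) * (1 + y n * y n)" by (simp_all add: y_def)
  have y01: "0 \<le> y n \<and> y n \<le> 1" for n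
    by (induction n) (auto simp: y mult_le_one)
  have norm_Y: "norm (Y n) \<le> y n" for n
  proof (induction n)
    case (Suc n)
    have "norm (M + Y n * Y n) \<le> 1 + y n * y n"
      using M Suc y01[of n]
      by (intro norm_triangle_le add_mono order_trans[OF norm_mult_ineq] mult_mono) auto
    then show ?case by (simp add: Y y)
  qed (simp add: Y y)
  have step: "norm (Y (Suc n) - Y n) \<le> y (Suc n) - y n" for n
  proof (induction n)
    case 0
    then show ?case using M by (simp add: Y y)
  next
    case (Suc n)
    define D where "D = Y (Suc n) - Y n"
    have "Y (Suc (Suc n)) - Y (Suc n) = (1/2) *\<^sub>R (Y (Suc n) * Y (Suc n) - Y n * Y n)"
      by (subst Y(2)[of "Suc n"], subst (3) Y(2)[of n]) (simp flip: scaleR_diff_right)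
    \<comment> \<open>This factorisation holds whether or not the two iterates commute.\<close>
    also have "Y (Suc n) * Y (Suc n) - Y n * Y n = Y (Suc n) * D + D * Y n"
      by (simp add: D_def algebra_simps)
    finally have "norm (Y (Suc (Suc n)) - Y (Suc n)) = norm (Y (Suc n) * D + D * Y n) / 2"
      by simp
    also have "\<dots> \<le> (y (Suc n) * (y (Suc n) - y n) + (y (Suc n) - y n) * y n) / 2"
      using Suc y01[of n] y01[of "Suc n"] norm_Y[of n] norm_Y[of "Suc n"] norm_ge_zero[of D]
        order_trans[OF norm_ge_zero Suc]
      unfolding D_def[symmetric]
      by (intro divide_right_mono norm_triangle_le add_mono order_trans[OF norm_mult_ineq] mult_mono) auto
    also have "\<dots> = y (Suc (Suc n)) - y (Suc n)"
      by (subst y(2)[of "Suc n"], subst (3) y(2)[of n]) (simp add: field_simps)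
    finally show ?case .
  qed
  have step': "norm (Y (n + k) - Y n) \<le> y (n + k) - y n" for n k
  proof (induction k)
    case (Suc k)
    have "norm (Y (n + Suc k) - Y n) = norm ((Y (Suc (n + k)) - Y (n + k)) + (Y (n + k) - Y n))" by simp
    also have "\<dots> \<le> (y (Suc (n + k)) - y (n + k)) + (y (n + k) - y n)"
      by (intro norm_triangle_le add_mono step Suc)
    finally show ?case by simp
  qed simp
  have "y n \<le> y (Suc n)" for n
    using step[of n] norm_ge_zero order_trans by (smt (verit))
  then have "incseq y" by (rule incseq_SucI)
  then have "convergent y"
    using y01 by (intro Bseq_mono_convergent BseqI'[of _ 1]) (auto simp: incseq_def)
  then have "Cauchy y" by (simp add: Cauchy_convergent_iff)
  have "Cauchy Y"
  proof (rule metric_CauchyI)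
    fix \<epsilon> :: real assume "\<epsilon> > 0"
    then obtain N where N: "\<And>m n. m \<ge> N \<Longrightarrow> n \<ge> N \<Longrightarrow> dist (y m) (y n) < \<epsilon>"
      using \<open>Cauchy y\<close> metric_CauchyD by metis
    have "dist (Y m) (Y n) < \<epsilon>" if "n \<le> m" "n \<ge> N" for m n
      using step'[of n "m - n"] N[of m n] that by (simp add: dist_norm)
    then show "\<exists>N. \<forall>m\<ge>N. \<forall>n\<ge>N. dist (Y m) (Y n) < \<epsilon>"
      by (metis dist_commute linear)
  qed
  then obtain Z where Z: "Y \<longlonglongrightarrow> Z"
    using Cauchy_convergent convergent_def by blast
  have "(\<lambda>n. Y (Suc n)) \<longlonglongrightarrow> (1/2) *\<^sub>R (M + Z * Z)"
    unfolding Y by (intro tendsto_intros Z)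
  then have "(1/2) *\<^sub>R (M + Z * Z) = Z"
    using LIMSEQ_Suc[OF Z] LIMSEQ_unique by blast
  then have ZZ: "M + Z * Z = 2 *\<^sub>R Z"
    by (metis divide_self_if mult_2 scaleR_2 scaleR_half_double scaleR_add_right)
  have "norm (Y n) \<le> 1" for n using norm_Y[of n] y01[of n] by simp
  then have norm_Z: "norm Z \<le> 1"
    by (intro LIMSEQ_le_const2[OF tendsto_norm[OF Z]]) auto
  have adj_Y: "bop_adj (Y n) = Y n" for n
    by (induction n)
      (simp_all add: Y M_def adj_scaleR adj_add adj_diff adj_mult adj_positive[OF S(1)])
  then have "(\<lambda>n. Y n) \<longlonglongrightarrow> bop_adj Z"
    using bounded_linear.tendsto[OF bounded_linear_adj Z] by simp
  then have adj_Z: "bop_adj Z = Z" using Z LIMSEQ_unique by blast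
  have "positive_bop (1 - Z)"
    unfolding positive_bop_iff
  proof safe
    fix x
    have "Re (cinner (Z *\<^sub>V x) x) \<le> cmod (cinner (Z *\<^sub>V x) x)" by (rule complex_Re_le_cmod)
    also have "\<dots> \<le> norm x * norm x"
      by (intro order_trans[OF cinner_bound] mult_right_mono contraction_apply norm_Z) simp
    finally show "0 \<le> Re (cinner ((1 - Z) *\<^sub>V x) x)"
      by (simp add: bop.diff_left bop_one_apply cinner.diff_left Re_cinner_self power2_eq_square)
    have "cnj (cinner (Z *\<^sub>V x) x) = cinner (Z *\<^sub>V x) x"
      by (metis adj_Z cinner_adj cinner_commute)
    then have "Im (cinner (Z *\<^sub>V x) x) = 0" by (simp add: complex_eq_iff)
    then show "Im (cinner ((1 - Z) *\<^sub>V x) x) = 0"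
      by (simp add: bop.diff_left bop_one_apply cinner.diff_left cinner_self)
  qed
  moreover have "(1 - Z) * (1 - Z) = S"
    using ZZ by (simp add: M_def algebra_simps scaleR_2)
  moreover have "(1 - Z) * C = C * (1 - Z)" if C: "S * C = C * S" for C
  proof -
    \<comment> \<open>Every iterate is a polynomial in \<open>M\<close>, so whatever commutes with
      \<open>S\<close> commutes with the limit.\<close>
    have "Y n * C = C * Y n" for n
    proof (induction n)
      case (Suc n)
      have "(Y n * Y n) * C = C * (Y n * Y n)" by (metis Suc mult.assoc)
      then show ?case by (simp add: Y M_def C algebra_simps)
    qed (simp add: Y)
    moreover have "(\<lambda>n. Y n * C) \<longlonglongrightarrow> Z * C" "(\<lambda>n. C * Y n) \<longlonglongrightarrow> C * Z"
      by (intro tendsto_intros Z)+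
    ultimately have "Z * C = C * Z" using LIMSEQ_unique by auto
    then show ?thesis by (simp add: algebra_simps)
  qed
  ultimately show ?thesis by blast
qed

lemma sqrt_exists:
  fixes S :: "'h bop"
  assumes S: "positive_bop S"
  shows "\<exists>Q. positive_bop Q \<and> Q * Q = S \<and> (\<forall>C. S * C = C * S \<longrightarrow> Q * C = C * Q)"
proof (cases "S = 0")
  case True
  then show ?thesis by (intro exI[of _ 0]) (simp add: positive_bop_iff bop.zero_left cinner.zero_left)
next
  case False
  define r where "r = norm S"
  have r: "r > 0" using False by (simp add: r_def)
  have pos: "positive_bop ((1/r) *\<^sub>R S)" and le: "norm ((1/r) *\<^sub>R S) \<le> 1"
    using r by (simp_all add: positive_scaleR S r_def)
  obtain Q where Q: "positive_bop Q" "Q * Q = (1/r) *\<^sub>R S"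
    "\<And>C. ((1/r) *\<^sub>R S) * C = C * ((1/r) *\<^sub>R S) \<Longrightarrow> Q * C = C * Q"
    using sqrt_exists_contraction[OF pos le] by blast
  show ?thesis
  proof (intro exI[of _ "sqrt r *\<^sub>R Q"] conjI allI impI)
    show "positive_bop (sqrt r *\<^sub>R Q)" using r by (simp add: positive_scaleR Q)
    show "(sqrt r *\<^sub>R Q) * (sqrt r *\<^sub>R Q) = S" using r by (simp add: Q)
    show "(sqrt r *\<^sub>R Q) * C = C * (sqrt r *\<^sub>R Q)" if "S * C = C * S" for C
      using Q(3)[of C] that by simp
  qed
qed

text \<open>(P + Q)(P - Q) = 0 forces both positive forms to vanish on the range of
  \<open>D\<close>. Hence \<open>D\<close> vanishes on its own range, and a self-adjoint
  \<open>D\<close> with D^2 = 0 is 0.\<close>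

lemma sqrt_unique:
  fixes P Q :: "'h bop"
  assumes P: "positive_bop P" and Q: "positive_bop Q" and eq: "P * P = Q * Q"
    and comm: "P * Q = Q * P"
  shows "P = Q"
proof (rule bop_eqI)
  fix x
  define D where "D = P - Q"
  define z where "z = D *\<^sub>V x"
  have "(P + Q) * D = 0" using eq comm by (simp add: D_def algebra_simps)
  moreover have "P *\<^sub>V z + Q *\<^sub>V z = ((P + Q) * D) *\<^sub>V x"
    by (simp add: z_def bop.add_left bop_times_apply)
  ultimately have "P *\<^sub>V z + Q *\<^sub>V z = 0" by (simp only: bop.zero_left)
  then have "cinner (P *\<^sub>V z) z + cinner (Q *\<^sub>V z) z = 0"
    by (simp add: cinner.add_left[symmetric] cinner.zero_left)
  then have "Re (cinner (P *\<^sub>V z) z) + Re (cinner (Q *\<^sub>V z) z) = 0"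
    by (metis plus_complex.sel(1) zero_complex.sel(1))
  then have "Re (cinner (P *\<^sub>V z) z) = 0" "Re (cinner (Q *\<^sub>V z) z) = 0"
    using positive_Re_nonneg[OF P, of z] positive_Re_nonneg[OF Q, of z] by auto
  then have "P *\<^sub>V z = 0" "Q *\<^sub>V z = 0"
    using positive_norm_apply_le[OF P, of "norm P + 1" z] positive_norm_apply_le[OF Q, of "norm Q + 1" z]
    by (simp_all add: add_nonneg_pos)
  then have "D *\<^sub>V z = 0" by (simp add: D_def bop.diff_left)
  moreover have "bop_adj D = D" by (simp add: D_def adj_diff adj_positive P Q)
  ultimately have "cinner z z = 0" by (metis cinner.zero_right cinner_adj z_def)
  then have "z = 0" by (simp add: cinner_self)
  then show "P *\<^sub>V x = Q *\<^sub>V x" by (simp add: z_def D_def bop.diff_left)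
qed

text \<open>A positive root \<open>P\<close> of \<open>?S\<close> commutes with \<open>?S\<close>,
  and the root \<open>Q\<close> supplied by \<open>sqrt_exists\<close> commutes with everything that
  commutes with \<open>?S\<close>. So \<open>P\<close> and \<open>Q\<close> commute, as
  \<open>sqrt_unique\<close> demands.\<close>

lemma bop_abs: "positive_bop (bop_abs T)" "bop_abs T * bop_abs T = bop_adj T * (T :: 'h bop)"
proof -
  let ?S = "bop_adj T * T"
  obtain Q where Q: "positive_bop Q" "Q * Q = ?S" "\<And>C. ?S * C = C * ?S \<Longrightarrow> Q * C = C * Q"
    using sqrt_exists[OF positive_adj_mult[of T]] by blast
  have "\<exists>!P. positive_bop P \<and> P * P = ?S"
  proof (rule ex1I[of _ Q])
    fix P assume P: "positive_bop P \<and> P * P = ?S"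
    have "Q * P = P * Q" using P by (intro Q(3)) (metis mult.assoc)
    then show "P = Q" using P Q sqrt_unique by metis
  qed (simp add: Q)
  from theI'[OF this] show "positive_bop (bop_abs T)" "bop_abs T * bop_abs T = ?S"
    unfolding bop_abs_def by auto
qed

text \<open>Neumann series: P + \<epsilon> = c (1 - M), where \<parallel>M\<parallel> \<le>
  \<parallel>P\<parallel> / (\<parallel>P\<parallel> + \<epsilon>) < 1.\<close>

lemma inverse_positive_shift:
  fixes P :: "'h bop"
  assumes P: "positive_bop P" and \<epsilon>: "0 < \<epsilon>"
  obtains J where "J * (P + \<epsilon> *\<^sub>R 1) = 1" "(P + \<epsilon> *\<^sub>R 1) * J = 1"
proof -
  define c where "c = norm P + \<epsilon>"
  have c: "c > 0" using \<epsilon> by (simp add: c_def add_nonneg_pos)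
  define M where "M = (1/c) *\<^sub>R (norm P *\<^sub>R 1 - P)"
  have "norm (norm P *\<^sub>R 1 - P) \<le> norm P"
    using norm_shift_positive[OF P, of "norm P"] by (cases "P = 0") auto
  then have "norm M < 1" using c \<epsilon> by (simp add: M_def c_def)
  then have sm: "summable (\<lambda>n. M ^ n)" by (rule complete_algebra_summable_geometric)
  define X where "X = (\<Sum>n. M ^ n)"
  have X: "X = 1 + (\<Sum>n. M ^ Suc n)"
    unfolding X_def using suminf_split_head[OF sm] by simp
  have "(\<Sum>n. M ^ Suc n) = M * X"
    by (simp add: X_def suminf_mult[OF sm])
  moreover have "(\<Sum>n. M ^ Suc n) = X * M"
    by (simp add: X_def suminf_mult2[OF sm] power_Suc2 del: power_Suc)
  ultimately have "X = 1 + M * X" "X = 1 + X * M" using X by simp_all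
  then have inv: "(1 - M) * X = 1" "X * (1 - M) = 1"
    by (simp_all add: algebra_simps)
  moreover have "P + \<epsilon> *\<^sub>R 1 = c *\<^sub>R (1 - M)"
    using c by (simp add: M_def scaleR_diff_right) (simp add: c_def scaleR_add_left)
  ultimately have "((1/c) *\<^sub>R X) * (P + \<epsilon> *\<^sub>R 1) = 1" "(P + \<epsilon> *\<^sub>R 1) * ((1/c) *\<^sub>R X) = 1"
    using c by (simp_all add: inv)
  then show ?thesis by (rule that)
qed

text \<open>An approximate polar decomposition, with the contraction \<open>W = T (\<bar>T\<bar> + \<epsilon>)\<inverse>\<close>.\<close>

lemma approx_polar:
  fixes T :: "'h bop"
  assumes \<epsilon>: "0 < \<epsilon>"
  obtains W where "norm W \<le> 1" "norm (bop_abs T - bop_adj W * T) \<le> \<epsilon>"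
proof -
  define P where "P = bop_abs T"
  have P: "positive_bop P" "P * P = bop_adj T * T" unfolding P_def by (rule bop_abs)+
  define L where "L = P + \<epsilon> *\<^sub>R 1"
  obtain J where J: "J * L = 1" "L * J = 1"
    using inverse_positive_shift[OF P(1) \<epsilon>] unfolding L_def by blast
  have "bop_adj L = L" by (simp add: L_def adj_add adj_scaleR adj_positive P)
  then have "L * bop_adj J = 1" by (metis J(1) adj_mult adj_one)
  then have adj_J: "bop_adj J = J" by (metis J(1) mult.assoc mult.right_neutral mult_1)
  \<comment> \<open>With v = J x one has x = P v + \<epsilon> v. The cross term in
    \<parallel>x\<parallel>^2 is non-negative because \<open>P\<close> is positive, so \<parallel>P
    v\<parallel> \<le> \<parallel>x\<parallel>.\<close>
  have norm_PJ: "norm (P *\<^sub>V J *\<^sub>V x) \<le> norm x" for x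
  proof -
    define v where "v = J *\<^sub>V x"
    have "x = L *\<^sub>V v" by (simp add: v_def bop_times_apply[symmetric] J bop_one_apply)
    also have "\<dots> = P *\<^sub>V v + \<epsilon> *\<^sub>R v" by (simp add: L_def bop.add_left bop.scaleR_left bop_one_apply)
    finally have "(norm x)\<^sup>2 = (norm (P *\<^sub>V v))\<^sup>2 + 2 * (\<epsilon> * Re (cinner (P *\<^sub>V v) v)) + (norm (\<epsilon> *\<^sub>R v))\<^sup>2"
      by (simp add: power2_norm_add cinner.scaleR_right)
    moreover have "0 \<le> \<epsilon> * Re (cinner (P *\<^sub>V v) v)"
      using \<epsilon> positive_Re_nonneg[OF P(1), of v] by simp
    ultimately have "(norm (P *\<^sub>V v))\<^sup>2 \<le> (norm x)\<^sup>2"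
      using zero_le_power2[of "norm (\<epsilon> *\<^sub>R v)"] by linarith
    then have "norm (P *\<^sub>V v) \<le> norm x" by (rule power2_le_imp_le) simp
    then show ?thesis by (simp add: v_def)
  qed
  have norm_abs: "norm (T *\<^sub>V y) = norm (P *\<^sub>V y)" for y
  proof -
    have "cinner (T *\<^sub>V y) (T *\<^sub>V y) = cinner (P *\<^sub>V y) (P *\<^sub>V y)"
      by (metis P adj_positive bop_times_apply cinner_adj)
    then have "(norm (T *\<^sub>V y))\<^sup>2 = (norm (P *\<^sub>V y))\<^sup>2"
      by (simp only: cinner_self of_real_eq_iff)
    then show ?thesis by (simp add: power2_eq_iff_nonneg)
  qed
  show ?thesis
  proof (rule that[of "T * J"])
    show "norm (T * J) \<le> 1"
      by (rule norm_bop_le) (simp_all add: bop_times_apply norm_abs norm_PJ)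
    have "bop_adj (T * J) * T = J * (P * P)"
      by (simp add: adj_mult adj_J P mult.assoc)
    moreover have "P = J * (L * P)" by (metis J(1) mult.assoc mult_1)
    ultimately have "P - bop_adj (T * J) * T = J * (L * P - P * P)"
      by (simp add: algebra_simps)
    also have "\<dots> = \<epsilon> *\<^sub>R (J * P)" by (simp add: L_def algebra_simps)
    \<comment> \<open>Since J L = L J = 1, both products equal 1 - \<epsilon> J.\<close>
    also have "J * P = P * J"
    proof -
      have "J * P = 1 - \<epsilon> *\<^sub>R J" "P * J = 1 - \<epsilon> *\<^sub>R J"
        using J by (simp_all add: L_def algebra_simps)
      then show ?thesis by simp
    qed
    also have "norm (\<epsilon> *\<^sub>R (P * J)) \<le> \<epsilon> * 1"
      using \<epsilon> by (simp, intro norm_bop_le) (simp_all add: bop_times_apply norm_PJ)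
    finally show "norm (bop_abs T - bop_adj (T * J) * T) \<le> \<epsilon>" by (simp add: P_def)
  qed
qed

end

section \<open>Hilbert-Schmidt operators\<close>

context onb
begin

lemma cmod_cinner_adj: "cmod (cinner (bop_adj T *\<^sub>V x) y) = cmod (cinner (T *\<^sub>V y) (x::'h))"
  by (metis cinner_adj' cinner_commute complex_mod_cnj)

lemma has_sum_matrix_entries:
  assumes "onb C" "((\<lambda>f. (norm (T *\<^sub>V f))\<^sup>2) has_sum s) C"
  shows "((\<lambda>(f, e). (cmod (cinner (T *\<^sub>V f) (e::'h)))\<^sup>2) has_sum s) (C \<times> B)"
proof -
  have inner: "((\<lambda>e. (\<lambda>(f, e). (cmod (cinner (T *\<^sub>V f) e))\<^sup>2) (f, e)) has_sum (norm (T *\<^sub>V f))\<^sup>2) B" for f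
    using has_sum_norm[of "T *\<^sub>V f"] by simp
  show ?thesis
    by (rule has_sum_SigmaI[OF inner assms(2)], rule summable_on_SigmaI[OF inner])
       (use assms(2) in \<open>auto simp: summable_on_def\<close>)
qed

text \<open>The squared matrix entries are summed by columns instead of rows. With two bases this
  yields both the independence of the basis and the invariance under adjoints.\<close>

lemma has_sum_adj_basis:
  assumes C: "onb C" and T: "((\<lambda>f. (norm (T *\<^sub>V f))\<^sup>2) has_sum s) C"
  shows "((\<lambda>e. (norm (bop_adj T *\<^sub>V (e::'h)))\<^sup>2) has_sum s) B"
proof -
  interpret C: onb C by (rule C)
  have "((\<lambda>(e, f). (\<lambda>(f, e). (cmod (cinner (T *\<^sub>V f) e))\<^sup>2) (f, e)) has_sum s) (B \<times> C)"
    using has_sum_matrix_entries[OF assms] by (simp only: has_sum_swap[where A = C])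
  then show ?thesis
  proof (rule has_sum_SigmaD)
    show "((\<lambda>f. (\<lambda>(e, f). (\<lambda>(f, e). (cmod (cinner (T *\<^sub>V f) e))\<^sup>2) (f, e)) (e, f))
        has_sum (norm (bop_adj T *\<^sub>V e))\<^sup>2) C" for e
      using C.has_sum_norm[of "bop_adj T *\<^sub>V e"] by (simp add: cmod_cinner_adj)
  qed
qed

definition HS :: "'h bop \<Rightarrow> bool" where
  "HS T \<longleftrightarrow> (\<lambda>e. (norm (T *\<^sub>V e))\<^sup>2) summable_on B"

definition hs_norm :: "'h bop \<Rightarrow> real" where
  "hs_norm T = sqrt (\<Sum>\<^sub>\<infinity>e\<in>B. (norm (T *\<^sub>V e))\<^sup>2)"

lemma hs_norm_nonneg [simp]: "0 \<le> hs_norm T"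
  by (simp add: hs_norm_def infsum_nonneg)

lemma has_sum_hs_norm: "HS T \<Longrightarrow> ((\<lambda>e. (norm (T *\<^sub>V e))\<^sup>2) has_sum (hs_norm T)\<^sup>2) B"
  by (simp add: HS_def hs_norm_def infsum_nonneg)

lemma HS_adj: "HS T \<Longrightarrow> HS (bop_adj T)"
  using has_sum_adj_basis[OF onb_axioms has_sum_hs_norm] by (auto simp: HS_def summable_on_def)

lemma hs_norm_adj: "HS T \<Longrightarrow> hs_norm (bop_adj T) = hs_norm T"
  using has_sum_unique[OF has_sum_adj_basis[OF onb_axioms has_sum_hs_norm] has_sum_hs_norm[OF HS_adj]]
  by (simp add: power2_eq_iff_nonneg)

text \<open>Two transpositions: the first goes from the basis \<open>C\<close> to \<open>B\<close>
  at the price of an adjoint, the second stays in \<open>B\<close> and removes it.\<close>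

lemma HS_hilbert_schmidt: "hilbert_schmidt T \<Longrightarrow> HS T"
proof -
  assume "hilbert_schmidt T"
  then obtain C where C: "onb C" "(\<lambda>f. (norm (T *\<^sub>V f))\<^sup>2) summable_on C"
    by (auto simp: hilbert_schmidt_def onb_def)
  then have "HS (bop_adj T)"
    using has_sum_adj_basis[OF C(1)] by (auto simp: HS_def summable_on_def)
  then show "HS T" using HS_adj by fastforce
qed

lemma hs_finite_le:
  assumes "HS T" "finite F" "F \<subseteq> B"
  shows "(\<Sum>e\<in>F. (norm (T *\<^sub>V e))\<^sup>2) \<le> (hs_norm T)\<^sup>2"
  by (rule finite_sum_le_has_sum[OF has_sum_hs_norm[OF assms(1)] assms(2,3)]) simp

lemma L2_set_le_hs_norm:
  assumes "HS T" "finite F" "F \<subseteq> B"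
  shows "L2_set (\<lambda>e. norm (T *\<^sub>V e)) F \<le> hs_norm T"
  unfolding L2_set_def using hs_finite_le[OF assms] by (intro real_le_lsqrt) auto

text \<open>Stated through \<open>L2_set\<close> over finite sets, so that Minkowski's inequality
  can be applied before passing to infinite sums.\<close>

lemma HS_intro:
  assumes "\<And>F. finite F \<Longrightarrow> F \<subseteq> B \<Longrightarrow> L2_set (\<lambda>e. norm (T *\<^sub>V e)) F \<le> K" "0 \<le> K"
  shows "HS T" "hs_norm T \<le> K"
proof -
  have le: "(\<Sum>e\<in>F. (norm (T *\<^sub>V e))\<^sup>2) \<le> K\<^sup>2" if "finite F" "F \<subseteq> B" for F
    using assms(1)[OF that] unfolding L2_set_def by (rule sqrt_le_D)
  show HS: "HS T"
    unfolding HS_def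
    by (rule nonneg_bounded_partial_sums_imp_summable_on[where C = "K\<^sup>2"])
       (use le in \<open>auto intro!: eventually_finite_subsets_at_top_weakI\<close>)
  have "(hs_norm T)\<^sup>2 \<le> K\<^sup>2"
    by (rule has_sum_le_finite_sums[OF has_sum_hs_norm[OF HS]]) (use le in auto)
  then show "hs_norm T \<le> K" using assms(2) by (rule power2_le_imp_le)
qed

lemma HS_add:
  assumes "HS S" "HS T"
  shows "HS (S + T)" "hs_norm (S + T) \<le> hs_norm S + hs_norm T"
proof -
  have le: "L2_set (\<lambda>e. norm ((S + T) *\<^sub>V e)) F \<le> hs_norm S + hs_norm T" if F: "finite F" "F \<subseteq> B" for F
  proof -
    have "L2_set (\<lambda>e. norm ((S + T) *\<^sub>V e)) F \<le> L2_set (\<lambda>e. norm (S *\<^sub>V e) + norm (T *\<^sub>V e)) F"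
      by (intro L2_set_mono) (simp_all add: bop.add_left norm_triangle_ineq)
    also have "\<dots> \<le> L2_set (\<lambda>e. norm (S *\<^sub>V e)) F + L2_set (\<lambda>e. norm (T *\<^sub>V e)) F"
      by (rule L2_set_triangle_ineq)
    also have "\<dots> \<le> hs_norm S + hs_norm T"
      by (intro add_mono L2_set_le_hs_norm assms F)
    finally show ?thesis .
  qed
  show "HS (S + T)" "hs_norm (S + T) \<le> hs_norm S + hs_norm T"
    by (rule HS_intro[OF le]; simp)+
qed

lemma HS_mult_left:
  assumes "HS T"
  shows "HS (C * T)" "hs_norm (C * T) \<le> norm C * hs_norm T"
proof -
  have le: "L2_set (\<lambda>e. norm ((C * T) *\<^sub>V e)) F \<le> norm C * hs_norm T" if F: "finite F" "F \<subseteq> B" for F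
  proof -
    have "L2_set (\<lambda>e. norm ((C * T) *\<^sub>V e)) F \<le> L2_set (\<lambda>e. norm C * norm (T *\<^sub>V e)) F"
      by (intro L2_set_mono) (simp_all add: bop_times_apply norm_bop_apply)
    also have "\<dots> = norm C * L2_set (\<lambda>e. norm (T *\<^sub>V e)) F"
      by (simp add: L2_set_right_distrib)
    also have "\<dots> \<le> norm C * hs_norm T"
      by (intro mult_left_mono L2_set_le_hs_norm assms F) simp
    finally show ?thesis .
  qed
  show "HS (C * T)" "hs_norm (C * T) \<le> norm C * hs_norm T"
    by (rule HS_intro[OF le]; simp)+
qed

lemma HS_mult_right:
  assumes "HS T"
  shows "HS (T * C)" "hs_norm (T * C) \<le> norm C * hs_norm T"
proof -
  have H: "HS (bop_adj C * bop_adj T)" by (intro HS_mult_left HS_adj assms)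
  then show "HS (T * C)" using HS_adj[OF H] by (simp add: adj_mult)
  have "hs_norm (T * C) = hs_norm (bop_adj C * bop_adj T)"
    using hs_norm_adj[OF H] by (simp add: adj_mult)
  also have "\<dots> \<le> norm (bop_adj C) * hs_norm (bop_adj T)" by (intro HS_mult_left HS_adj assms)
  finally show "hs_norm (T * C) \<le> norm C * hs_norm T" by (simp add: hs_norm_adj assms)
qed

lemma HS_scaleC: "HS T \<Longrightarrow> HS (c *\<^sub>C T)" and hs_norm_scaleC: "hs_norm (c *\<^sub>C T) = cmod c * hs_norm T"
proof -
  have eq: "(norm ((c *\<^sub>C T) *\<^sub>V e))\<^sup>2 = (cmod c)\<^sup>2 * (norm (T *\<^sub>V e))\<^sup>2" for e
    by (simp add: bop_scaleC_apply norm_scaleC power_mult_distrib)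
  show "HS T \<Longrightarrow> HS (c *\<^sub>C T)"
    unfolding HS_def eq by (rule summable_on_cmult_right)
  show "hs_norm (c *\<^sub>C T) = cmod c * hs_norm T"
    unfolding hs_norm_def eq infsum_cmult_right' by (simp add: real_sqrt_mult)
qed

lemma HS_scaleR: "HS T \<Longrightarrow> HS (r *\<^sub>R T)" and hs_norm_scaleR: "hs_norm (r *\<^sub>R T) = \<bar>r\<bar> * hs_norm T"
  by (simp_all add: scaleR_scaleC HS_scaleC hs_norm_scaleC)

lemma HS_diff:
  assumes "HS S" "HS T"
  shows "HS (S - T)" "hs_norm (S - T) \<le> hs_norm S + hs_norm T"
  using HS_add[OF assms(1) HS_scaleR[OF assms(2), of "-1"]] hs_norm_scaleR[of "-1" T] by simp_all

lemma HS_zero [simp]: "HS 0" "hs_norm 0 = 0"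
  by (simp_all add: HS_def hs_norm_def bop.zero_left)

lemma HS_sum:
  assumes "\<And>i. i \<in> I \<Longrightarrow> HS (f i)"
  shows "HS (\<Sum>i\<in>I. f i)" "hs_norm (\<Sum>i\<in>I. f i) \<le> (\<Sum>i\<in>I. hs_norm (f i))"
proof -
  have "HS (\<Sum>i\<in>I. f i) \<and> hs_norm (\<Sum>i\<in>I. f i) \<le> (\<Sum>i\<in>I. hs_norm (f i))"
    using assms
    by (induction I rule: infinite_finite_induct)
       (auto intro: HS_add order_trans[OF HS_add(2)])
  then show "HS (\<Sum>i\<in>I. f i)" "hs_norm (\<Sum>i\<in>I. f i) \<le> (\<Sum>i\<in>I. hs_norm (f i))" by auto
qed

lemma sum_cinner_le:
  assumes "HS S" "HS T" "finite F" "F \<subseteq> B"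
  shows "(\<Sum>e\<in>F. cmod (cinner (S *\<^sub>V e) (T *\<^sub>V e))) \<le> hs_norm S * hs_norm T"
proof -
  have "(\<Sum>e\<in>F. cmod (cinner (S *\<^sub>V e) (T *\<^sub>V e)))
      \<le> (\<Sum>e\<in>F. \<bar>norm (S *\<^sub>V e)\<bar> * \<bar>norm (T *\<^sub>V e)\<bar>)"
    by (intro sum_mono) (simp add: cinner_bound)
  also have "\<dots> \<le> L2_set (\<lambda>e. norm (S *\<^sub>V e)) F * L2_set (\<lambda>e. norm (T *\<^sub>V e)) F"
    by (rule L2_set_mult_ineq)
  also have "\<dots> \<le> hs_norm S * hs_norm T"
    by (intro mult_mono L2_set_le_hs_norm assms) auto
  finally show ?thesis .
qed

section \<open>Trace class operators\<close>

text \<open>\<open>trace_bound T K\<close> says that the trace norm of \<open>T\<close> is at most \<open>K\<close>, in terms of the duality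
  with contractions; the finite sets \<open>F\<close> avoid convergence questions.\<close>

definition trace_bound :: "'h bop \<Rightarrow> real \<Rightarrow> bool" where
  "trace_bound T K \<longleftrightarrow> (\<forall>F W Z. finite F \<longrightarrow> F \<subseteq> B \<longrightarrow> norm W \<le> 1 \<longrightarrow> norm Z \<le> 1 \<longrightarrow>
     cmod (\<Sum>e\<in>F. cinner (T *\<^sub>V Z *\<^sub>V e) (W *\<^sub>V e)) \<le> K)"

definition trace :: "'h bop \<Rightarrow> complex" where
  "trace T = (\<Sum>\<^sub>\<infinity>e\<in>B. cinner (T *\<^sub>V e) e)"

lemma trace_boundI:
  assumes "\<And>F W Z. finite F \<Longrightarrow> F \<subseteq> B \<Longrightarrow> norm W \<le> 1 \<Longrightarrow> norm Z \<le> 1 \<Longrightarrow>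
     cmod (\<Sum>e\<in>F. cinner (T *\<^sub>V Z *\<^sub>V e) (W *\<^sub>V e)) \<le> K"
  shows "trace_bound T K"
  using assms unfolding trace_bound_def by blast

lemma trace_boundD:
  assumes "trace_bound T K" "finite F" "F \<subseteq> B" "norm W \<le> 1" "norm Z \<le> 1"
  shows "cmod (\<Sum>e\<in>F. cinner (T *\<^sub>V Z *\<^sub>V e) (W *\<^sub>V e)) \<le> K"
  using assms unfolding trace_bound_def by blast

lemma trace_bound_nonneg: "trace_bound T K \<Longrightarrow> 0 \<le> K"
  using trace_boundD[of T K "{}" 0 0] by simp

lemma trace_bound_mono: "trace_bound T K \<Longrightarrow> K \<le> L \<Longrightarrow> trace_bound T L"
  unfolding trace_bound_def by (meson order_trans)

lemma trace_bound_zero: "trace_bound 0 0"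
  by (rule trace_boundI) (simp add: bop.zero_left cinner.zero_left)

lemma trace_bound_add:
  assumes "trace_bound S K" "trace_bound T L"
  shows "trace_bound (S + T) (K + L)"
proof (rule trace_boundI)
  fix F and W Z :: "'h bop"
  assume F: "finite F" "F \<subseteq> B" "norm W \<le> 1" "norm Z \<le> 1"
  have "(\<Sum>e\<in>F. cinner ((S + T) *\<^sub>V Z *\<^sub>V e) (W *\<^sub>V e))
      = (\<Sum>e\<in>F. cinner (S *\<^sub>V Z *\<^sub>V e) (W *\<^sub>V e)) + (\<Sum>e\<in>F. cinner (T *\<^sub>V Z *\<^sub>V e) (W *\<^sub>V e))"
    by (simp add: bop.add_left cinner.add_left sum.distrib)
  then show "cmod (\<Sum>e\<in>F. cinner ((S + T) *\<^sub>V Z *\<^sub>V e) (W *\<^sub>V e)) \<le> K + L"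
    using trace_boundD[OF assms(1) F] trace_boundD[OF assms(2) F] by (simp add: norm_triangle_mono)
qed

lemma trace_bound_scaleC:
  assumes "trace_bound T K"
  shows "trace_bound (c *\<^sub>C T) (cmod c * K)"
proof (rule trace_boundI)
  fix F and W Z :: "'h bop"
  assume F: "finite F" "F \<subseteq> B" "norm W \<le> 1" "norm Z \<le> 1"
  show "cmod (\<Sum>e\<in>F. cinner ((c *\<^sub>C T) *\<^sub>V Z *\<^sub>V e) (W *\<^sub>V e)) \<le> cmod c * K"
    using trace_boundD[OF assms F]
    by (simp add: bop_scaleC_apply cinner_scaleC_left sum_distrib_left[symmetric] norm_mult mult_left_mono)
qed

lemma trace_bound_scaleR: "trace_bound T K \<Longrightarrow> trace_bound (r *\<^sub>R T) (\<bar>r\<bar> * K)"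
  using trace_bound_scaleC[of T K "of_real r"] by (simp add: scaleR_scaleC)

lemma trace_bound_sum:
  "(\<And>i. i \<in> I \<Longrightarrow> trace_bound (f i) (k i)) \<Longrightarrow> trace_bound (\<Sum>i\<in>I. f i) (\<Sum>i\<in>I. k i)"
  by (induction I rule: infinite_finite_induct) (auto intro: trace_bound_zero trace_bound_add)

lemma norm_mult_contraction: "norm C \<le> 1 \<Longrightarrow> norm D \<le> 1 \<Longrightarrow> norm (C * D :: 'h bop) \<le> 1"
  by (rule order_trans[OF norm_mult_ineq]) (simp add: mult_le_one)

text \<open>The test contractions \<open>W\<close> and \<open>Z\<close> are built into
  \<open>trace_bound\<close> so that a factor on either side is simply absorbed into one of
  them.\<close>

lemma trace_bound_mult_left:
  assumes "trace_bound T K" "norm C \<le> 1"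
  shows "trace_bound (C * T) K"
proof (rule trace_boundI)
  fix F and W Z :: "'h bop"
  assume F: "finite F" "F \<subseteq> B" "norm W \<le> 1" "norm Z \<le> 1"
  have "norm (bop_adj C * W) \<le> 1" using assms(2) F by (simp add: norm_mult_contraction)
  from trace_boundD[OF assms(1) F(1,2) this F(4)]
  show "cmod (\<Sum>e\<in>F. cinner ((C * T) *\<^sub>V Z *\<^sub>V e) (W *\<^sub>V e)) \<le> K"
    by (simp add: bop_times_apply cinner_adj)
qed

lemma trace_bound_mult_right:
  assumes "trace_bound T K" "norm C \<le> 1"
  shows "trace_bound (T * C) K"
proof (rule trace_boundI)
  fix F and W Z :: "'h bop"
  assume F: "finite F" "F \<subseteq> B" "norm W \<le> 1" "norm Z \<le> 1"
  have "norm (C * Z) \<le> 1" using assms(2) F by (simp add: norm_mult_contraction)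
  from trace_boundD[OF assms(1) F(1,2,3) this]
  show "cmod (\<Sum>e\<in>F. cinner ((T * C) *\<^sub>V Z *\<^sub>V e) (W *\<^sub>V e)) \<le> K"
    by (simp add: bop_times_apply)
qed

text \<open>The factor \<open>S\<close> moves to the other side of the inner product, and the finite
  Cauchy-Schwarz inequality is applied to \<open>T * Z\<close> and
  \<open>bop_adj S * W\<close>.\<close>

lemma trace_bound_HS:
  assumes "HS S" "HS T"
  shows "trace_bound (S * T) (hs_norm S * hs_norm T)"
proof (rule trace_boundI)
  fix F and W Z :: "'h bop"
  assume F: "finite F" "F \<subseteq> B" "norm W \<le> 1" "norm Z \<le> 1"
  have TZ: "HS (T * Z)" "hs_norm (T * Z) \<le> hs_norm T"
    using HS_mult_right[OF assms(2), of Z] F(4) mult_left_le_one_le[of "hs_norm T" "norm Z"] by auto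
  have SW: "HS (bop_adj S * W)" "hs_norm (bop_adj S * W) \<le> hs_norm S"
    using HS_mult_right[OF HS_adj[OF assms(1)], of W] F(3) hs_norm_adj[OF assms(1)]
      mult_left_le_one_le[of "hs_norm S" "norm W"] by auto
  have "cmod (\<Sum>e\<in>F. cinner ((S * T) *\<^sub>V Z *\<^sub>V e) (W *\<^sub>V e))
      \<le> (\<Sum>e\<in>F. cmod (cinner ((T * Z) *\<^sub>V e) ((bop_adj S * W) *\<^sub>V e)))"
    by (rule order_trans[OF norm_sum]) (simp add: bop_times_apply cinner_adj)
  also have "\<dots> \<le> hs_norm (T * Z) * hs_norm (bop_adj S * W)"
    by (intro sum_cinner_le TZ SW F)
  also have "\<dots> \<le> hs_norm T * hs_norm S"
    by (intro mult_mono TZ SW) auto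
  finally show "cmod (\<Sum>e\<in>F. cinner ((S * T) *\<^sub>V Z *\<^sub>V e) (W *\<^sub>V e)) \<le> hs_norm S * hs_norm T"
    by (simp add: mult.commute)
qed

lemma basis_nonempty: "B \<noteq> {}"
proof
  assume "B = {}"
  then have "(UNIV :: 'h set) = {0}" using onb by (simp add: is_onb_def)
  then show False using UNIV_not_singleton by blast
qed

lemma rank_one_exists:
  obtains Z where "\<And>z. Z *\<^sub>V z = cinner z e *\<^sub>C (x :: 'h)" "norm Z \<le> norm e * norm x"
proof -
  obtain Z where Z: "\<And>z. Z *\<^sub>V z = cinner z e *\<^sub>C x"
  proof (rule bop_exists[of "\<lambda>z. cinner z e *\<^sub>C x" "norm e * norm x"])
    show "norm (cinner z e *\<^sub>C x) \<le> norm z * (norm e * norm x)" for z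
      unfolding norm_scaleC mult.assoc[symmetric] by (intro mult_right_mono cinner_bound) simp
  qed (auto simp: cinner.add_left scaleC_add_left cinner_scaleC_left scaleC_scaleC)
  moreover have "norm Z \<le> norm e * norm x"
  proof (rule norm_bop_le)
    fix z show "norm (Z *\<^sub>V z) \<le> norm e * norm x * norm z"
      using mult_right_mono[OF cinner_bound[of z e], of "norm x"] by (simp add: Z norm_scaleC mult_ac)
  qed simp
  ultimately show ?thesis by (rule that)
qed

text \<open>The test operators have rank one: \<open>Z\<close> sends one basis vector
  \<open>e\<close> to the direction of \<open>x\<close> and \<open>W\<close> sends it to the
  direction of \<open>y\<close>, so that the sum over \<open>{e}\<close> is \<parallel>y\<parallel>
  / \<parallel>x\<parallel>.\<close>

lemma norm_le_trace_bound:
  assumes "trace_bound T K"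
  shows "norm T \<le> K"
proof (rule norm_bop_le[OF trace_bound_nonneg[OF assms]])
  fix x
  obtain e where e: "e \<in> B" using basis_nonempty by blast
  define y where "y = T *\<^sub>V x"
  show "norm (T *\<^sub>V x) \<le> K * norm x"
  proof (cases "x = 0 \<or> y = 0")
    case True
    then show ?thesis using trace_bound_nonneg[OF assms] by (auto simp: y_def bop.zero_right)
  next
    case False
    obtain Z where Z: "\<And>z. Z *\<^sub>V z = cinner z e *\<^sub>C (inverse (norm x) *\<^sub>R x)"
      "norm Z \<le> norm e * norm (inverse (norm x) *\<^sub>R x)"
      using rank_one_exists[where e = e and x = "inverse (norm x) *\<^sub>R x"] by blast
    obtain W where W: "\<And>z. W *\<^sub>V z = cinner z e *\<^sub>C (inverse (norm y) *\<^sub>R y)"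
      "norm W \<le> norm e * norm (inverse (norm y) *\<^sub>R y)"
      using rank_one_exists[where e = e and x = "inverse (norm y) *\<^sub>R y"] by blast
    have one: "1 *\<^sub>C z = z" for z :: 'h using scaleR_scaleC[of 1 z] by simp
    have "cmod (\<Sum>e\<in>{e}. cinner (T *\<^sub>V Z *\<^sub>V e) (W *\<^sub>V e)) \<le> K"
      by (rule trace_boundD[OF assms]) (use Z(2) W(2) e False in \<open>auto simp: norm_basis\<close>)
    then have "inverse (norm x) * (inverse (norm y) * (norm y)\<^sup>2) \<le> K"
      using e by (simp add: Z W norm_basis one bop.scaleR_right y_def[symmetric] cinner.scaleR_left
          cinner.scaleR_right cinner_self norm_mult norm_power mult_ac)
    then show ?thesis using False by (simp add: y_def[symmetric] power2_eq_square field_simps)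
  qed
qed

text \<open>The identity as test operator bounds the sums over all finite subsets by
  \<open>K\<close>. Passing from these to absolute values costs the factor 4, one for each sign of
  the real and the imaginary part.\<close>

lemma trace_bound_abs_summable:
  assumes "trace_bound T K"
  shows "(\<lambda>e. cmod (cinner (T *\<^sub>V e) e)) summable_on B" "(\<Sum>\<^sub>\<infinity>e\<in>B. cmod (cinner (T *\<^sub>V e) e)) \<le> 4 * K"
proof -
  have sub: "cmod (\<Sum>e\<in>F. cinner (T *\<^sub>V e) e) \<le> K" if "finite F" "F \<subseteq> B" for F
    using trace_boundD[OF assms that, of 1 1] by (simp add: bop_one_apply)
  have le: "(\<Sum>e\<in>F. cmod (cinner (T *\<^sub>V e) e)) \<le> 4 * K" if F: "finite F" "F \<subseteq> B" for F
    using sum_norm_allsubsets_bound[OF F(1), of "\<lambda>e. cinner (T *\<^sub>V e) e" K] sub F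
    by (simp add: finite_subset subset_trans)
  show sm: "(\<lambda>e. cmod (cinner (T *\<^sub>V e) e)) summable_on B"
    by (rule nonneg_bounded_partial_sums_imp_summable_on[where C = "4 * K"])
       (use le in \<open>auto intro!: eventually_finite_subsets_at_top_weakI\<close>)
  show "(\<Sum>\<^sub>\<infinity>e\<in>B. cmod (cinner (T *\<^sub>V e) e)) \<le> 4 * K"
    by (rule infsum_le_finite_sums[OF sm]) (use le in auto)
qed

section \<open>The trace functional: linearity, cyclicity and convergence\<close>

lemma has_sum_trace: "trace_bound T K \<Longrightarrow> ((\<lambda>e. cinner (T *\<^sub>V e) e) has_sum trace T) B"
  unfolding trace_def
  by (rule has_sum_infsum, rule abs_summable_summable, rule trace_bound_abs_summable(1))

lemma cmod_trace_le:
  assumes "trace_bound T K"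
  shows "cmod (trace T) \<le> 4 * K"
  unfolding trace_def
  by (rule order_trans[OF norm_infsum_bound]) (use trace_bound_abs_summable[OF assms] in auto)

lemma trace_add:
  assumes "trace_bound S K" "trace_bound T L"
  shows "trace (S + T) = trace S + trace T"
  by (rule has_sum_unique[OF has_sum_trace[OF trace_bound_add[OF assms]]])
     (use has_sum_add[OF has_sum_trace[OF assms(1)] has_sum_trace[OF assms(2)]]
      in \<open>simp add: bop.add_left cinner.add_left\<close>)

lemma trace_scaleC: "trace (c *\<^sub>C T) = c * trace T"
  by (simp add: trace_def bop_scaleC_apply cinner_scaleC_left infsum_cmult_right')

lemma trace_scaleR: "trace (r *\<^sub>R T) = of_real r * trace T"
  by (simp add: scaleR_scaleC trace_scaleC)

lemma trace_diff: "trace_bound S K \<Longrightarrow> trace_bound T L \<Longrightarrow> trace (S - T) = trace S - trace T"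
  using trace_add[OF _ trace_bound_scaleR[of T L "-1"], of S K] trace_scaleR[of "-1" T] by simp

lemma trace_sum:
  assumes "\<And>i. i \<in> I \<Longrightarrow> trace_bound (f i) (k i)"
  shows "trace (\<Sum>i\<in>I. f i) = (\<Sum>i\<in>I. trace (f i))"
  using assms
proof (induction I rule: infinite_finite_induct)
  case (insert i I)
  have "trace (f i + (\<Sum>i\<in>I. f i)) = trace (f i) + trace (\<Sum>i\<in>I. f i)"
    by (rule trace_add[where K = "k i" and L = "sum k I"]) (auto intro: trace_bound_sum insert.prems)
  moreover have "trace (\<Sum>i\<in>I. f i) = (\<Sum>i\<in>I. trace (f i))"
    by (rule insert.IH) (simp add: insert.prems)
  ultimately show ?case by (simp add: insert.hyps)
qed (simp_all add: trace_def bop.zero_left cinner.zero_left)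

text \<open>Both sides are iterated sums of the same products of matrix entries. The double sum
  converges absolutely by x y \<le> x^2 + y^2, so the order can be exchanged.\<close>

lemma trace_commute:
  assumes S: "HS S" and T: "HS T"
  shows "trace (S * T) = trace (T * S)"
proof -
  have entries: "(\<lambda>(e, f). (cmod (cinner (X *\<^sub>V e) f))\<^sup>2) summable_on B \<times> B" if "HS X" for X
    using has_sum_matrix_entries[OF onb_axioms has_sum_hs_norm[OF that]] by (auto simp: summable_on_def)
  have entries': "(\<lambda>(e, f). (cmod (cinner (S *\<^sub>V f) e))\<^sup>2) summable_on B \<times> B"
    using entries[OF S] by (subst summable_on_swap) simp
  define a where "a = (\<lambda>e f. cinner (T *\<^sub>V e) f * cinner (S *\<^sub>V f) e)"
  have "(\<lambda>p. norm (case p of (e, f) \<Rightarrow> a e f)) summable_on B \<times> B"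
  proof (rule summable_on_comparison_test)
    show "(\<lambda>p. (case p of (e, f) \<Rightarrow> (cmod (cinner (T *\<^sub>V e) f))\<^sup>2)
        + (case p of (e, f) \<Rightarrow> (cmod (cinner (S *\<^sub>V f) e))\<^sup>2)) summable_on B \<times> B"
      by (intro summable_on_add entries T entries')
    show "norm (case p of (e, f) \<Rightarrow> a e f) \<le> (case p of (e, f) \<Rightarrow> (cmod (cinner (T *\<^sub>V e) f))\<^sup>2)
        + (case p of (e, f) \<Rightarrow> (cmod (cinner (S *\<^sub>V f) e))\<^sup>2)" for p
    proof (cases p)
      case (Pair e f)
      have "x * y \<le> x\<^sup>2 + y\<^sup>2" if "0 \<le> x" "0 \<le> y" for x y :: real
        using sum_squares_bound[of x y] that mult_nonneg_nonneg[of x y] by linarith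
      then show ?thesis by (simp add: Pair a_def norm_mult)
    qed
  qed simp
  then have "(\<lambda>(e, f). a e f) summable_on B \<times> B" by (rule abs_summable_summable)
  then have "(\<Sum>\<^sub>\<infinity>e\<in>B. \<Sum>\<^sub>\<infinity>f\<in>B. a e f) = (\<Sum>\<^sub>\<infinity>f\<in>B. \<Sum>\<^sub>\<infinity>e\<in>B. a e f)"
    by (rule infsum_swap_banach)
  moreover have "(\<Sum>\<^sub>\<infinity>f\<in>B. a e f) = cinner ((S * T) *\<^sub>V e) e" for e
    using infsumI[OF has_sum_cinner[of "T *\<^sub>V e" "bop_adj S *\<^sub>V e"]]
    by (simp add: a_def bop_times_apply cinner_adj)
  moreover have "(\<Sum>\<^sub>\<infinity>e\<in>B. a e f) = cinner ((T * S) *\<^sub>V f) f" for f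
    using infsumI[OF has_sum_cinner[of "S *\<^sub>V f" "bop_adj T *\<^sub>V f"]]
    by (simp add: a_def bop_times_apply cinner_adj mult.commute)
  ultimately show ?thesis by (simp add: trace_def)
qed

text \<open>\<open>trace_class\<close> speaks of the absolute value, while
  \<open>trace_bound\<close> tests \<open>T\<close> itself. The approximate polar decomposition
  links them: the diagonal entries of \<open>P\<close> are the inner products of \<open>T e\<close>
  with \<open>W e\<close>, up to a small error.\<close>

lemma trace_class_trace_bound:
  assumes "trace_bound T K"
  shows "trace_class T"
  unfolding trace_class_def
proof (intro exI conjI)
  show "is_onb B" by (rule onb)
  define P where "P = bop_abs T"
  have P: "positive_bop P" unfolding P_def by (rule bop_abs)
  have le: "(\<Sum>e\<in>F. Re (cinner (P *\<^sub>V e) e)) \<le> K" if F: "finite F" "F \<subseteq> B" for F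
  proof (rule field_le_epsilon)
    fix \<epsilon> :: real assume "\<epsilon> > 0"
    \<comment> \<open>The error \<open>d\<close> occurs once for each element of \<open>F\<close>;
      the 1 in the denominator covers the empty set.\<close>
    define d where "d = \<epsilon> / (real (card F) + 1)"
    have "d > 0" using \<open>\<epsilon> > 0\<close> by (simp add: d_def)
    then obtain W where W: "norm W \<le> 1" "norm (P - bop_adj W * T) \<le> d"
      unfolding P_def by (rule approx_polar)
    have d: "Re (cinner ((P - bop_adj W * T) *\<^sub>V e) e) \<le> d" if "e \<in> F" for e
    proof -
      have "norm e = 1" using that F norm_basis by blast
      then have "cmod (cinner ((P - bop_adj W * T) *\<^sub>V e) e) \<le> d"
        using cinner_bound[of "(P - bop_adj W * T) *\<^sub>V e" e] norm_bop_apply[of "P - bop_adj W * T" e] W(2)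
        by simp
      then show ?thesis using complex_Re_le_cmod order_trans by blast
    qed
    have "(\<Sum>e\<in>F. Re (cinner (P *\<^sub>V e) e))
        = (\<Sum>e\<in>F. Re (cinner ((P - bop_adj W * T) *\<^sub>V e) e)) + Re (\<Sum>e\<in>F. cinner (T *\<^sub>V 1 *\<^sub>V e) (W *\<^sub>V e))"
      by (simp add: sum.distrib[symmetric] bop.diff_left cinner.diff_left bop_times_apply cinner_adj' bop_one_apply)
    also have "\<dots> \<le> real (card F) * d + K"
    proof (rule add_mono)
      show "(\<Sum>e\<in>F. Re (cinner ((P - bop_adj W * T) *\<^sub>V e) e)) \<le> real (card F) * d"
        by (rule sum_bounded_above[OF d])
      show "Re (\<Sum>e\<in>F. cinner (T *\<^sub>V 1 *\<^sub>V e) (W *\<^sub>V e)) \<le> K"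
        by (rule order_trans[OF complex_Re_le_cmod]) (rule trace_boundD[OF assms F W(1)], simp)
    qed
    also have "real (card F) * d \<le> \<epsilon>"
      using \<open>\<epsilon> > 0\<close> by (simp add: d_def divide_simps mult.commute)
    finally show "(\<Sum>e\<in>F. Re (cinner (P *\<^sub>V e) e)) \<le> K + \<epsilon>" by simp
  qed
  have "(\<lambda>e. Re (cinner (P *\<^sub>V e) e)) summable_on B"
    by (rule nonneg_bounded_partial_sums_imp_summable_on[where C = K])
       (use le positive_Re_nonneg[OF P] in \<open>auto intro!: eventually_finite_subsets_at_top_weakI\<close>)
  then have "(\<lambda>e. complex_of_real (Re (cinner (P *\<^sub>V e) e))) summable_on B"
    by (rule summable_on_of_real)
  moreover have "complex_of_real (Re (cinner (P *\<^sub>V e) e)) = cinner (P *\<^sub>V e) e" for e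
    using P by (simp add: positive_bop_iff complex_eq_iff)
  ultimately show "(\<lambda>e. cinner (bop_abs T *\<^sub>V e) e) summable_on B"
    by (simp add: P_def)
qed

text \<open>For fixed \<open>F\<close>, \<open>W\<close> and \<open>Z\<close> the tested sum is a
  bounded linear functional of the operator, so convergence in operator norm is enough to pass to
  the limit.\<close>

lemma trace_bound_has_sum:
  assumes f: "(f has_sum T) I" and k: "(k has_sum s) I"
    and tb: "\<And>i. i \<in> I \<Longrightarrow> trace_bound (f i) (k i)"
  shows "trace_bound T s"
proof (rule trace_boundI)
  fix F and W Z :: "'h bop"
  assume F: "finite F" "F \<subseteq> B" "norm W \<le> 1" "norm Z \<le> 1"
  define \<phi> where "\<phi> = (\<lambda>T. \<Sum>e\<in>F. cinner (T *\<^sub>V Z *\<^sub>V e) (W *\<^sub>V e))"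
  have "bounded_linear \<phi>"
    unfolding \<phi>_def
    by (intro bounded_linear_sum bounded_linear_compose[OF cinner.bounded_linear_left bop.bounded_linear_left])
  then have "((\<lambda>i. \<phi> (f i)) has_sum \<phi> T) I"
    by (rule has_sum_bounded_linear[OF _ f])
  from norm_infsum_le[OF this k] have "cmod (\<phi> T) \<le> s"
    using trace_boundD[OF tb F] by (simp add: \<phi>_def)
  then show "cmod (\<Sum>e\<in>F. cinner (T *\<^sub>V Z *\<^sub>V e) (W *\<^sub>V e)) \<le> s"
    by (simp add: \<phi>_def)
qed

text \<open>The trace need not be continuous in operator norm, so the tail
  \<open>T - sum f F\<close> is controlled through its trace bound, which is a tail of
  \<open>k\<close>.\<close>

lemma trace_has_sum:
  assumes f: "(f has_sum T) I" and k: "k summable_on I"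
    and tb: "\<And>i. i \<in> I \<Longrightarrow> trace_bound (f i) (k i)"
  shows "((\<lambda>i. trace (f i)) has_sum trace T) I"
  unfolding has_sum_def
proof (rule tendstoI)
  fix \<epsilon> :: real assume "\<epsilon> > 0"
  then have "\<forall>\<^sub>F F in finite_subsets_at_top I. dist (sum k F) (infsum k I) < \<epsilon> / 8"
    using k by (intro tendstoD) (auto simp: has_sum_def[symmetric])
  moreover have "\<forall>\<^sub>F F in finite_subsets_at_top I. finite F \<and> F \<subseteq> I"
    by (intro eventually_finite_subsets_at_top_weakI) auto
  ultimately show "\<forall>\<^sub>F F in finite_subsets_at_top I. dist (\<Sum>i\<in>F. trace (f i)) (trace T) < \<epsilon>"
  proof eventually_elim
    case (elim F)
    then have F: "finite F" "F \<subseteq> I" by auto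
    have rest: "trace_bound (T - sum f F) (infsum k I - sum k F)"
      by (rule trace_bound_has_sum[where I = "I - F" and f = f and k = k])
        (use F k f tb in \<open>auto intro!: has_sum_Diff simp: has_sum_finite\<close>)
    have "trace (T - sum f F) = trace T - (\<Sum>i\<in>F. trace (f i))"
      using F tb
      by (subst trace_diff[OF trace_bound_has_sum[OF f has_sum_infsum[OF k] tb] trace_bound_sum[of F f k]])
         (auto simp: trace_sum[of F f k] subset_iff)
    then have "dist (\<Sum>i\<in>F. trace (f i)) (trace T) \<le> 4 * (infsum k I - sum k F)"
      using cmod_trace_le[OF rest] by (simp add: dist_norm norm_minus_commute)
    also have "\<dots> \<le> 4 * dist (sum k F) (infsum k I)"
      using abs_ge_minus_self[of "sum k F - infsum k I"] by (simp add: dist_real_def)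
    also have "\<dots> < \<epsilon>" using elim(1) \<open>\<epsilon> > 0\<close> by linarith
    finally show ?case .
  qed
qed

end

section \<open>A transference inequality\<close>

lemma sum_telescope_int:
  fixes G :: "int \<Rightarrow> 'b::ab_group_add"
  assumes "p \<le> q"
  shows "(\<Sum>a\<in>{p..<q}. G (a + 1) - G a) = G q - G p"
  using assms
proof (induction q rule: int_ge_induct)
  case (step q)
  then have "{p..<q + 1} = insert q {p..<q}" by auto
  then show ?case using step by simp
qed simp

definition root_of_unity :: "nat \<Rightarrow> nat \<Rightarrow> complex" where
  "root_of_unity K j = cis (2 * pi * real j / real K)"

lemma sum_roots_of_unity:
  assumes "K > 0"
  shows "(\<Sum>j<K. root_of_unity K j powi m) = (if int K dvd m then of_nat K else 0)"
proof -
  define q where "q = cis (2 * pi * real_of_int m / real K)"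
  have eq: "root_of_unity K j powi m = q ^ j" for j
    unfolding root_of_unity_def q_def cis_power_int Complex.DeMoivre by (simp add: mult_ac)
  have "q ^ K = cis (2 * pi * real_of_int m)"
    using assms unfolding q_def Complex.DeMoivre by simp
  then have qK: "q ^ K = 1" by (simp only: cis_multiple_2pi[OF Ints_of_int])
  have q1: "q = 1 \<longleftrightarrow> int K dvd m"
  proof
    assume "int K dvd m"
    then obtain k where "m = int K * k" by blast
    then have "2 * pi * real_of_int m / real K = 2 * pi * real_of_int k" using assms by simp
    then show "q = 1" unfolding q_def by (simp only: cis_multiple_2pi[OF Ints_of_int])
  next
    assume "q = 1"
    then obtain n :: int where "2 * pi * real_of_int m / real K = real_of_int n * 2 * pi"
      unfolding q_def by (auto simp: complex_eq_iff cos_one_2pi_int)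
    then have "real_of_int m = real_of_int (n * int K)" using assms by (simp add: field_simps)
    then have "m = n * int K" by (simp only: of_int_eq_iff)
    then show "int K dvd m" by simp
  qed
  show ?thesis
  proof (cases "int K dvd m")
    case True
    then show ?thesis using q1 by (simp add: eq)
  next
    case False
    then have "(\<Sum>j<K. q ^ j) = 0" using q1 qK by (simp add: geometric_sum)
    then show ?thesis using False by (simp add: eq)
  qed
qed

text \<open>For \<open>u\<close> on the torus this is the character of frequency \<open>p\<close>.
  Read in \<open>p\<close> it is a character of the lattice, which is how the finite Fourier
  transform uses it.\<close>

definition torus_char :: "complex \<times> complex \<Rightarrow> int \<times> int \<Rightarrow> complex" where
  "torus_char u p = fst u powi fst p * snd u powi snd p"

definition root_grid :: "nat \<Rightarrow> (complex \<times> complex) set" where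
  "root_grid K = (\<lambda>(j, l). (root_of_unity K j, root_of_unity K l)) ` ({..<K} \<times> {..<K})"

lemma root_of_unity_inj: "inj_on (root_of_unity K) {..<K}"
proof (rule inj_onI)
  fix i j assume ij: "i \<in> {..<K}" "j \<in> {..<K}" and eq: "root_of_unity K i = root_of_unity K j"
  then have K: "K > 0" by auto
  have "root_of_unity K i * cnj (root_of_unity K j) = 1"
    unfolding eq by (simp add: root_of_unity_def cis_cnj cis_mult)
  then have "cis (2 * pi * (real i - real j) / real K) = 1"
    using K by (simp add: root_of_unity_def cis_cnj cis_mult diff_divide_distrib right_diff_distrib)
  then obtain n :: int where "2 * pi * (real i - real j) / real K = real_of_int n * 2 * pi"
    by (auto simp: complex_eq_iff cos_one_2pi_int)
  then have "2 * pi * (real i - real j) = 2 * pi * (real_of_int n * real K)"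
    using K by (simp add: field_simps)
  then have "real_of_int (int i - int j) = real_of_int (n * int K)"
    by (subst (asm) mult_cancel_left) simp
  then have n: "int i - int j = n * int K" by (simp only: of_int_eq_iff)
  have "\<bar>int i - int j\<bar> < int K" using ij by auto
  then have "n = 0" unfolding n by (simp add: abs_mult) (smt (verit) K mult_le_cancel_right1 of_nat_0_less_iff)
  then show "i = j" using n by simp
qed

lemma sum_root_grid:
  assumes "K > 0"
  shows "(\<Sum>u\<in>root_grid K. torus_char u p) = (if int K dvd fst p \<and> int K dvd snd p then (of_nat K)\<^sup>2 else 0)"
proof -
  have inj: "inj_on (\<lambda>(j, l). (root_of_unity K j, root_of_unity K l)) ({..<K} \<times> {..<K})"
    using root_of_unity_inj[of K] by (auto simp: inj_on_def)
  have "(\<Sum>u\<in>root_grid K. torus_char u p)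
      = (\<Sum>(j, l)\<in>{..<K} \<times> {..<K}. root_of_unity K j powi fst p * root_of_unity K l powi snd p)"
    unfolding root_grid_def by (subst sum.reindex[OF inj]) (simp add: torus_char_def case_prod_unfold)
  also have "\<dots> = (\<Sum>j<K. root_of_unity K j powi fst p) * (\<Sum>l<K. root_of_unity K l powi snd p)"
    by (simp add: sum_product sum.cartesian_product)
  finally show ?thesis
    using assms by (simp add: sum_roots_of_unity power2_eq_square)
qed

lemma root_grid_unit:
  assumes "u \<in> root_grid K"
  shows "cmod (fst u) = 1" "cmod (snd u) = 1"
  using assms by (auto simp: root_grid_def root_of_unity_def)

lemma torus_char_add:
  assumes "cmod (fst u) = 1" "cmod (snd u) = 1"
  shows "torus_char u (p + q) = torus_char u p * torus_char u q"
proof -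
  have "fst u \<noteq> 0" "snd u \<noteq> 0" using assms by auto
  then show ?thesis by (simp add: torus_char_def power_int_add)
qed

lemma cnj_torus_char:
  assumes "cmod (fst u) = 1" "cmod (snd u) = 1"
  shows "cnj (torus_char u p) = torus_char u (- p)"
proof -
  have "cnj z = inverse z" if "cmod z = 1" for z
    using that by (metis complex_mod_cnj complex_norm_square divide_complex_def inverse_eq_divide
        mult.commute nonzero_eq_divide_eq norm_one norm_zero of_real_1 power_one zero_neq_one)
  then show ?thesis using assms by (simp add: torus_char_def power_int_minus power_int_inverse)
qed

text \<open>Orthogonality of characters keeps the pairs with p congruent to q + s modulo
  \<open>K\<close>. The assumption on congruent pairs excludes aliasing, so that the cyclic
  correlation equals the correlation on the lattice.\<close>

lemma sum_char_cinner:
  fixes x y :: "int \<times> int \<Rightarrow> 'a::complex_hilbert"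
  assumes K: "K > 0" and fin: "finite P" "finite Q" and sub: "\<And>q. q \<in> Q \<Longrightarrow> q + s \<in> P"
    and sep: "\<And>p q. p \<in> P \<Longrightarrow> q \<in> Q \<Longrightarrow> int K dvd fst (s - p + q) \<Longrightarrow> int K dvd snd (s - p + q) \<Longrightarrow> p = q + s"
  shows "(\<Sum>u\<in>root_grid K. torus_char u s *
      cinner (\<Sum>p\<in>P. torus_char u (- p) *\<^sub>C x p) (\<Sum>q\<in>Q. torus_char u (- q) *\<^sub>C y q))
    = (of_nat K)\<^sup>2 * (\<Sum>q\<in>Q. cinner (x (q + s)) (y q))"
proof -
  have "(\<Sum>u\<in>root_grid K. torus_char u s *
      cinner (\<Sum>p\<in>P. torus_char u (- p) *\<^sub>C x p) (\<Sum>q\<in>Q. torus_char u (- q) *\<^sub>C y q))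
    = (\<Sum>u\<in>root_grid K. \<Sum>q\<in>Q. \<Sum>p\<in>P. torus_char u (s - p + q) * cinner (x p) (y q))"
  proof (rule sum.cong[OF refl])
    fix u assume "u \<in> root_grid K"
    then have u: "cmod (fst u) = 1" "cmod (snd u) = 1" by (simp_all add: root_grid_unit)
    have "torus_char u (s - p + q) = torus_char u s * (torus_char u (- p) * cnj (torus_char u (- q)))" for p q
    proof -
      have "s - p + q = s + (- p + q)" by simp
      then show ?thesis by (simp only: torus_char_add[OF u] cnj_torus_char[OF u]) simp
    qed
    then show "torus_char u s *
        cinner (\<Sum>p\<in>P. torus_char u (- p) *\<^sub>C x p) (\<Sum>q\<in>Q. torus_char u (- q) *\<^sub>C y q)
      = (\<Sum>q\<in>Q. \<Sum>p\<in>P. torus_char u (s - p + q) * cinner (x p) (y q))"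
      by (simp add: cinner.sum_left cinner.sum_right cinner_scaleC_left cinner_scaleC_right sum_distrib_left mult_ac)
  qed
  also have "\<dots> = (\<Sum>q\<in>Q. \<Sum>u\<in>root_grid K. \<Sum>p\<in>P. torus_char u (s - p + q) * cinner (x p) (y q))"
    by (rule sum.swap)
  also have "\<dots> = (\<Sum>q\<in>Q. \<Sum>p\<in>P. (\<Sum>u\<in>root_grid K. torus_char u (s - p + q)) * cinner (x p) (y q))"
    by (rule sum.cong[OF refl]) (subst sum.swap, simp only: sum_distrib_right)
  also have "\<dots> = (\<Sum>q\<in>Q. \<Sum>p\<in>P. (if p = q + s then (of_nat K)\<^sup>2 * cinner (x p) (y q) else 0))"
  proof (rule sum.cong[OF refl], rule sum.cong[OF refl])
    fix p q assume "q \<in> Q" "p \<in> P"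
    show "(\<Sum>u\<in>root_grid K. torus_char u (s - p + q)) * cinner (x p) (y q)
        = (if p = q + s then (of_nat K)\<^sup>2 * cinner (x p) (y q) else 0)"
    proof (cases "p = q + s")
      case True
      then show ?thesis by (simp add: sum_root_grid[OF K])
    next
      case False
      then have "\<not> (int K dvd fst (s - p + q) \<and> int K dvd snd (s - p + q))"
        using sep[OF \<open>p \<in> P\<close> \<open>q \<in> Q\<close>] by blast
      then show ?thesis unfolding sum_root_grid[OF K] using False by auto
    qed
  qed
  also have "\<dots> = (\<Sum>q\<in>Q. (of_nat K)\<^sup>2 * cinner (x (q + s)) (y q))"
    using fin sub by (intro sum.cong refl) simp
  finally show ?thesis by (simp add: sum_distrib_left)
qed

text \<open>Plancherel: the correlation identity with shift 0 and \<open>y = x\<close>.\<close>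

lemma sum_norm_char:
  fixes x :: "int \<times> int \<Rightarrow> 'a::complex_hilbert"
  assumes K: "K > 0" and fin: "finite P"
    and sep: "\<And>p q. p \<in> P \<Longrightarrow> q \<in> P \<Longrightarrow> int K dvd fst (q - p) \<Longrightarrow> int K dvd snd (q - p) \<Longrightarrow> p = q"
  shows "L2_set (\<lambda>u. norm (\<Sum>p\<in>P. torus_char u (- p) *\<^sub>C x p)) (root_grid K)
    = real K * L2_set (\<lambda>p. norm (x p)) P"
proof -
  have "torus_char u 0 = 1" for u by (simp add: torus_char_def)
  moreover have "(of_nat K)\<^sup>2 = complex_of_real ((real K)\<^sup>2)" by simp
  ultimately have "complex_of_real (\<Sum>u\<in>root_grid K. (norm (\<Sum>p\<in>P. torus_char u (- p) *\<^sub>C x p))\<^sup>2)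
      = of_real ((real K)\<^sup>2 * (\<Sum>p\<in>P. (norm (x p))\<^sup>2))"
    using sum_char_cinner[of K P P 0 x x] assms by (simp add: cinner_self del: of_real_power)
  then have "(\<Sum>u\<in>root_grid K. (norm (\<Sum>p\<in>P. torus_char u (- p) *\<^sub>C x p))\<^sup>2)
      = (real K)\<^sup>2 * (\<Sum>p\<in>P. (norm (x p))\<^sup>2)"
    by (simp only: of_real_eq_iff)
  then show ?thesis by (simp add: L2_set_def real_sqrt_mult)
qed

text \<open>Discrete Fourier transform on \<open>(\<int>/K)\<^sup>2\<close>: the box of side \<open>3M + 1\<close> that contains all
  shifts of the box of side \<open>M + 1\<close> embeds into it for \<open>K = 3M + 1\<close>.\<close>

lemma transference_vector:
  fixes x y :: "int \<times> int \<Rightarrow> 'a::complex_hilbert" and M :: nat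
  defines "P \<equiv> {- int M..2 * int M} \<times> {- int M..2 * int M}" and "Q \<equiv> {0..int M} \<times> {0..int M}"
  assumes fin: "finite I"
    and s: "\<And>i. i \<in> I \<Longrightarrow> s i \<in> {- int M..int M} \<times> {- int M..int M}"
    and bound: "\<And>u. cmod (fst u) = 1 \<Longrightarrow> cmod (snd u) = 1 \<Longrightarrow> cmod (\<Sum>i\<in>I. c i * torus_char u (s i)) \<le> H"
  shows "cmod (\<Sum>i\<in>I. c i * (\<Sum>q\<in>Q. cinner (x (q + s i)) (y q)))
    \<le> H * (L2_set (\<lambda>p. norm (x p)) P * L2_set (\<lambda>q. norm (y q)) Q)"
proof -
  define K where "K = 3 * M + 1"
  have K: "K > 0" by (simp add: K_def)
  have finP: "finite P" "finite Q" by (simp_all add: P_def Q_def)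
  have small: "d = 0" if "int K dvd d" "\<bar>d\<bar> < int K" for d
    using that dvd_imp_le_int[of d "int K"] by force
  define X where "X = (\<lambda>u. \<Sum>p\<in>P. torus_char u (- p) *\<^sub>C x p)"
  define Y where "Y = (\<lambda>u. \<Sum>q\<in>Q. torus_char u (- q) *\<^sub>C y q)"
  have pair: "(\<Sum>u\<in>root_grid K. torus_char u (s i) * cinner (X u) (Y u))
      = (of_nat K)\<^sup>2 * (\<Sum>q\<in>Q. cinner (x (q + s i)) (y q))" if "i \<in> I" for i
    unfolding X_def Y_def
  proof (rule sum_char_cinner[OF K finP])
    show "q + s i \<in> P" if "q \<in> Q" for q
      using that s[OF \<open>i \<in> I\<close>] by (cases q; cases "s i") (auto simp: P_def Q_def)
    fix p q assume p: "p \<in> P" and q: "q \<in> Q" and d: "int K dvd fst (s i - p + q)" "int K dvd snd (s i - p + q)"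
    have "\<bar>fst (s i - p + q)\<bar> < int K" "\<bar>snd (s i - p + q)\<bar> < int K"
      using p q s[OF \<open>i \<in> I\<close>] by (cases p; cases q; cases "s i"; auto simp: P_def Q_def K_def)+
    then have "fst (s i - p + q) = 0" "snd (s i - p + q) = 0" using small d by blast+
    then show "p = q + s i" by (simp add: prod_eq_iff)
  qed
  have normX: "L2_set (\<lambda>u. norm (X u)) (root_grid K) = real K * L2_set (\<lambda>p. norm (x p)) P"
    unfolding X_def
  proof (rule sum_norm_char[OF K finP(1)])
    fix p q assume p: "p \<in> P" and q: "q \<in> P" and d: "int K dvd fst (q - p)" "int K dvd snd (q - p)"
    have "\<bar>fst (q - p)\<bar> < int K" "\<bar>snd (q - p)\<bar> < int K"
      using p q by (cases p; cases q; auto simp: P_def K_def)+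
    then have "fst (q - p) = 0" "snd (q - p) = 0" using small d by blast+
    then show "p = q" by (simp add: prod_eq_iff)
  qed
  have normY: "L2_set (\<lambda>u. norm (Y u)) (root_grid K) = real K * L2_set (\<lambda>q. norm (y q)) Q"
    unfolding Y_def
  proof (rule sum_norm_char[OF K finP(2)])
    fix p q assume p: "p \<in> Q" and q: "q \<in> Q" and d: "int K dvd fst (q - p)" "int K dvd snd (q - p)"
    have "\<bar>fst (q - p)\<bar> < int K" "\<bar>snd (q - p)\<bar> < int K"
      using p q by (cases p; cases q; auto simp: Q_def K_def)+
    then have "fst (q - p) = 0" "snd (q - p) = 0" using small d by blast+
    then show "p = q" by (simp add: prod_eq_iff)
  qed
  have H: "0 \<le> H" using order_trans[OF norm_ge_zero bound[of "(1, 1)"]] by simp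
  define S where "S = (\<Sum>i\<in>I. c i * (\<Sum>q\<in>Q. cinner (x (q + s i)) (y q)))"
  have "(of_nat K)\<^sup>2 * S = (\<Sum>i\<in>I. c i * (\<Sum>u\<in>root_grid K. torus_char u (s i) * cinner (X u) (Y u)))"
    unfolding S_def sum_distrib_left by (intro sum.cong refl) (simp add: pair sum_distrib_left[symmetric])
  \<comment> \<open>After the exchange of sums the shifts act as multiplication by their symbol,
    which is at most \<open>H\<close> in modulus at every grid point.\<close>
  also have "\<dots> = (\<Sum>u\<in>root_grid K. (\<Sum>i\<in>I. c i * torus_char u (s i)) * cinner (X u) (Y u))"
    unfolding sum_distrib_left sum_distrib_right by (subst sum.swap) (simp add: mult.assoc)
  finally have "(real K)\<^sup>2 * cmod S = cmod (\<Sum>u\<in>root_grid K. (\<Sum>i\<in>I. c i * torus_char u (s i)) * cinner (X u) (Y u))"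
    by (metis norm_mult norm_of_nat norm_power)
  also have "\<dots> \<le> (\<Sum>u\<in>root_grid K. H * (\<bar>norm (X u)\<bar> * \<bar>norm (Y u)\<bar>))"
  proof (rule sum_norm_le)
    fix u assume "u \<in> root_grid K"
    then show "cmod ((\<Sum>i\<in>I. c i * torus_char u (s i)) * cinner (X u) (Y u))
        \<le> H * (\<bar>norm (X u)\<bar> * \<bar>norm (Y u)\<bar>)"
      unfolding norm_mult abs_norm_cancel
      by (intro mult_mono bound cinner_bound H root_grid_unit) auto
  qed
  also have "\<dots> \<le> H * (L2_set (\<lambda>u. norm (X u)) (root_grid K) * L2_set (\<lambda>u. norm (Y u)) (root_grid K))"
    unfolding sum_distrib_left[symmetric] by (intro mult_left_mono L2_set_mult_ineq H)
  also have "\<dots> = (real K)\<^sup>2 * (H * (L2_set (\<lambda>p. norm (x p)) P * L2_set (\<lambda>q. norm (y q)) Q))"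
    by (simp add: normX normY power2_eq_square mult_ac)
  finally show ?thesis using K by (simp add: S_def)
qed

section \<open>Laurent polynomials of a pair of unitary operators\<close>

lemma has_sum_finite_sum:
  fixes f :: "'i \<Rightarrow> 'a \<Rightarrow> 'b::topological_comm_monoid_add"
  assumes "\<And>i. i \<in> I \<Longrightarrow> (f i has_sum s i) A"
  shows "((\<lambda>x. \<Sum>i\<in>I. f i x) has_sum (\<Sum>i\<in>I. s i)) A"
  using assms by (induction I rule: infinite_finite_induct) (simp_all add: has_sum_add)

context onb
begin

section \<open>Integer powers of unitary operators and their divided differences\<close>

lemma unitary_powi_Suc:
  assumes V: "unitary_bop V"
  shows "unitary_powi V (n + 1) = V * (unitary_powi V n :: 'h bop)"
proof (cases "n \<ge> 0")
  case True
  then show ?thesis by (simp add: unitary_powi_def nat_add_distrib)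
next
  case False
  then obtain k where n: "n = - int (Suc k)" by (metis negD not_le)
  have "unitary_powi V n = bop_adj V * bop_adj V ^ k"
    by (simp add: unitary_powi_def n del: of_nat_Suc)
  then have "V * unitary_powi V n = bop_adj V ^ k"
    using V by (simp add: mult.assoc[symmetric] unitary_bop_def)
  moreover have "unitary_powi V (n + 1) = bop_adj V ^ k"
    by (cases k) (simp_all add: unitary_powi_def n nat_add_distrib)
  ultimately show ?thesis by simp
qed

lemma unitary_powi_diff_one:
  assumes V: "unitary_bop V"
  shows "unitary_powi V (n - 1) = bop_adj V * (unitary_powi V n :: 'h bop)"
  using unitary_powi_Suc[OF V, of "n - 1"] V
  by (simp add: mult.assoc[symmetric] unitary_bop_def)

lemma unitary_powi_add:
  assumes V: "unitary_bop V"
  shows "unitary_powi V (m + n) = unitary_powi V m * (unitary_powi V n :: 'h bop)"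
proof (induction m rule: int_induct[where k = 0])
  case base
  then show ?case by (simp add: unitary_powi_def)
next
  case (step1 i)
  have "unitary_powi V (i + 1 + n) = V * unitary_powi V (i + n)"
    using unitary_powi_Suc[OF V, of "i + n"] by (simp add: algebra_simps)
  then show ?case using step1 by (simp add: unitary_powi_Suc[OF V] mult.assoc)
next
  case (step2 i)
  have "unitary_powi V (i - 1 + n) = bop_adj V * unitary_powi V (i + n)"
    using unitary_powi_diff_one[OF V, of "i + n"] by (simp add: algebra_simps)
  then show ?case using step2 by (simp add: unitary_powi_diff_one[OF V] mult.assoc)
qed

lemma unitary_unitary_powi: "unitary_bop V \<Longrightarrow> unitary_bop (unitary_powi V n :: 'h bop)"
  by (simp add: unitary_powi_def unitary_power unitary_adj)

lemma norm_unitary_powi: "unitary_bop V \<Longrightarrow> norm (unitary_powi V n :: 'h bop) \<le> 1"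
  by (intro norm_unitary unitary_unitary_powi)

text \<open>The exponents \<open>a\<close> in \<open>z\<^sup>n - w\<^sup>n = sgn n \<Sum>\<^sub>a z\<^sup>a (z - w) w\<^sup>(n - 1 - a)\<close>.\<close>

definition divdiff_exps :: "int \<Rightarrow> int set" where
  "divdiff_exps n = {min 0 n..<max 0 n}"

lemma sum_divdiff_telescope:
  fixes G :: "int \<Rightarrow> 'b::real_vector"
  shows "(\<Sum>a\<in>divdiff_exps n. G (a + 1) - G a) = of_int (sgn n) *\<^sub>R (G n - G 0)"
  using sum_telescope_int[of "min 0 n" "max 0 n" G]
  by (cases "n \<ge> 0"; cases "n = 0") (auto simp: divdiff_exps_def min_def max_def)

text \<open>\<open>G a\<close> telescopes from V^n at 0 to U^n at \<open>n\<close>. For negative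
  \<open>n\<close> the exponents run from \<open>n\<close> up to -1, and \<open>sgn n\<close>
  corrects the orientation.\<close>

lemma unitary_powi_diff:
  assumes U: "unitary_bop U" and V: "unitary_bop V"
  shows "unitary_powi U n - unitary_powi V n
    = of_int (sgn n) *\<^sub>R (\<Sum>a\<in>divdiff_exps n. unitary_powi U a * (U - V) * unitary_powi V (n - 1 - a) :: 'h bop)"
proof -
  define G where "G = (\<lambda>a. unitary_powi U a * unitary_powi V (n - a))"
  have "unitary_powi U a * (U - V) * unitary_powi V (n - 1 - a) = G (a + 1) - G a" for a
  proof -
    have "unitary_powi U (a + 1) = unitary_powi U a * U"
      using unitary_powi_add[OF U, of a 1] by (simp add: unitary_powi_def[of U 1])
    moreover have "unitary_powi V (n - a) = V * unitary_powi V (n - 1 - a)"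
      using unitary_powi_Suc[OF V, of "n - 1 - a"] by (simp add: algebra_simps)
    ultimately show ?thesis by (simp add: G_def algebra_simps mult.assoc)
  qed
  then have "(\<Sum>a\<in>divdiff_exps n. unitary_powi U a * (U - V) * unitary_powi V (n - 1 - a))
      = of_int (sgn n) *\<^sub>R (G n - G 0)"
    by (simp add: sum_divdiff_telescope)
  moreover have "G n = unitary_powi U n" "G 0 = unitary_powi V n"
    by (simp_all add: G_def unitary_powi_def[of _ 0])
  ultimately show ?thesis
    by (cases n "0 :: int" rule: linorder_cases) (simp_all add: unitary_powi_def[of _ 0])
qed

lemma HS_unitary_powi_diff:
  assumes U: "unitary_bop U" and V: "unitary_bop V" and D: "HS (U - V)"
  shows "HS (unitary_powi U n - unitary_powi V n)"
    "hs_norm (unitary_powi U n - unitary_powi V n) \<le> \<bar>real_of_int n\<bar> * hs_norm (U - V)"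
proof -
  let ?t = "\<lambda>a. unitary_powi U a * (U - V) * unitary_powi V (n - 1 - a)"
  have t: "HS (?t a)" "hs_norm (?t a) \<le> hs_norm (U - V)" for a
  proof -
    show "HS (?t a)" by (intro HS_mult_left HS_mult_right D)
    have "hs_norm (?t a) \<le> norm (unitary_powi V (n - 1 - a)) * hs_norm (unitary_powi U a * (U - V))"
      by (intro HS_mult_right HS_mult_left D)
    also have "\<dots> \<le> 1 * (1 * hs_norm (U - V))"
      by (intro mult_mono order_trans[OF HS_mult_left(2)[OF D]] norm_unitary_powi U V) auto
    finally show "hs_norm (?t a) \<le> hs_norm (U - V)" by simp
  qed
  show "HS (unitary_powi U n - unitary_powi V n)"
    unfolding unitary_powi_diff[OF U V] by (intro HS_scaleR HS_sum t)
  have "hs_norm (unitary_powi U n - unitary_powi V n) \<le> hs_norm (\<Sum>a\<in>divdiff_exps n. ?t a)"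
    unfolding unitary_powi_diff[OF U V] hs_norm_scaleR by (simp add: sgn_if)
  also have "\<dots> \<le> (\<Sum>a\<in>divdiff_exps n. hs_norm (?t a))" by (intro HS_sum t)
  also have "\<dots> \<le> of_nat (card (divdiff_exps n)) * hs_norm (U - V)"
    by (intro sum_bounded_above t)
  also have "card (divdiff_exps n) = nat \<bar>n\<bar>"
    by (auto simp: divdiff_exps_def)
  finally show "hs_norm (unitary_powi U n - unitary_powi V n) \<le> \<bar>real_of_int n\<bar> * hs_norm (U - V)" by simp
qed

text \<open>Multiplication by unitaries on both sides preserves the Hilbert-Schmidt inner product.
  This makes all shifts by \<open>q\<close> in the transference argument contribute the same
  number.\<close>

lemma trace_conj_unitary:
  assumes X: "HS X" and Y: "HS Y" and a: "unitary_bop a" and b: "unitary_bop b"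
  shows "trace (bop_adj (a * Y * b) * (a * X * b)) = trace (bop_adj Y * X)"
proof -
  have "bop_adj a * (a * Z) = Z" "b * (bop_adj b * Z) = Z" for Z
    using a b by (simp_all add: mult.assoc[symmetric] unitary_bop_def)
  then have eq: "bop_adj (a * Y * b) * (a * X * b) = (bop_adj b * bop_adj Y) * (X * b)"
    and eq': "(X * b) * (bop_adj b * bop_adj Y) = X * bop_adj Y"
    by (simp_all add: adj_mult mult.assoc)
  then have "trace (bop_adj (a * Y * b) * (a * X * b)) = trace ((X * b) * (bop_adj b * bop_adj Y))"
    unfolding eq by (intro trace_commute HS_mult_left HS_mult_right HS_adj X Y)
  also have "\<dots> = trace (X * bop_adj Y)" by (simp only: eq')
  also have "trace (X * bop_adj Y) = trace (bop_adj Y * X)"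
    by (intro trace_commute X HS_adj Y)
  finally show ?thesis .
qed

lemma L2_set_two:
  assumes "finite P"
  shows "(L2_set (\<lambda>e. L2_set (f e) P) F)\<^sup>2 = (\<Sum>p\<in>P. \<Sum>e\<in>F. (f e p)\<^sup>2)"
  by (subst sum.swap) (simp add: L2_set_def sum_nonneg)

text \<open>The orbit of \<open>X\<close> over a box is fed into the vector inequality, one basis
  vector \<open>e\<close> at a time. By unitary invariance each of the (M + 1)^2 shifts contributes
  the same trace, while the orbits of \<open>X\<close> and \<open>Y\<close> have norms at most
  \<open>sqrt (card P)\<close> and \<open>sqrt (card Q)\<close> times those of \<open>X\<close> and
  \<open>Y\<close>. The quotient (3 M + 1) / (M + 1) is at most 3, so the constant does not depend
  on \<open>M\<close>.\<close>

lemma transference: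
  fixes X Y U V :: "'h bop" and M :: nat
  assumes U: "unitary_bop U" and V: "unitary_bop V" and X: "HS X" and Y: "HS Y"
    and fin: "finite I"
    and s: "\<And>i. i \<in> I \<Longrightarrow> s i \<in> {- int M..int M} \<times> {- int M..int M}"
    and bound: "\<And>u. cmod (fst u) = 1 \<Longrightarrow> cmod (snd u) = 1 \<Longrightarrow> cmod (\<Sum>i\<in>I. c i * torus_char u (s i)) \<le> H"
  shows "cmod (\<Sum>i\<in>I. c i * trace (bop_adj Y * (unitary_powi U (fst (s i)) * X * unitary_powi V (snd (s i)))))
    \<le> 3 * H * (hs_norm X * hs_norm Y)"
proof -
  define P where "P = {- int M..2 * int M} \<times> {- int M..2 * int M}"
  define Q where "Q = {0..int M} \<times> {0..int M}"
  define T where "T = (\<lambda>Z p. unitary_powi U (fst p) * Z * unitary_powi V (snd p))"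
  have finPQ: "finite P" "finite Q" by (simp_all add: P_def Q_def)
  have HT: "HS (T Z p)" "hs_norm (T Z p) \<le> hs_norm Z" if "HS Z" for Z p
  proof -
    show "HS (T Z p)" unfolding T_def by (intro HS_mult_left HS_mult_right that)
    have "hs_norm (T Z p) \<le> norm (unitary_powi V (snd p)) * hs_norm (unitary_powi U (fst p) * Z)"
      unfolding T_def by (intro HS_mult_right HS_mult_left that)
    also have "\<dots> \<le> 1 * (1 * hs_norm Z)"
      by (intro mult_mono order_trans[OF HS_mult_left(2)[OF that]] norm_unitary_powi U V) auto
    finally show "hs_norm (T Z p) \<le> hs_norm Z" by simp
  qed
  have T_add: "T Z (q + r) = unitary_powi U (fst q) * T Z r * unitary_powi V (snd q)" for Z q r
    using unitary_powi_add[OF U, of "fst q" "fst r"] unitary_powi_add[OF V, of "snd r" "snd q"]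
    by (simp add: T_def mult.assoc add.commute)
  have H: "0 \<le> H" using order_trans[OF norm_ge_zero bound[of "(1, 1)"]] by simp
  define \<beta> where "\<beta> = (\<lambda>i. trace (bop_adj Y * T X (s i)))"
  have sums: "((\<lambda>e. \<Sum>i\<in>I. c i * (\<Sum>q\<in>Q. cinner (T X (q + s i) *\<^sub>V e) (T Y q *\<^sub>V e)))
      has_sum (\<Sum>i\<in>I. c i * (\<Sum>q\<in>Q. \<beta> i))) B"
  proof (intro has_sum_finite_sum has_sum_cmult_right)
    fix i q assume "i \<in> I" "q \<in> Q"
    have "trace (bop_adj (T Y q) * T X (q + s i)) = \<beta> i"
      unfolding \<beta>_def T_add
      using trace_conj_unitary[OF HT(1)[OF X] Y unitary_unitary_powi[OF U] unitary_unitary_powi[OF V]]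
      by (simp add: T_def)
    then show "((\<lambda>e. cinner (T X (q + s i) *\<^sub>V e) (T Y q *\<^sub>V e)) has_sum \<beta> i) B"
      using has_sum_trace[OF trace_bound_HS[OF HS_adj[OF HT(1)[OF Y]] HT(1)[OF X]], of q "q + s i"]
      by (simp add: bop_times_apply cinner_adj')
  qed
  have le: "L2_set (\<lambda>e. L2_set (\<lambda>p. norm (T Z p *\<^sub>V e)) R) F \<le> sqrt (card R) * hs_norm Z"
    if "HS Z" "finite F" "F \<subseteq> B" "finite R" for Z F R
  proof (rule power2_le_imp_le)
    have "(L2_set (\<lambda>e. L2_set (\<lambda>p. norm (T Z p *\<^sub>V e)) R) F)\<^sup>2 = (\<Sum>p\<in>R. \<Sum>e\<in>F. (norm (T Z p *\<^sub>V e))\<^sup>2)"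
      by (rule L2_set_two[OF that(4)])
    also have "\<dots> \<le> (\<Sum>p\<in>R. (hs_norm Z)\<^sup>2)"
      by (intro sum_mono order_trans[OF hs_finite_le[OF HT(1)]] power_mono HT(2) that) simp_all
    finally show "(L2_set (\<lambda>e. L2_set (\<lambda>p. norm (T Z p *\<^sub>V e)) R) F)\<^sup>2 \<le> (sqrt (card R) * hs_norm Z)\<^sup>2"
      by (simp add: power_mult_distrib)
  qed simp
  have part: "cmod (\<Sum>e\<in>F. \<Sum>i\<in>I. c i * (\<Sum>q\<in>Q. cinner (T X (q + s i) *\<^sub>V e) (T Y q *\<^sub>V e)))
      \<le> H * ((3 * real M + 1) * hs_norm X * ((real M + 1) * hs_norm Y))" if F: "finite F" "F \<subseteq> B" for F
  proof -
    have "cmod (\<Sum>e\<in>F. \<Sum>i\<in>I. c i * (\<Sum>q\<in>Q. cinner (T X (q + s i) *\<^sub>V e) (T Y q *\<^sub>V e)))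
      \<le> (\<Sum>e\<in>F. H * (\<bar>L2_set (\<lambda>p. norm (T X p *\<^sub>V e)) P\<bar> * \<bar>L2_set (\<lambda>q. norm (T Y q *\<^sub>V e)) Q\<bar>))"
      unfolding P_def Q_def
      by (intro sum_norm_le, simp, rule transference_vector[OF fin s bound])
    also have "\<dots> \<le> H * (L2_set (\<lambda>e. L2_set (\<lambda>p. norm (T X p *\<^sub>V e)) P) F
        * L2_set (\<lambda>e. L2_set (\<lambda>q. norm (T Y q *\<^sub>V e)) Q) F)"
      unfolding sum_distrib_left[symmetric] by (intro mult_left_mono L2_set_mult_ineq H)
    also have "\<dots> \<le> H * ((sqrt (card P) * hs_norm X) * (sqrt (card Q) * hs_norm Y))"
      by (intro mult_left_mono mult_mono le X Y F finPQ H) auto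
    also have "sqrt (card P) = 3 * real M + 1"
      unfolding P_def card_cartesian_product of_nat_mult real_sqrt_mult_self
      by (simp add: nat_add_distrib)
    also have "sqrt (card Q) = real M + 1"
      unfolding Q_def card_cartesian_product of_nat_mult real_sqrt_mult_self
      by (simp add: nat_add_distrib)
    finally show ?thesis .
  qed
  have "cmod (\<Sum>i\<in>I. c i * (\<Sum>q\<in>Q. \<beta> i)) \<le> H * ((3 * real M + 1) * hs_norm X * ((real M + 1) * hs_norm Y))"
    using sums unfolding has_sum_def
    by (rule tendsto_norm[THEN tendsto_upperbound])
       (use part in \<open>auto intro!: eventually_finite_subsets_at_top_weakI\<close>)
  also have "(\<Sum>i\<in>I. c i * (\<Sum>q\<in>Q. \<beta> i)) = (of_nat (card Q)) * (\<Sum>i\<in>I. c i * \<beta> i)"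
    by (simp add: sum_distrib_left mult_ac)
  also have "card Q = (M + 1) * (M + 1)"
    by (simp add: Q_def card_cartesian_product nat_add_distrib)
  also have "cmod (of_nat ((M + 1) * (M + 1)) * (\<Sum>i\<in>I. c i * \<beta> i))
      = (real M + 1) * ((real M + 1) * cmod (\<Sum>i\<in>I. c i * \<beta> i))"
    by (simp only: norm_mult norm_of_nat) (simp only: of_nat_mult of_nat_add of_nat_1 mult.assoc)
  finally have "(real M + 1) * ((real M + 1) * cmod (\<Sum>i\<in>I. c i * \<beta> i))
      \<le> (real M + 1) * ((3 * real M + 1) * (H * (hs_norm X * hs_norm Y)))"
    by (simp only: mult_ac)
  then have "(real M + 1) * cmod (\<Sum>i\<in>I. c i * \<beta> i) \<le> (3 * real M + 1) * (H * (hs_norm X * hs_norm Y))"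
    by (rule mult_left_le_imp_le) simp
  also have "\<dots> \<le> (3 * real M + 3) * (H * (hs_norm X * hs_norm Y))"
    by (intro mult_right_mono) (auto intro!: mult_nonneg_nonneg H)
  finally have "(real M + 1) * cmod (\<Sum>i\<in>I. c i * \<beta> i) \<le> (real M + 1) * (3 * H * (hs_norm X * hs_norm Y))"
    by (simp add: algebra_simps)
  then have "cmod (\<Sum>i\<in>I. c i * \<beta> i) \<le> 3 * H * (hs_norm X * hs_norm Y)"
    by (rule mult_left_le_imp_le) simp
  then show ?thesis by (simp add: \<beta>_def T_def)
qed

text \<open>Off the diagonal \<open>h\<close> is a difference quotient of the polynomial, so the
  Lipschitz constant bounds it; the diagonal is reached by continuity.\<close>

lemma torus_divdiff_bound:
  fixes d :: "int \<Rightarrow> complex" and I :: "int set"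
  defines "h \<equiv> \<lambda>u. \<Sum>(n, a)\<in>Sigma I divdiff_exps. d n * of_int (sgn n) * torus_char u (a, n - 1 - a)"
  assumes fin: "finite I"
    and lip: "\<And>z w. cmod z = 1 \<Longrightarrow> cmod w = 1 \<Longrightarrow>
      cmod ((\<Sum>n\<in>I. d n * z powi n) - (\<Sum>n\<in>I. d n * w powi n)) \<le> H * cmod (z - w)"
    and u: "cmod (fst u) = 1" "cmod (snd u) = 1"
  shows "cmod (h u) \<le> H"
proof -
  have finS: "finite (divdiff_exps n)" for n by (simp add: divdiff_exps_def)
  have mult: "(z - w) * h (z, w) = (\<Sum>n\<in>I. d n * z powi n) - (\<Sum>n\<in>I. d n * w powi n)"
    if "z \<noteq> 0" "w \<noteq> 0" for z w
  proof -
    have "(z - w) * (\<Sum>a\<in>divdiff_exps n. of_int (sgn n) * torus_char (z, w) (a, n - 1 - a)) = z powi n - w powi n" for n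
    proof -
      define G where "G = (\<lambda>a. z powi a * w powi (n - a))"
      have "(z - w) * torus_char (z, w) (a, n - 1 - a) = G (a + 1) - G a" for a
      proof -
        have "w powi (n - a) = w * w powi (n - 1 - a)"
          using that power_int_add[of w "n - 1 - a" 1] by (simp add: algebra_simps)
        moreover have "z powi (a + 1) = z powi a * z" using that by (simp add: power_int_add)
        ultimately show ?thesis by (simp add: G_def torus_char_def algebra_simps)
      qed
      then have "(\<Sum>a\<in>divdiff_exps n. (z - w) * torus_char (z, w) (a, n - 1 - a)) = of_int (sgn n) *\<^sub>R (G n - G 0)"
        by (simp add: sum_divdiff_telescope)
      moreover have "G n = z powi n" "G 0 = w powi n" by (simp_all add: G_def)
      ultimately show ?thesis
        by (cases n "0 :: int" rule: linorder_cases) (simp_all add: sum_distrib_left sum_negf mult_ac)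
    qed
    then have "(\<Sum>n\<in>I. d n * ((z - w) * (\<Sum>a\<in>divdiff_exps n. of_int (sgn n) * torus_char (z, w) (a, n - 1 - a))))
        = (\<Sum>n\<in>I. d n * z powi n) - (\<Sum>n\<in>I. d n * w powi n)"
      by (simp only: right_diff_distrib sum_subtractf)
    moreover have "(z - w) * h (z, w)
        = (\<Sum>n\<in>I. d n * ((z - w) * (\<Sum>a\<in>divdiff_exps n. of_int (sgn n) * torus_char (z, w) (a, n - 1 - a))))"
      unfolding h_def using fin finS
      by (simp add: sum.Sigma[symmetric] sum_distrib_left mult_ac)
    ultimately show ?thesis by simp
  qed
  have off: "cmod (h (z, w)) \<le> H" if "cmod z = 1" "cmod w = 1" "z \<noteq> w" for z w
  proof -
    have "z \<noteq> 0" "w \<noteq> 0" using that by auto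
    then have "cmod (z - w) * cmod (h (z, w)) \<le> cmod (z - w) * H"
      using lip[OF that(1,2)] by (simp add: norm_mult[symmetric] mult mult.commute)
    then show ?thesis by (rule mult_left_le_imp_le) (use that in simp)
  qed
  obtain z w where zw: "u = (z, w)" by (cases u)
  show ?thesis
  proof (cases "z = w")
    case False
    then show ?thesis using off[of z w] u zw by simp
  next
    case True
    \<comment> \<open>Rotating \<open>w\<close> by angles in (0, 1] gives points different from
      \<open>w\<close> that tend to it.\<close>
    define t where "t = (\<lambda>n. 1 / (real n + 1))"
    have "t \<longlonglongrightarrow> 0" unfolding t_def by real_asymp
    define v where "v = (\<lambda>n. w * cis (t n))"
    have "v \<longlonglongrightarrow> w * cis 0"
      unfolding v_def by (intro tendsto_intros \<open>t \<longlonglongrightarrow> 0\<close>)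
    then have v: "v \<longlonglongrightarrow> w" by simp
    have "(\<lambda>n. h (v n, w)) \<longlonglongrightarrow> h (w, w)"
      unfolding h_def torus_char_def case_prod_unfold fst_conv snd_conv
      using u zw by (intro tendsto_intros v) auto
    moreover have "cmod (h (v n, w)) \<le> H" for n
    proof (rule off)
      have t: "0 < t n" "t n \<le> 1" by (simp_all add: t_def)
      then have "0 < sin (t n)" using pi_gt3 by (intro sin_gt_zero) auto
      then have "cis (t n) \<noteq> 1" by (auto simp: complex_eq_iff)
      then show "v n \<noteq> w" using u zw by (auto simp: v_def)
    qed (use u zw in \<open>simp_all add: norm_mult v_def\<close>)
    ultimately show ?thesis
      using LIMSEQ_le_const2[OF tendsto_norm, of "\<lambda>n. h (v n, w)" "h (w, w)" H] True zw
      by auto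
  qed
qed

text \<open>Transference with the divided difference as symbol and \<open>U - V\<close> as operator
  turns a scalar Lipschitz bound into one for the Hilbert-Schmidt norm, here tested against
  \<open>Y\<close>.\<close>

lemma hs_lipschitz:
  fixes U V Y :: "'h bop" and d :: "int \<Rightarrow> complex"
  assumes U: "unitary_bop U" and V: "unitary_bop V" and D: "HS (U - V)" and Y: "HS Y"
    and fin: "finite I"
    and lip: "\<And>z w. cmod z = 1 \<Longrightarrow> cmod w = 1 \<Longrightarrow>
      cmod ((\<Sum>n\<in>I. d n * z powi n) - (\<Sum>n\<in>I. d n * w powi n)) \<le> H * cmod (z - w)"
  shows "cmod (\<Sum>n\<in>I. d n * trace (bop_adj Y * (unitary_powi U n - unitary_powi V n)))
    \<le> 3 * H * (hs_norm (U - V) * hs_norm Y)"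
proof -
  have finS: "finite (divdiff_exps n)" for n by (simp add: divdiff_exps_def)
  \<comment> \<open>Both \<open>a\<close> and \<open>n - 1 - a\<close> lie between -\<bar>n\<bar>
    and \<bar>n\<bar>, so this \<open>M\<close> bounds all frequencies that occur.\<close>
  define M where "M = nat (Max (insert 0 (abs ` I)))"
  have M: "\<bar>n\<bar> \<le> int M" if "n \<in> I" for n
    using that fin by (simp add: M_def)
  define t where "t = (\<lambda>n a. bop_adj Y * (unitary_powi U a * (U - V) * unitary_powi V (n - 1 - a)))"
  have "trace (bop_adj Y * (unitary_powi U n - unitary_powi V n))
      = (\<Sum>a\<in>divdiff_exps n. of_int (sgn n) * trace (t n a))" for n
  proof -
    have "trace_bound (t n a) (hs_norm (bop_adj Y) * hs_norm (unitary_powi U a * (U - V) * unitary_powi V (n - 1 - a)))" for a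
      unfolding t_def by (intro trace_bound_HS HS_adj Y HS_mult_left HS_mult_right D)
    then have "trace (\<Sum>a\<in>divdiff_exps n. t n a) = (\<Sum>a\<in>divdiff_exps n. trace (t n a))"
      by (rule trace_sum)
    moreover have "bop_adj Y * (unitary_powi U n - unitary_powi V n) = of_int (sgn n) *\<^sub>R (\<Sum>a\<in>divdiff_exps n. t n a)"
      by (simp add: unitary_powi_diff[OF U V] t_def sum_distrib_left)
    ultimately show ?thesis by (simp add: trace_scaleR sum_distrib_left)
  qed
  then have "(\<Sum>n\<in>I. d n * trace (bop_adj Y * (unitary_powi U n - unitary_powi V n)))
      = (\<Sum>(n, a)\<in>Sigma I divdiff_exps. d n * of_int (sgn n) * trace (t n a))"
    using fin finS by (simp add: sum.Sigma[symmetric] sum_distrib_left mult_ac)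
  also have "cmod \<dots> \<le> 3 * H * (hs_norm (U - V) * hs_norm Y)"
    using transference[OF U V D Y, of "Sigma I divdiff_exps" "\<lambda>(n, a). (a, n - 1 - a)" M
        "\<lambda>(n, a). d n * of_int (sgn n)" H]
      torus_divdiff_bound[OF fin lip] fin finS M
    by (fastforce simp: t_def case_prod_unfold divdiff_exps_def)
  finally show ?thesis .
qed

end

section \<open>Differentiating along the unitary path\<close>

text \<open>The remainder keeps the exact factor x^k, so that for a Hilbert-Schmidt operator
  \<open>x\<close> it is Hilbert-Schmidt when k = 1 and trace class when k = 2.\<close>

lemma exp_remainder:
  fixes x :: "'a::{real_normed_algebra_1,banach}"
  obtains \<psi> where "exp x = (\<Sum>i<k. x ^ i /\<^sub>R fact i) + x ^ k * \<psi>" "norm \<psi> \<le> exp (norm x)"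
proof -
  define f where "f = (\<lambda>n. x ^ n /\<^sub>R fact (n + k))"
  have le: "norm (f n) \<le> norm x ^ n /\<^sub>R fact n" for n
  proof -
    have "(fact n :: real) \<le> fact (n + k)" by (rule fact_mono) simp
    then have "inverse (fact (n + k)) \<le> inverse (fact n :: real)" by (rule le_imp_inverse_le) simp
    then show ?thesis
      unfolding f_def norm_scaleR real_scaleR_def
      by (intro mult_mono norm_power_ineq) auto
  qed
  have sm: "summable (\<lambda>n. norm (f n))"
    by (rule summable_comparison_test'[OF summable_exp_generic[of "norm x"]]) (use le in simp)
  show ?thesis
  proof (rule that[of "suminf f"])
    have "exp x = (\<Sum>n. x ^ (n + k) /\<^sub>R fact (n + k)) + (\<Sum>i<k. x ^ i /\<^sub>R fact i)"
      unfolding exp_def by (rule suminf_split_initial_segment[OF summable_exp_generic])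
    also have "(\<Sum>n. x ^ (n + k) /\<^sub>R fact (n + k)) = (\<Sum>n. x ^ k * f n)"
      by (simp add: f_def add.commute flip: power_add)
    also have "\<dots> = x ^ k * suminf f"
      by (rule suminf_mult[OF summable_norm_cancel[OF sm]])
    finally show "exp x = (\<Sum>i<k. x ^ i /\<^sub>R fact i) + x ^ k * suminf f" by simp
    have "norm (suminf f) \<le> (\<Sum>n. norm (f n))" by (rule summable_norm[OF sm])
    also have "\<dots> \<le> (\<Sum>n. norm x ^ n /\<^sub>R fact n)"
      by (rule suminf_le[OF le sm summable_exp_generic])
    finally show "norm (suminf f) \<le> exp (norm x)" by (simp add: exp_def)
  qed
qed

lemma has_vector_derivativeI_quadratic:
  fixes f :: "real \<Rightarrow> 'a::real_normed_vector"
  assumes "\<And>h. \<bar>h\<bar> \<le> 1 \<Longrightarrow> norm (f (s + h) - f s - h *\<^sub>R d) \<le> K * h\<^sup>2"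
  shows "(f has_vector_derivative d) (at s within S)"
proof -
  have "((\<lambda>h. norm (f (s + h) - f s - h *\<^sub>R d) / norm h) \<longlongrightarrow> 0) (at 0)"
  proof (rule Lim_null_comparison)
    have "\<forall>\<^sub>F h in at 0. \<bar>h\<bar> < (1::real)"
      by (auto simp: eventually_at intro!: exI[of _ 1])
    then show "\<forall>\<^sub>F h in at 0. norm (norm (f (s + h) - f s - h *\<^sub>R d) / norm h) \<le> K * \<bar>h\<bar>"
    proof eventually_elim
      case (elim h)
      then show ?case
        using assms[of h] by (cases "h = 0") (auto simp: divide_le_eq power2_eq_square abs_mult_self_eq mult.assoc)
    qed
    show "((\<lambda>h. K * \<bar>h\<bar>) \<longlongrightarrow> 0) (at 0)" by (auto intro!: tendsto_eq_intros)
  qed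
  then have "(f has_derivative (\<lambda>h. h *\<^sub>R d)) (at s)"
    by (simp add: has_derivative_at bounded_linear_scaleR_left)
  then show ?thesis
    unfolding has_vector_derivative_def by (rule has_derivative_at_withinI)
qed

section \<open>Trigonometric estimates on the circle\<close>

lemma cis_int_has_vector_derivative:
  "((\<lambda>t. cis (of_int n * t)) has_vector_derivative \<i> * of_int n * cis (of_int n * t)) (at t)"
proof -
  have "((\<lambda>x. exp (\<i> * (of_int n * x))) has_field_derivative \<i> * of_int n * cis (of_int n * t)) (at (of_real t))"
    by (auto intro!: derivative_eq_intros simp: cis_conv_exp)
  from has_vector_derivative_real_field[OF this] show ?thesis by (simp add: cis_conv_exp)
qed

text \<open>A crude form of Jordan's inequality: up to \<pi>/3 the difference sin x - x/4 increases,
  and beyond it sin x \<ge> 1/2 \<ge> x/4.\<close>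

lemma sin_ge_quarter:
  assumes "0 \<le> x" "x \<le> pi / 2"
  shows "x / 4 \<le> sin x"
proof (cases "x \<le> pi / 3")
  case True
  have "sin 0 - 0 / 4 \<le> sin x - x / 4"
  proof (rule DERIV_nonneg_imp_nondecreasing[OF assms(1)])
    fix t assume t: "0 \<le> t" "t \<le> x"
    have "cos (pi / 3) \<le> cos t"
      using t True pi_gt_zero by (intro cos_monotone_0_pi_le) auto
    then have "0 \<le> cos t - 1 / 4" by (simp add: cos_60)
    moreover have "((\<lambda>x. sin x - x / 4) has_real_derivative cos t - 1 / 4) (at t)"
      by (auto intro!: derivative_eq_intros)
    ultimately show "\<exists>y. ((\<lambda>x. sin x - x / 4) has_real_derivative y) (at t) \<and> 0 \<le> y" by blast
  qed
  then show ?thesis by simp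
next
  case False
  have "x / 4 \<le> 1 / 2" using assms pi_less_4 by simp
  also have "\<dots> \<le> sin (pi / 3)" using real_le_rsqrt[of 1 3] by (simp add: sin_60)
  also have "\<dots> \<le> sin x" using assms False by (intro sin_monotone_2pi_le) auto
  finally show ?thesis .
qed

text \<open>For an angle \<theta> between the points the chord is 2 \<bar>sin (\<theta>/2)\<bar>,
  and \<open>sin_ge_quarter\<close> at \<bar>\<theta>\<bar>/2 gives \<bar>\<theta>\<bar>/8 \<le>
  \<bar>sin (\<theta>/2)\<bar>; hence the 4.\<close>

lemma arc_le_chord:
  assumes "cmod z = 1" "cmod w = 1"
  obtains t u where "z = cis t" "w = cis u" "\<bar>t - u\<bar> \<le> 4 * cmod (z - w)"
proof -
  define \<theta> where "\<theta> = Arg (z / w)"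
  have ne: "z / w \<noteq> 0" and w0: "w \<noteq> 0" using assms by auto
  have "cis \<theta> = z / w"
    using cis_Arg[OF ne] assms by (simp add: \<theta>_def sgn_eq norm_divide)
  moreover have w: "w = cis (Arg w)"
    using cis_Arg[OF w0] assms by (simp add: sgn_eq)
  ultimately have z: "z = cis (\<theta> + Arg w)"
    using assms by (metis cis_mult cis_neq_zero nonzero_eq_divide_eq)
  have \<theta>: "- pi < \<theta>" "\<theta> \<le> pi" unfolding \<theta>_def using Arg_bounded by auto
  have "\<bar>\<theta>\<bar> / 2 / 4 \<le> sin (\<bar>\<theta>\<bar> / 2)" using \<theta> by (intro sin_ge_quarter) auto
  also have "sin (\<bar>\<theta>\<bar> / 2) \<le> \<bar>sin (\<theta> / 2)\<bar>" by (cases "\<theta> \<ge> 0") auto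
  finally have "\<bar>\<theta>\<bar> \<le> 4 * cmod (cis \<theta> - 1)"
    using dist_exp_i_1[of \<theta>] by (simp add: cis_conv_exp mult.commute)
  also have "cmod (cis \<theta> - 1) = cmod (z - w)"
  proof -
    have "z - w = (cis \<theta> - 1) * w" using z w by (simp add: left_diff_distrib) (metis cis_mult)
    then show ?thesis using assms by (simp add: norm_mult)
  qed
  finally show ?thesis using z w by (intro that[of "\<theta> + Arg w" "Arg w"]) auto
qed

section \<open>The one-parameter group generated by \<open>A\<close> and expansions along it\<close>

locale unitary_path = onb B for B :: "'h::nonzero_complex_hilbert set" +
  fixes A U0 :: "'h bop"
  assumes HS_A: "HS A" and adj_A: "bop_adj A = A" and unitary_U0: "unitary_bop U0"
begin

definition gen :: "'h bop" where "gen = \<i> *\<^sub>C A"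

definition flow :: "real \<Rightarrow> 'h bop" where "flow s = exp (s *\<^sub>R gen)"

definition path :: "real \<Rightarrow> 'h bop" where "path s = flow s * U0"

lemma HS_gen: "HS gen" and hs_norm_gen: "hs_norm gen = hs_norm A" and norm_gen: "norm gen = norm A"
  by (simp_all add: gen_def HS_scaleC HS_A hs_norm_scaleC norm_scaleC_bop)

lemma flow_add: "flow (s + t) = flow s * flow t"
  unfolding flow_def scaleR_add_left by (rule exp_add_commuting) simp

lemma flow_zero [simp]: "flow 0 = 1" by (simp add: flow_def)

lemma path_zero [simp]: "path 0 = U0" by (simp add: path_def)

lemma path_add: "path (s + h) = flow h * path s"
  by (simp add: path_def add.commute[of s] flow_add mult.assoc)

lemma adj_flow: "bop_adj (flow s) = flow (- s)"
proof -
  have adj: "bop_adj ((s *\<^sub>R gen) ^ n /\<^sub>R fact n) = ((- s) *\<^sub>R gen) ^ n /\<^sub>R fact n" for n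
  proof -
    have "bop_adj (s *\<^sub>R gen) = (- s) *\<^sub>R gen"
      by (simp add: gen_def adj_scaleR adj_scaleC adj_A)
    then show ?thesis by (simp only: adj_scaleR adj_power)
  qed
  show ?thesis
    unfolding flow_def exp_def
    by (subst bounded_linear.suminf[OF bounded_linear_adj summable_exp_generic]) (simp only: adj)
qed

lemma unitary_flow: "unitary_bop (flow s)"
  using flow_add[of s "- s"] flow_add[of "- s" s] by (simp add: unitary_bop_def adj_flow)

lemma unitary_path: "unitary_bop (path s)"
  unfolding path_def by (intro unitary_mult unitary_flow unitary_U0)

text \<open>Bounds the factor \<psi> in the exponential remainders for all \<bar>s\<bar> \<le>
  1.\<close>

definition exp_A :: real where "exp_A = exp (norm A)"

lemma flow_diff_one:
  assumes "\<bar>s\<bar> \<le> 1"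
  shows "HS (flow s - 1)" "hs_norm (flow s - 1) \<le> \<bar>s\<bar> * (hs_norm A * exp_A)"
proof -
  obtain \<psi> where \<psi>: "exp (s *\<^sub>R gen) = (\<Sum>i<1. (s *\<^sub>R gen) ^ i /\<^sub>R fact i) + (s *\<^sub>R gen) ^ 1 * \<psi>"
    "norm \<psi> \<le> exp (norm (s *\<^sub>R gen))"
    by (rule exp_remainder)
  then have eq: "flow s - 1 = s *\<^sub>R (gen * \<psi>)" by (simp add: flow_def)
  show "HS (flow s - 1)" unfolding eq by (intro HS_scaleR HS_mult_right HS_gen)
  have "\<bar>s\<bar> * norm A \<le> norm A" using assms by (simp add: mult_left_le_one_le)
  then have "norm \<psi> \<le> exp_A" using \<psi>(2) by (simp add: norm_gen exp_A_def) (smt (verit) exp_le_cancel_iff)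
  then have "hs_norm (gen * \<psi>) \<le> exp_A * hs_norm A"
    using HS_mult_right(2)[OF HS_gen, of \<psi>] mult_right_mono[of "norm \<psi>" exp_A "hs_norm A"] hs_norm_gen by simp
  then show "hs_norm (flow s - 1) \<le> \<bar>s\<bar> * (hs_norm A * exp_A)"
    unfolding eq hs_norm_scaleR by (simp add: mult_left_mono mult.commute)
qed

lemma flow_remainder:
  assumes "\<bar>s\<bar> \<le> 1"
  shows "trace_bound (flow s - 1 - s *\<^sub>R gen) (s\<^sup>2 * ((hs_norm A)\<^sup>2 * exp_A))"
proof -
  obtain \<psi> where \<psi>: "exp (s *\<^sub>R gen) = (\<Sum>i<2. (s *\<^sub>R gen) ^ i /\<^sub>R fact i) + (s *\<^sub>R gen) ^ 2 * \<psi>"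
    "norm \<psi> \<le> exp (norm (s *\<^sub>R gen))"
    by (rule exp_remainder)
  then have eq: "flow s - 1 - s *\<^sub>R gen = s\<^sup>2 *\<^sub>R (gen * (gen * \<psi>))"
    by (simp add: flow_def numeral_2_eq_2 mult.assoc)
  have "\<bar>s\<bar> * norm A \<le> norm A" using assms by (simp add: mult_left_le_one_le)
  then have "norm \<psi> \<le> exp_A" using \<psi>(2) by (simp add: norm_gen exp_A_def) (smt (verit) exp_le_cancel_iff)
  then have "hs_norm (gen * \<psi>) \<le> exp_A * hs_norm A"
    using HS_mult_right(2)[OF HS_gen, of \<psi>] mult_right_mono[of "norm \<psi>" exp_A "hs_norm A"] hs_norm_gen by simp
  then have "hs_norm gen * hs_norm (gen * \<psi>) \<le> (hs_norm A)\<^sup>2 * exp_A"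
    using mult_left_mono[of "hs_norm (gen * \<psi>)" "exp_A * hs_norm A" "hs_norm A"]
    by (simp add: hs_norm_gen power2_eq_square mult_ac)
  with trace_bound_HS[OF HS_gen HS_mult_right(1)[OF HS_gen, of \<psi>]]
  have "trace_bound (gen * (gen * \<psi>)) ((hs_norm A)\<^sup>2 * exp_A)"
    by (rule trace_bound_mono)
  from trace_bound_scaleR[OF this, of "s\<^sup>2"] show ?thesis unfolding eq by simp
qed

text \<open>The derivative of (e^(s gen) V)^n at s = 0. In the divided difference the increment of
  the base becomes \<open>gen * V\<close>, and this \<open>V\<close> is merged into the last
  power.\<close>

definition powi_deriv :: "'h bop \<Rightarrow> int \<Rightarrow> 'h bop" where
  "powi_deriv V n = of_int (sgn n) *\<^sub>R (\<Sum>a\<in>divdiff_exps n. unitary_powi V a * gen * unitary_powi V (n - a))"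

definition taylor_const :: real where "taylor_const = 2 * (hs_norm A)\<^sup>2 * exp_A"

lemma exp_A_pos: "0 < exp_A" by (simp add: exp_A_def)

lemma path_step_HS:
  assumes V: "unitary_bop V" and h: "\<bar>h\<bar> \<le> 1"
  shows "HS (flow h * V - V)" "hs_norm (flow h * V - V) \<le> \<bar>h\<bar> * (hs_norm A * exp_A)"
proof -
  have eq: "flow h * V - V = (flow h - 1) * V" by (simp add: algebra_simps)
  show "HS (flow h * V - V)" unfolding eq by (intro HS_mult_right flow_diff_one h)
  have "hs_norm ((flow h - 1) * V) \<le> norm V * hs_norm (flow h - 1)"
    by (intro HS_mult_right flow_diff_one h)
  also have "\<dots> \<le> 1 * (\<bar>h\<bar> * (hs_norm A * exp_A))"
    by (intro mult_mono norm_unitary V flow_diff_one h) auto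
  finally show "hs_norm (flow h * V - V) \<le> \<bar>h\<bar> * (hs_norm A * exp_A)" by (simp add: eq)
qed

text \<open>Each term of the divided difference has two errors: the second-order remainder of the
  flow, and \<open>h\<close> times a power difference times \<open>gen\<close>, a product of two
  Hilbert-Schmidt operators that carries a factor \<bar>a\<bar> \<le> \<bar>n\<bar>. Summing
  \<bar>n\<bar> terms gives \<bar>n\<bar> + n^2 \<le> 2 n^2, whence the 2 in
  \<open>taylor_const\<close>. The growth n^2 is exactly what the coefficients of \<Phi> can
  absorb.\<close>

lemma taylor_bound:
  assumes V: "unitary_bop V" and h: "\<bar>h\<bar> \<le> 1"
  shows "trace_bound (unitary_powi (flow h * V) n - unitary_powi V n - h *\<^sub>R powi_deriv V n)
    (h\<^sup>2 * (taylor_const * (real_of_int n)\<^sup>2))"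
proof -
  define W where "W = flow h * V"
  have W: "unitary_bop W" unfolding W_def by (intro unitary_mult unitary_flow V)
  define K1 where "K1 = h\<^sup>2 * ((hs_norm A)\<^sup>2 * exp_A)"
  have K1: "0 \<le> K1" using exp_A_pos by (simp add: K1_def)
  define r where "r = (\<lambda>a. unitary_powi W a * (flow h - 1 - h *\<^sub>R gen) * unitary_powi V (n - a)
      + h *\<^sub>R ((unitary_powi W a - unitary_powi V a) * gen * unitary_powi V (n - a)))"
  have "unitary_powi W a * (W - V) * unitary_powi V (n - 1 - a)
      - h *\<^sub>R (unitary_powi V a * gen * unitary_powi V (n - a)) = r a" for a
  proof -
    have "unitary_powi V (n - a) = V * unitary_powi V (n - 1 - a)"
      using unitary_powi_Suc[OF V, of "n - 1 - a"] by (simp add: algebra_simps)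
    then show ?thesis by (simp add: r_def W_def algebra_simps mult.assoc)
  qed
  then have "(\<Sum>a\<in>divdiff_exps n. r a)
      = (\<Sum>a\<in>divdiff_exps n. unitary_powi W a * (W - V) * unitary_powi V (n - 1 - a))
        - h *\<^sub>R (\<Sum>a\<in>divdiff_exps n. unitary_powi V a * gen * unitary_powi V (n - a))"
    by (simp only: sum_subtractf[symmetric] scaleR_sum_right)
  then have eq: "unitary_powi W n - unitary_powi V n - h *\<^sub>R powi_deriv V n
      = of_int (sgn n) *\<^sub>R (\<Sum>a\<in>divdiff_exps n. r a)"
    unfolding unitary_powi_diff[OF W V] powi_deriv_def by (simp add: scaleR_diff_right mult.commute)
  have "trace_bound (r a) (K1 + \<bar>real_of_int n\<bar> * K1)" if a: "a \<in> divdiff_exps n" for a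
    unfolding r_def
  proof (rule trace_bound_add)
    show "trace_bound (unitary_powi W a * (flow h - 1 - h *\<^sub>R gen) * unitary_powi V (n - a)) K1"
      unfolding K1_def
      by (intro trace_bound_mult_left trace_bound_mult_right flow_remainder h norm_unitary_powi W V)
    have D: "HS (W - V)" "hs_norm (W - V) \<le> \<bar>h\<bar> * (hs_norm A * exp_A)"
      unfolding W_def by (intro path_step_HS V h)+
    have Da: "HS (unitary_powi W a - unitary_powi V a)" by (intro HS_unitary_powi_diff W V D)
    have "hs_norm (unitary_powi W a - unitary_powi V a) \<le> \<bar>real_of_int a\<bar> * hs_norm (W - V)"
      by (intro HS_unitary_powi_diff W V D)
    also have "\<dots> \<le> \<bar>real_of_int n\<bar> * (\<bar>h\<bar> * (hs_norm A * exp_A))"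
      using a by (intro mult_mono D) (auto simp: divdiff_exps_def)
    finally have le: "hs_norm (unitary_powi W a - unitary_powi V a) * hs_norm gen
        \<le> \<bar>real_of_int n\<bar> * (\<bar>h\<bar> * (hs_norm A * exp_A)) * hs_norm A"
      unfolding hs_norm_gen by (rule mult_right_mono) simp
    have "trace_bound ((unitary_powi W a - unitary_powi V a) * gen) (\<bar>real_of_int n\<bar> * (\<bar>h\<bar> * (hs_norm A * exp_A)) * hs_norm A)"
      by (rule trace_bound_mono[OF trace_bound_HS[OF Da HS_gen] le])
    then have "trace_bound ((unitary_powi W a - unitary_powi V a) * gen * unitary_powi V (n - a))
        (\<bar>real_of_int n\<bar> * (\<bar>h\<bar> * (hs_norm A * exp_A)) * hs_norm A)"
      by (rule trace_bound_mult_right[OF _ norm_unitary_powi[OF V]])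
    from trace_bound_scaleR[OF this, of h]
    show "trace_bound (h *\<^sub>R ((unitary_powi W a - unitary_powi V a) * gen * unitary_powi V (n - a)))
        (\<bar>real_of_int n\<bar> * K1)"
      by (simp add: K1_def power2_eq_square mult_ac abs_mult_self_eq flip: mult.assoc[of "\<bar>h\<bar>" "\<bar>h\<bar>"])
  qed
  then have "trace_bound (\<Sum>a\<in>divdiff_exps n. r a) (\<Sum>a\<in>divdiff_exps n. K1 + \<bar>real_of_int n\<bar> * K1)"
    by (rule trace_bound_sum)
  then have "trace_bound (of_int (sgn n) *\<^sub>R (\<Sum>a\<in>divdiff_exps n. r a))
      (\<bar>of_int (sgn n)\<bar> * (\<Sum>a\<in>divdiff_exps n. K1 + \<bar>real_of_int n\<bar> * K1))"
    by (rule trace_bound_scaleR)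
  then show ?thesis unfolding eq[unfolded W_def]
  proof (rule trace_bound_mono)
    have "real (card (divdiff_exps n)) = \<bar>real_of_int n\<bar>" by (auto simp: divdiff_exps_def)
    then have "\<bar>of_int (sgn n)\<bar> * (\<Sum>a\<in>divdiff_exps n. K1 + \<bar>real_of_int n\<bar> * K1)
        \<le> \<bar>real_of_int n\<bar> * (K1 + \<bar>real_of_int n\<bar> * K1)"
      using K1 by (simp add: sgn_if)
    also have "\<dots> = \<bar>real_of_int n\<bar> * K1 + (real_of_int n)\<^sup>2 * K1"
      by (simp add: algebra_simps power2_eq_square)
    also have "\<bar>real_of_int n\<bar> * K1 \<le> (real_of_int n)\<^sup>2 * K1"
    proof (rule mult_right_mono[OF _ K1])
      have "\<bar>n\<bar> \<le> n\<^sup>2"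
        using mult_left_mono[of 1 "\<bar>n\<bar>" "\<bar>n\<bar>"] by (cases "n = 0") (auto simp: power2_eq_square)
      then have "real_of_int \<bar>n\<bar> \<le> real_of_int (n\<^sup>2)" by (simp only: of_int_le_iff)
      then show "\<bar>real_of_int n\<bar> \<le> (real_of_int n)\<^sup>2" by simp
    qed
    finally show "\<bar>of_int (sgn n)\<bar> * (\<Sum>a\<in>divdiff_exps n. K1 + \<bar>real_of_int n\<bar> * K1)
        \<le> h\<^sup>2 * (taylor_const * (real_of_int n)\<^sup>2)"
      by (simp add: K1_def taylor_const_def mult_ac)
  qed
qed

lemma path_HS_diff:
  assumes "0 \<le> s" "s \<le> 1"
  shows "HS (path s - U0)" "hs_norm (path s - U0) \<le> hs_norm A * exp_A"
proof -
  show "HS (path s - U0)" unfolding path_def using assms by (intro path_step_HS unitary_U0) auto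
  have "hs_norm (path s - U0) \<le> \<bar>s\<bar> * (hs_norm A * exp_A)"
    unfolding path_def using assms by (intro path_step_HS unitary_U0) auto
  also have "\<dots> \<le> 1 * (hs_norm A * exp_A)"
    using assms exp_A_pos by (intro mult_right_mono) auto
  finally show "hs_norm (path s - U0) \<le> hs_norm A * exp_A" by simp
qed

text \<open>A single derivative is in general only Hilbert-Schmidt, so cyclicity is applied to
  differences, split into products of two Hilbert-Schmidt factors. The trace of the term for
  \<open>a\<close> does not depend on \<open>a\<close>, whence the factor \<open>n\<close>.\<close>

lemma trace_powi_deriv_diff:
  assumes V: "unitary_bop V" and W: "unitary_bop W" and D: "HS (V - W)"
  shows "trace (powi_deriv V n - powi_deriv W n)
      = of_int n * \<i> * trace (A * (unitary_powi V n - unitary_powi W n))"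
    and "\<exists>K. trace_bound (powi_deriv V n - powi_deriv W n) K"
proof -
  have Dk: "HS (unitary_powi V k - unitary_powi W k)" for k by (intro HS_unitary_powi_diff V W D)
  define t where "t = (\<lambda>a. unitary_powi V a * gen * unitary_powi V (n - a) - unitary_powi W a * gen * unitary_powi W (n - a))"
  have split: "t a = (unitary_powi V a - unitary_powi W a) * (gen * unitary_powi V (n - a))
      + (unitary_powi W a * gen) * (unitary_powi V (n - a) - unitary_powi W (n - a))" for a
    by (simp add: t_def algebra_simps mult.assoc)
  note HS_intros = HS_mult_left(1) HS_mult_right(1) HS_gen Dk
  have tb: "\<exists>K. trace_bound (t a) K" for a
    unfolding split
    by (rule exI, rule trace_bound_add; rule trace_bound_HS) (intro HS_intros)+
  have tr: "trace (t a) = \<i> * trace (A * (unitary_powi V n - unitary_powi W n))" for a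
  proof -
    let ?P = "gen * unitary_powi V (n - a) * (unitary_powi V a - unitary_powi W a)"
    let ?Q = "gen * ((unitary_powi V (n - a) - unitary_powi W (n - a)) * unitary_powi W a)"
    have Vn: "unitary_powi V (n - a) * unitary_powi V a = unitary_powi V n"
      "unitary_powi W (n - a) * unitary_powi W a = unitary_powi W n"
      by (simp_all add: unitary_powi_add[OF V, symmetric] unitary_powi_add[OF W, symmetric])
    have "trace (t a) = trace ((unitary_powi V a - unitary_powi W a) * (gen * unitary_powi V (n - a)))
        + trace ((unitary_powi W a * gen) * (unitary_powi V (n - a) - unitary_powi W (n - a)))"
      unfolding split by (rule trace_add; rule trace_bound_HS; intro HS_intros)
    also have "trace ((unitary_powi V a - unitary_powi W a) * (gen * unitary_powi V (n - a))) = trace ?P"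
      by (intro trace_commute HS_intros)
    also have "trace ((unitary_powi W a * gen) * (unitary_powi V (n - a) - unitary_powi W (n - a))) = trace ?Q"
    proof -
      have "trace ((unitary_powi W a * gen) * (unitary_powi V (n - a) - unitary_powi W (n - a)))
          = trace ((unitary_powi V (n - a) - unitary_powi W (n - a)) * (unitary_powi W a * gen))"
        by (intro trace_commute HS_intros)
      also have "\<dots> = trace (((unitary_powi V (n - a) - unitary_powi W (n - a)) * unitary_powi W a) * gen)"
        by (simp only: mult.assoc)
      also have "\<dots> = trace ?Q" by (intro trace_commute HS_intros)
      finally show ?thesis .
    qed
    also have "trace ?P + trace ?Q = trace (?P + ?Q)"
      by (rule trace_add[symmetric]; rule trace_bound_HS; intro HS_intros)
    also have "?P + ?Q = gen * (unitary_powi V n - unitary_powi W n)"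
      by (simp add: algebra_simps Vn mult.assoc)
    also have "\<dots> = \<i> *\<^sub>C (A * (unitary_powi V n - unitary_powi W n))"
      by (simp add: gen_def scaleC_mult_left)
    finally show ?thesis by (simp add: trace_scaleC)
  qed
  have eq: "powi_deriv V n - powi_deriv W n = of_int (sgn n) *\<^sub>R (\<Sum>a\<in>divdiff_exps n. t a)"
    by (simp add: powi_deriv_def t_def sum_subtractf scaleR_diff_right)
  obtain k where k: "\<And>a. trace_bound (t a) (k a)" using tb by metis
  show "\<exists>K. trace_bound (powi_deriv V n - powi_deriv W n) K"
    unfolding eq by (rule exI, rule trace_bound_scaleR, rule trace_bound_sum, rule k)
  have "trace (powi_deriv V n - powi_deriv W n)
      = of_real (of_int (sgn n)) * (of_nat (card (divdiff_exps n)) * (\<i> * trace (A * (unitary_powi V n - unitary_powi W n))))"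
    unfolding eq trace_scaleR trace_sum[OF k] tr by simp
  also have "card (divdiff_exps n) = nat \<bar>n\<bar>" by (auto simp: divdiff_exps_def)
  also have "complex_of_real (of_int (sgn n)) * (of_nat (nat \<bar>n\<bar>) * z) = of_int n * z" for z
    by (cases n "0 :: int" rule: linorder_cases) simp_all
  finally show "trace (powi_deriv V n - powi_deriv W n)
      = of_int n * \<i> * trace (A * (unitary_powi V n - unitary_powi W n))"
    by (simp add: mult.assoc)
qed

section \<open>The trace of the remainder as an integral along the path\<close>

definition taylor_trace :: "int \<Rightarrow> real \<Rightarrow> complex" where
  "taylor_trace n s = trace (unitary_powi (path s) n - unitary_powi U0 n - s *\<^sub>R powi_deriv U0 n)"

definition pairing :: "int \<Rightarrow> real \<Rightarrow> complex" where
  "pairing n s = trace (A * (unitary_powi (path s) n - unitary_powi U0 n))"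

text \<open>The increment from \<open>s\<close> to \<open>s + h\<close> is a Taylor remainder based
  at \<open>path s\<close>, of order h^2 in the trace bound, plus \<open>h\<close> times the
  difference \<open>G\<close> of two derivatives, whose trace is known.\<close>

lemma taylor_trace_has_vector_derivative:
  assumes s: "0 \<le> s" "s \<le> 1"
  shows "(taylor_trace n has_vector_derivative of_int n * \<i> * pairing n s) (at s within S)"
proof (rule has_vector_derivativeI_quadratic)
  fix h :: real assume h: "\<bar>h\<bar> \<le> 1"
  define X where "X = (\<lambda>s. unitary_powi (path s) n - unitary_powi U0 n - s *\<^sub>R powi_deriv U0 n)"
  define R where "R = unitary_powi (path (s + h)) n - unitary_powi (path s) n - h *\<^sub>R powi_deriv (path s) n"
  define G where "G = powi_deriv (path s) n - powi_deriv U0 n"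
  have D: "HS (path s - U0)" by (rule path_HS_diff[OF s])
  have X: "trace_bound (X s) (s\<^sup>2 * (taylor_const * (real_of_int n)\<^sup>2))"
    using taylor_bound[OF unitary_U0, of s n] s by (simp add: X_def path_def)
  have R: "trace_bound R (h\<^sup>2 * (taylor_const * (real_of_int n)\<^sup>2))"
    unfolding R_def path_add by (rule taylor_bound[OF unitary_path h])
  obtain K where G: "trace_bound G K"
    using trace_powi_deriv_diff(2)[OF unitary_path unitary_U0 D] unfolding G_def by blast
  have "X (s + h) = X s + (R + h *\<^sub>R G)"
    by (simp add: X_def R_def G_def algebra_simps)
  then have "trace (X (s + h)) = trace (X s) + trace (R + h *\<^sub>R G)"
    using trace_add[OF X trace_bound_add[OF R trace_bound_scaleR[OF G, of h]]] by simp
  also have "trace (R + h *\<^sub>R G) = trace R + h *\<^sub>R trace G"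
    unfolding trace_add[OF R trace_bound_scaleR[OF G, of h]] trace_scaleR by (simp add: scaleR_conv_of_real)
  also have "trace G = of_int n * \<i> * pairing n s"
    unfolding G_def pairing_def by (rule trace_powi_deriv_diff(1)[OF unitary_path unitary_U0 D])
  finally have "taylor_trace n (s + h) - taylor_trace n s - h *\<^sub>R (of_int n * \<i> * pairing n s) = trace R"
    by (simp add: taylor_trace_def X_def)
  then show "cmod (taylor_trace n (s + h) - taylor_trace n s - h *\<^sub>R (of_int n * \<i> * pairing n s))
      \<le> 4 * taylor_const * (real_of_int n)\<^sup>2 * h\<^sup>2"
    using cmod_trace_le[OF R] by (simp add: mult_ac)
qed

lemma taylor_trace_has_integral:
  "((\<lambda>s. of_int n * \<i> * pairing n s) has_integral taylor_trace n 1) {0..1}"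
proof -
  have "((\<lambda>s. of_int n * \<i> * pairing n s) has_integral taylor_trace n 1 - taylor_trace n 0) {0..1}"
    by (rule fundamental_theorem_of_calculus) (auto intro: taylor_trace_has_vector_derivative)
  moreover have "taylor_trace n 0 = 0"
    using trace_scaleR[of 0 0] by (simp add: taylor_trace_def)
  ultimately show ?thesis by simp
qed

text \<open>\<open>A\<close> is cut off by a finite coordinate projection \<open>P\<close>: the part
  \<open>A * P\<close> contributes finitely many matrix entries, and \<open>Y = A - A * P\<close>
  carries a small tail of the square sum. As \<open>Y\<close> need not be self-adjoint, the pairing
  is with its adjoint.\<close>

lemma truncate_trace:
  assumes "\<epsilon> > 0"
  obtains F Y where "finite F" "F \<subseteq> B" "HS Y" "hs_norm Y < \<epsilon>"
    "\<And>W. HS W \<Longrightarrow> trace (A * W) = (\<Sum>e\<in>F. cinner (W *\<^sub>V e) (A *\<^sub>V e)) + trace (bop_adj Y * W)"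
proof -
  have "\<epsilon>\<^sup>2 / 2 > 0" using assms by simp
  then obtain F where F: "finite F" "F \<subseteq> B"
    "dist (\<Sum>e\<in>F. (norm (A *\<^sub>V e))\<^sup>2) ((hs_norm A)\<^sup>2) \<le> \<epsilon>\<^sup>2 / 2"
    using has_sum_finite_approximation[OF has_sum_hs_norm[OF HS_A]] by blast
  obtain P where P: "\<And>x. P *\<^sub>V x = (\<Sum>e\<in>F. cinner x e *\<^sub>C e)"
  proof (rule bop_exists[of "\<lambda>x. \<Sum>e\<in>F. cinner x e *\<^sub>C e" 2])
    fix x
    have "norm (\<Sum>e\<in>F. cinner x e *\<^sub>C e) = norm (x - remainder F x)" by (simp add: remainder_def)
    also have "\<dots> \<le> norm x + norm (remainder F x)" by (rule norm_triangle_ineq4)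
    also have "\<dots> \<le> norm x * 2" using norm_remainder_le[OF F(1,2), of x] by simp
    finally show "norm (\<Sum>e\<in>F. cinner x e *\<^sub>C e) \<le> norm x * 2" .
  qed (auto simp: cinner.add_left scaleC_add_left cinner_scaleC_left scaleC_scaleC sum.distrib
      complex_vector.scale_sum_right)
  have Pe: "P *\<^sub>V e = (if e \<in> F then e else 0)" if "e \<in> B" for e
  proof -
    have "P *\<^sub>V e = (\<Sum>f\<in>F. if f = e then e else 0)"
      unfolding P using that F(2) by (intro sum.cong refl) (auto simp: cinner_basis subset_iff)
    then show ?thesis using F(1) by simp
  qed
  define Y where "Y = A - A * P"
  have Ye: "Y *\<^sub>V e = (if e \<in> F then 0 else A *\<^sub>V e)" if "e \<in> B" for e
    using that by (simp add: Y_def bop.diff_left bop_times_apply Pe bop.zero_right)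
  have Y: "HS Y" unfolding Y_def by (intro HS_diff HS_mult_right HS_A)
  have "((\<lambda>e. (norm (A *\<^sub>V e))\<^sup>2) has_sum ((hs_norm A)\<^sup>2 - (\<Sum>e\<in>F. (norm (A *\<^sub>V e))\<^sup>2))) (B - F)"
    using F by (intro has_sum_Diff has_sum_hs_norm HS_A has_sum_finite)
  then have "((\<lambda>e. (norm (Y *\<^sub>V e))\<^sup>2) has_sum ((hs_norm A)\<^sup>2 - (\<Sum>e\<in>F. (norm (A *\<^sub>V e))\<^sup>2))) B"
    by (rule has_sum_cong_neutral[THEN iffD1, rotated -1]) (auto simp: Ye)
  then have "(hs_norm Y)\<^sup>2 = (hs_norm A)\<^sup>2 - (\<Sum>e\<in>F. (norm (A *\<^sub>V e))\<^sup>2)"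
    using has_sum_hs_norm[OF Y] has_sum_unique by blast
  also have "\<dots> \<le> dist (\<Sum>e\<in>F. (norm (A *\<^sub>V e))\<^sup>2) ((hs_norm A)\<^sup>2)"
    using abs_ge_minus_self[of "(\<Sum>e\<in>F. (norm (A *\<^sub>V e))\<^sup>2) - (hs_norm A)\<^sup>2"] by (simp add: dist_real_def)
  also have "\<dots> < \<epsilon>\<^sup>2" using F(3) \<open>\<epsilon>\<^sup>2 / 2 > 0\<close> by linarith
  finally have Y\<epsilon>: "hs_norm Y < \<epsilon>" by (rule power_less_imp_less_base) (use assms in simp)
  have "trace (A * W) = (\<Sum>e\<in>F. cinner (W *\<^sub>V e) (A *\<^sub>V e)) + trace (bop_adj Y * W)" if W: "HS W" for W
  proof (rule has_sum_unique)
    show "((\<lambda>e. cinner (W *\<^sub>V e) (A *\<^sub>V e)) has_sum trace (A * W)) B"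
      using has_sum_trace[OF trace_bound_HS[OF HS_A W]]
      by (simp add: bop_times_apply cinner_adj adj_A)
    have "((\<lambda>e. if e \<in> F then cinner (W *\<^sub>V e) (A *\<^sub>V e) else 0)
        has_sum (\<Sum>e\<in>F. cinner (W *\<^sub>V e) (A *\<^sub>V e))) B"
      by (rule has_sum_cong_neutral[THEN iffD1, rotated -1, OF has_sum_finite[OF F(1)]]) (use F in auto)
    from has_sum_add[OF this has_sum_trace[OF trace_bound_HS[OF HS_adj[OF Y] W]]]
    show "((\<lambda>e. cinner (W *\<^sub>V e) (A *\<^sub>V e)) has_sum
        (\<Sum>e\<in>F. cinner (W *\<^sub>V e) (A *\<^sub>V e)) + trace (bop_adj Y * W)) B"
      by (rule has_sum_cong[THEN iffD1, rotated])
         (auto simp: bop_times_apply cinner_adj' Ye cinner.zero_right)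
  qed
  then show ?thesis by (rule that[OF F(1,2) Y Y\<epsilon>])
qed

lemma continuous_path: "continuous_on S path"
  unfolding path_def flow_def
  by (intro continuous_intros continuous_at_imp_continuous_on ballI
      has_vector_derivative_continuous[OF exp_scaleR_has_vector_derivative_right])

lemma continuous_powi_path: "continuous_on S (\<lambda>s. unitary_powi (path s) n)"
  unfolding unitary_powi_def
  by (cases "n \<ge> 0")
     (auto intro!: continuous_intros continuous_path bounded_linear.continuous_on[OF bounded_linear_adj])

text \<open>The prescribed moments of \<eta>. Division by zero makes the value at 0 equal to 0, but
  that value is never imposed on \<eta>.\<close>

definition coeff :: "int \<Rightarrow> complex" where
  "coeff n = - taylor_trace n 1 / (of_int n)\<^sup>2"

text \<open>\<open>d\<close> are the coefficients of the primitive of \<open>\<Sum>\<^sub>n b\<^sub>n cis (n t)\<close>.\<close>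

lemma trig_sum_lipschitz:
  fixes b :: "int \<Rightarrow> complex"
  assumes I: "finite I" "0 \<notin> I" and Q: "\<And>t. cmod (\<Sum>n\<in>I. b n * cis (of_int n * t)) \<le> Q"
    and zw: "cmod z = 1" "cmod w = 1"
  defines "d \<equiv> \<lambda>n. - \<i> * b n / of_int n"
  shows "cmod ((\<Sum>n\<in>I. d n * z powi n) - (\<Sum>n\<in>I. d n * w powi n)) \<le> 4 * Q * cmod (z - w)"
proof -
  obtain t u where tu: "z = cis t" "w = cis u" "\<bar>t - u\<bar> \<le> 4 * cmod (z - w)"
    using arc_le_chord[OF zw] by blast
  define g where "g = (\<lambda>t. \<Sum>n\<in>I. d n * cis (of_int n * t))"
  have "(g has_vector_derivative (\<Sum>n\<in>I. b n * cis (of_int n * t))) (at t within UNIV)" for t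
  proof -
    have "(g has_vector_derivative (\<Sum>n\<in>I. d n * (\<i> * of_int n * cis (of_int n * t)))) (at t)"
      unfolding g_def
      by (intro has_vector_derivative_sum has_vector_derivative_mult_right cis_int_has_vector_derivative)
    also have "(\<Sum>n\<in>I. d n * (\<i> * of_int n * cis (of_int n * t))) = (\<Sum>n\<in>I. b n * cis (of_int n * t))"
      using I by (intro sum.cong refl) (auto simp: d_def field_simps)
    finally show ?thesis .
  qed
  then have "cmod (g t - g u) \<le> Q * norm (t - u)"
    using differentiable_bound[of UNIV g "\<lambda>t h. h *\<^sub>R (\<Sum>n\<in>I. b n * cis (of_int n * t))" Q t u] Q
    by (simp add: has_vector_derivative_def onorm_scaleR_left onorm_id)
  also have "\<dots> \<le> Q * (4 * cmod (z - w))"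
    using tu order_trans[OF norm_ge_zero Q] by (intro mult_left_mono) auto
  finally show ?thesis
    unfolding g_def tu(1,2) cis_power_int by (simp add: mult_ac)
qed

text \<open>\<open>c1\<close> comes from finitely many matrix entries of U_s^n - U_0^n, which are
  bounded uniformly in \<open>n\<close>, so the factor 1/n survives. Pairing \<open>c2\<close> with
  \<open>b\<close> tests the primitive with coefficients \<open>d\<close>, to which
  \<open>hs_lipschitz\<close> applies with a small \<open>Y\<close>.\<close>

lemma coeff_split:
  assumes "\<epsilon> > 0"
  obtains c1 c2 K where "\<And>n. n \<noteq> 0 \<Longrightarrow> coeff n = c1 n + c2 n" "\<And>n. cmod (c1 n) \<le> K / \<bar>real_of_int n\<bar>"
    "\<And>I b Q. finite I \<Longrightarrow> 0 \<notin> I \<Longrightarrow> (\<And>t. cmod (\<Sum>n\<in>I. b n * cis (of_int n * t)) \<le> Q)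
      \<Longrightarrow> cmod (\<Sum>n\<in>I. b n * c2 n) \<le> \<epsilon> * Q"
proof -
  \<comment> \<open>12 = 3 * 4: the transference constant times the ratio of arc to chord. The 1
    keeps \<open>N\<close> positive when \<open>A\<close> is 0.\<close>
  define N where "N = 12 * (hs_norm A * exp_A) + 1"
  have N: "N > 0" using exp_A_pos by (simp add: N_def add_nonneg_pos)
  define \<delta> where "\<delta> = \<epsilon> / N"
  have \<delta>: "\<delta> > 0" using assms N by (simp add: \<delta>_def)
  obtain F Y where F: "finite F" "F \<subseteq> B" and Y: "HS Y" "hs_norm Y < \<delta>"
    and split: "\<And>W. HS W \<Longrightarrow> trace (A * W) = (\<Sum>e\<in>F. cinner (W *\<^sub>V e) (A *\<^sub>V e)) + trace (bop_adj Y * W)"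
    using truncate_trace[OF \<delta>] by blast
  define W where "W = (\<lambda>n s. unitary_powi (path s) n - unitary_powi U0 n)"
  define \<sigma> where "\<sigma> = (\<lambda>n s. \<Sum>e\<in>F. cinner (W n s *\<^sub>V e) (A *\<^sub>V e))"
  define \<rho> where "\<rho> = (\<lambda>n s. trace (bop_adj Y * W n s))"
  define c1 where "c1 = (\<lambda>n. - \<i> / of_int n * integral {0..1} (\<sigma> n))"
  define c2 where "c2 = (\<lambda>n. - \<i> / of_int n * integral {0..1} (\<rho> n))"
  have HW: "HS (W n s)" if "s \<in> {0..1}" for n s
    unfolding W_def using that by (intro HS_unitary_powi_diff unitary_path unitary_U0 path_HS_diff) auto
  have pairing: "pairing n s = \<sigma> n s + \<rho> n s" if "s \<in> {0..1}" for n s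
    using split[OF HW[OF that, of n]] by (simp add: pairing_def \<sigma>_def \<rho>_def W_def)
  have cont: "continuous_on {0..1} (\<sigma> n)" for n
    unfolding \<sigma>_def W_def
    by (intro continuous_intros continuous_powi_path cinner.continuous_on bop.continuous_on)
  have int\<sigma>: "(\<sigma> n has_integral integral {0..1} (\<sigma> n)) {0..1}" for n
    using integrable_continuous_real[OF cont] by (rule integrable_integral)
  \<comment> \<open>Integrability of \<rho> is inherited by subtraction: \<open>pairing\<close> is
    integrable as a derivative, \<sigma> by continuity.\<close>
  have int\<rho>: "(\<rho> n has_integral taylor_trace n 1 / (of_int n * \<i>) - integral {0..1} (\<sigma> n)) {0..1}"
    if "n \<noteq> 0" for n
  proof -
    have "((\<lambda>s. pairing n s) has_integral taylor_trace n 1 / (of_int n * \<i>)) {0..1}"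
      using has_integral_mult_right[OF taylor_trace_has_integral, of "1 / (of_int n * \<i>)" n] that by simp
    from has_integral_diff[OF this int\<sigma>[of n]] show ?thesis
      by (rule has_integral_cong[THEN iffD1, rotated]) (simp add: pairing)
  qed
  show ?thesis
  proof (rule that[of c1 c2 "2 * (\<Sum>e\<in>F. norm (A *\<^sub>V e))"])
    fix n :: int assume n: "n \<noteq> 0"
    have "integral {0..1} (\<rho> n) = taylor_trace n 1 / (of_int n * \<i>) - integral {0..1} (\<sigma> n)"
      by (rule integral_unique[OF int\<rho>[OF n]])
    then show "coeff n = c1 n + c2 n"
      using n by (simp add: coeff_def c1_def c2_def field_simps power2_eq_square)
  next
    fix n :: int
    have "norm (\<sigma> n s) \<le> 2 * (\<Sum>e\<in>F. norm (A *\<^sub>V e))" for s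
      unfolding \<sigma>_def sum_distrib_left
    proof (rule sum_norm_le)
      fix e assume "e \<in> F"
      then have e: "norm e = 1" using F norm_basis by blast
      have "norm (W n s) \<le> 2"
        using norm_triangle_ineq4[of "unitary_powi (path s) n" "unitary_powi U0 n"]
          norm_unitary_powi[OF unitary_path, of s n] norm_unitary_powi[OF unitary_U0, of n]
        by (simp add: W_def)
      then have "norm (W n s *\<^sub>V e) \<le> 2" using norm_bop_apply[of "W n s" e] e by simp
      then show "cmod (cinner (W n s *\<^sub>V e) (A *\<^sub>V e)) \<le> 2 * norm (A *\<^sub>V e)"
        by (intro order_trans[OF cinner_bound] mult_right_mono) auto
    qed
    then have "norm (integral {0..1} (\<sigma> n)) \<le> 2 * (\<Sum>e\<in>F. norm (A *\<^sub>V e))"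
      using integral_bound[of 0 1 "\<sigma> n" "2 * (\<Sum>e\<in>F. norm (A *\<^sub>V e))"] cont by simp
    then show "cmod (c1 n) \<le> 2 * (\<Sum>e\<in>F. norm (A *\<^sub>V e)) / \<bar>real_of_int n\<bar>"
      by (simp add: c1_def norm_mult norm_divide divide_right_mono)
  next
    fix I :: "int set" and b Q
    assume I: "finite I" "0 \<notin> I" and Q: "\<And>t. cmod (\<Sum>n\<in>I. b n * cis (of_int n * t)) \<le> Q"
    define d where "d = (\<lambda>n. - \<i> * b n / of_int n)"
    have Q0: "0 \<le> Q" using order_trans[OF norm_ge_zero Q] .
    have "((\<lambda>s. \<Sum>n\<in>I. d n * \<rho> n s) has_integral (\<Sum>n\<in>I. d n * integral {0..1} (\<rho> n))) {0..1}"
      using I by (intro has_integral_sum has_integral_mult_right integrable_integral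
          has_integral_integrable[OF int\<rho>]) auto
    moreover have "cmod (\<Sum>n\<in>I. d n * \<rho> n s) \<le> \<epsilon> * Q" if s: "s \<in> {0..1}" for s
    proof -
      have D: "HS (path s - U0)" "hs_norm (path s - U0) \<le> hs_norm A * exp_A"
        using s by (auto intro: path_HS_diff)
      have "cmod (\<Sum>n\<in>I. d n * \<rho> n s) \<le> 3 * (4 * Q) * (hs_norm (path s - U0) * hs_norm Y)"
        unfolding \<rho>_def W_def d_def
        by (rule hs_lipschitz[OF unitary_path unitary_U0 D(1) Y(1) I(1) trig_sum_lipschitz[OF I Q]])
      also have "\<dots> \<le> 3 * (4 * Q) * ((hs_norm A * exp_A) * \<delta>)"
        using Q0 D(2) Y(2) exp_A_pos by (intro mult_left_mono mult_mono) auto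
      also have "\<dots> = (12 * (hs_norm A * exp_A)) * (\<delta> * Q)" by (simp add: mult_ac)
      also have "\<dots> \<le> N * (\<delta> * Q)"
        using Q0 \<delta> by (intro mult_right_mono) (auto simp: N_def)
      also have "\<dots> = \<epsilon> * Q" using N by (simp add: \<delta>_def)
      finally show ?thesis .
    qed
    ultimately have "cmod (\<Sum>n\<in>I. d n * integral {0..1} (\<rho> n)) \<le> \<epsilon> * Q"
      using has_integral_bound_real[of "\<epsilon> * Q" "{}" "\<lambda>s. \<Sum>n\<in>I. d n * \<rho> n s" _ 0 1] assms Q0 by simp
    then show "cmod (\<Sum>n\<in>I. b n * c2 n) \<le> \<epsilon> * Q"
      by (simp add: c2_def d_def mult_ac)
  qed
qed

end

section \<open>Integrable functions from Fourier coefficients\<close>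

text \<open>A subsequence converging almost everywhere supplies the limit, and Fatou's lemma along
  it turns the Cauchy condition into convergence of the whole sequence.\<close>

lemma L1_complete:
  fixes s :: "nat \<Rightarrow> 'a \<Rightarrow> 'b::{banach, second_countable_topology}"
  assumes s: "\<And>n. integrable M (s n)"
    and cauchy: "\<And>e. e > 0 \<Longrightarrow> \<exists>N. \<forall>i\<ge>N. \<forall>j\<ge>N. (LINT x|M. norm (s i x - s j x)) < e"
  obtains \<eta> where "integrable M \<eta>" "(\<lambda>n. LINT x|M. norm (s n x - \<eta> x)) \<longlonglongrightarrow> 0"
proof -
  have [measurable]: "s n \<in> borel_measurable M" for n using s by (rule borel_measurable_integrable)
  obtain r where r: "strict_mono r" "AE x in M. Cauchy (\<lambda>i. s (r i) x)"
    using cauchy_L1_AE_cauchy_subseq[OF s cauchy] by blast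
  define \<eta> where "\<eta> = (\<lambda>x. lim (\<lambda>i. s (r i) x))"
  have [measurable]: "\<eta> \<in> borel_measurable M" unfolding \<eta>_def by measurable
  have lim: "AE x in M. (\<lambda>i. s (r i) x) \<longlonglongrightarrow> \<eta> x"
    using r(2) by eventually_elim (simp add: \<eta>_def Cauchy_convergent_iff convergent_LIMSEQ_iff)
  have nn: "\<exists>N. \<forall>n\<ge>N. (\<integral>\<^sup>+x. norm (s n x - \<eta> x) \<partial>M) \<le> ennreal e" if e: "e > 0" for e
  proof -
    obtain N where N: "\<And>i j. i \<ge> N \<Longrightarrow> j \<ge> N \<Longrightarrow> (LINT x|M. norm (s i x - s j x)) < e"
      using cauchy[OF e] by blast
    have "(\<integral>\<^sup>+x. norm (s n x - \<eta> x) \<partial>M) \<le> ennreal e" if n: "n \<ge> N" for n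
    proof -
      have "(\<integral>\<^sup>+x. norm (s n x - \<eta> x) \<partial>M) = (\<integral>\<^sup>+x. liminf (\<lambda>j. ennreal (norm (s n x - s (r j) x))) \<partial>M)"
      proof (rule nn_integral_cong_AE)
        show "AE x in M. ennreal (norm (s n x - \<eta> x)) = liminf (\<lambda>j. ennreal (norm (s n x - s (r j) x)))"
          using lim
        proof eventually_elim
          case (elim x)
          then have "(\<lambda>j. ennreal (norm (s n x - s (r j) x))) \<longlonglongrightarrow> ennreal (norm (s n x - \<eta> x))"
            by (intro tendsto_ennrealI tendsto_intros)
          then show ?case by (intro lim_imp_Liminf[symmetric]) auto
        qed
      qed
      also have "\<dots> \<le> liminf (\<lambda>j. \<integral>\<^sup>+x. norm (s n x - s (r j) x) \<partial>M)"
        by (rule nn_integral_liminf) measurable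
      also have "\<dots> \<le> ennreal e"
      proof (rule Liminf_le)
        have "\<forall>\<^sub>F j in sequentially. N \<le> r j"
          using filterlim_subseq[OF r(1)] by (simp add: filterlim_at_top)
        then show "\<forall>\<^sub>F j in sequentially. (\<integral>\<^sup>+x. norm (s n x - s (r j) x) \<partial>M) \<le> ennreal e"
        proof eventually_elim
          case (elim j)
          have "(\<integral>\<^sup>+x. norm (s n x - s (r j) x) \<partial>M) = ennreal (LINT x|M. norm (s n x - s (r j) x))"
            by (rule nn_integral_eq_integral[OF integrable_norm[OF Bochner_Integration.integrable_diff[OF s s]]]) simp
          then show ?case using N[OF n elim] by (simp add: ennreal_leI)
        qed
      qed simp
      finally show ?thesis .
    qed
    then show ?thesis by blast
  qed
  have int: "integrable M (\<lambda>x. s n x - \<eta> x) \<and> (LINT x|M. norm (s n x - \<eta> x)) \<le> e"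
    if "(\<integral>\<^sup>+x. norm (s n x - \<eta> x) \<partial>M) \<le> ennreal e" "e > 0" for n e
  proof
    show i: "integrable M (\<lambda>x. s n x - \<eta> x)"
      by (rule integrableI_bounded) (use that(1) in \<open>auto intro: le_less_trans\<close>)
    have "ennreal (LINT x|M. norm (s n x - \<eta> x)) \<le> ennreal e"
      using that(1) nn_integral_eq_integral[of M "\<lambda>x. norm (s n x - \<eta> x)"] i by simp
    then show "(LINT x|M. norm (s n x - \<eta> x)) \<le> e" using that(2) by (simp add: ennreal_le_iff)
  qed
  obtain n where "integrable M (\<lambda>x. s n x - \<eta> x)"
    using nn[of 1] int[of _ 1] by auto
  from Bochner_Integration.integrable_diff[OF s[of n] this] have "integrable M \<eta>" by simp
  moreover have "(\<lambda>n. LINT x|M. norm (s n x - \<eta> x)) \<longlonglongrightarrow> 0"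
  proof (rule LIMSEQ_I)
    fix e :: real assume "e > 0"
    then obtain N where "\<And>n. n \<ge> N \<Longrightarrow> (\<integral>\<^sup>+x. norm (s n x - \<eta> x) \<partial>M) \<le> ennreal (e / 2)"
      using nn[of "e / 2"] by auto
    then have "(LINT x|M. norm (s n x - \<eta> x)) \<le> e / 2" if "n \<ge> N" for n
      using int[of n "e / 2"] that \<open>e > 0\<close> by simp
    moreover have "0 \<le> (LINT x|M. norm (s n x - \<eta> x))" for n
      by (rule Bochner_Integration.integral_nonneg) simp
    ultimately have "norm ((LINT x|M. norm (s n x - \<eta> x)) - 0) < e" if "n \<ge> N" for n
      using that \<open>e > 0\<close> by (fastforce simp: abs_of_nonneg)
    then show "\<exists>N. \<forall>n\<ge>N. norm ((LINT x|M. norm (s n x - \<eta> x)) - 0) < e" by blast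
  qed
  ultimately show ?thesis by (rule that)
qed

section \<open>Lebesgue measure on one period, the Fejer kernel and Fejer means\<close>

definition period :: "real measure" where
  "period = restrict_space lborel {0..2 * pi}"

lemma finite_measure_period: "finite_measure period"
  by (rule finite_measureI) (simp add: period_def space_restrict_space emeasure_restrict_space)

lemma measure_period: "measure period (space period) = 2 * pi"
  by (simp add: period_def space_restrict_space measure_restrict_space)

lemma measurable_period: "f \<in> borel_measurable borel \<Longrightarrow> f \<in> borel_measurable period"
  unfolding period_def by (rule measurable_restrict_space1) simp

lemma integrable_period:
  fixes f :: "real \<Rightarrow> 'b::{banach, second_countable_topology}"
  assumes "f \<in> borel_measurable borel" "\<And>t. norm (f t) \<le> C"
  shows "integrable period f"
  by (rule finite_measure.integrable_const_bound[OF finite_measure_period, of _ C])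
     (use assms in \<open>auto intro: measurable_period\<close>)

lemma borel_cis [measurable]: "(\<lambda>t. cis (f t)) \<in> borel_measurable M" if "f \<in> borel_measurable M"
  using measurable_compose[OF that borel_measurable_continuous_onI[OF continuous_on_cis[OF continuous_on_id]]] .

lemma integral_cis_period:
  "(LINT t|period. cis (of_int n * t)) = (if n = 0 then 2 * of_real pi else 0)"
proof -
  define F where "F = (\<lambda>t. if n = 0 then complex_of_real t else cis (of_int n * t) / (\<i> * of_int n))"
  have "(F has_vector_derivative cis (of_int n * t)) (at t within S)" for t S
  proof (cases "n = 0")
    case True
    then show ?thesis by (auto simp: F_def intro!: derivative_eq_intros)
  next
    case False
    have "((\<lambda>x. exp (\<i> * (of_int n * x)) / (\<i> * of_int n)) has_field_derivative cis (of_int n * t)) (at (of_real t))"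
      using False by (auto intro!: derivative_eq_intros simp: cis_conv_exp) (simp add: complex_eq_iff)
    from has_vector_derivative_real_field[OF this] False show ?thesis
      by (simp add: cis_conv_exp F_def)
  qed
  then have "(LINT t|period. cis (of_int n * t)) = F (2 * pi) - F 0"
    unfolding period_def
    by (subst integral_restrict_space) (auto intro!: integral_FTC_Icc continuous_intros)
  also have "\<dots> = (if n = 0 then 2 * of_real pi else 0)"
  proof (cases "n = 0")
    case False
    have "cis (of_int n * (2 * pi)) = 1"
      using cis_multiple_2pi[OF Ints_of_int, of n] by (simp add: mult_ac)
    then show ?thesis using False by (simp add: F_def)
  qed (simp add: F_def)
  finally show ?thesis .
qed

text \<open>Passing from N to N + 1 adds one row and one column, which together meet every
  difference from -N to N exactly once.\<close>

lemma sum_pairs_diff: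
  fixes f :: "int \<Rightarrow> complex"
  shows "(\<Sum>j<N. \<Sum>k<N. f (int j - int k)) = (\<Sum>n\<in>{- int N..int N}. of_int (int N - \<bar>n\<bar>) * f n)"
proof (induction N)
  case (Suc N)
  have "(\<Sum>j<Suc N. \<Sum>k<Suc N. f (int j - int k))
      = (\<Sum>j<N. \<Sum>k<N. f (int j - int k)) + (\<Sum>j<N. f (int j - int N)) + ((\<Sum>k<N. f (int N - int k)) + f 0)"
    by (simp add: sum.distrib)
  also have "(\<Sum>j<N. f (int j - int N)) = (\<Sum>n\<in>{- int N..<0}. f n)"
    by (rule sum.reindex_bij_witness[of _ "\<lambda>n. nat (n + int N)" "\<lambda>j. int j - int N"]) auto
  also have "(\<Sum>k<N. f (int N - int k)) = (\<Sum>n\<in>{0<..int N}. f n)"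
    by (rule sum.reindex_bij_witness[of _ "\<lambda>n. nat (int N - n)" "\<lambda>k. int N - int k"]) auto
  also have "(\<Sum>j<N. \<Sum>k<N. f (int j - int k)) + (\<Sum>n\<in>{- int N..<0}. f n) + ((\<Sum>n\<in>{0<..int N}. f n) + f 0)
      = (\<Sum>j<N. \<Sum>k<N. f (int j - int k)) + (\<Sum>n\<in>{- int N..int N}. f n)"
  proof -
    have "{- int N..int N} = {- int N..<0} \<union> insert 0 {0<..int N}" by auto
    then have "(\<Sum>n\<in>{- int N..int N}. f n) = (\<Sum>n\<in>{- int N..<0}. f n) + (\<Sum>n\<in>insert 0 {0<..int N}. f n)"
      by (simp only:) (rule sum.union_disjoint, auto)
    then show ?thesis by simp
  qed
  also have "\<dots> = (\<Sum>n\<in>{- int N..int N}. of_int (int (Suc N) - \<bar>n\<bar>) * f n)"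
    unfolding Suc sum.distrib[symmetric] by (intro sum.cong refl) (simp add: algebra_simps)
  \<comment> \<open>The two new end points carry the weight 0.\<close>
  also have "\<dots> = (\<Sum>n\<in>{- int (Suc N)..int (Suc N)}. of_int (int (Suc N) - \<bar>n\<bar>) * f n)"
  proof (rule sum.mono_neutral_left)
    show "\<forall>n\<in>{- int (Suc N)..int (Suc N)} - {- int N..int N}. of_int (int (Suc N) - \<bar>n\<bar>) * f n = 0"
    proof
      fix n assume "n \<in> {- int (Suc N)..int (Suc N)} - {- int N..int N}"
      then have "\<bar>n\<bar> = int (Suc N)" by auto
      then show "of_int (int (Suc N) - \<bar>n\<bar>) * f n = 0" by simp
    qed
  qed auto
  finally show ?case .
qed simp

definition fejer_weight :: "nat \<Rightarrow> int \<Rightarrow> real" where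
  "fejer_weight N n = max 0 (1 - \<bar>real_of_int n\<bar> / real N)"

text \<open>Written as a square so that positivity is immediate; \<open>fejer_eq\<close> recovers
  the trigonometric form.\<close>

definition fejer :: "nat \<Rightarrow> real \<Rightarrow> real" where
  "fejer N x = (cmod (\<Sum>k<N. cis (real k * x)))\<^sup>2 / real N"

lemma fejer_nonneg: "0 \<le> fejer N x"
  by (simp add: fejer_def)

lemma fejer_eq:
  assumes "N > 0"
  shows "complex_of_real (fejer N x) = (\<Sum>n\<in>{- int N..int N}. of_real (fejer_weight N n) * cis (of_int n * x))"
proof -
  have "complex_of_real ((cmod (\<Sum>k<N. cis (real k * x)))\<^sup>2) = (\<Sum>j<N. \<Sum>k<N. cis (of_int (int j - int k) * x))"
    unfolding complex_norm_square cnj_sum sum_product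
    by (intro sum.cong refl) (simp add: cis_cnj cis_mult algebra_simps)
  also have "\<dots> = (\<Sum>n\<in>{- int N..int N}. of_int (int N - \<bar>n\<bar>) * cis (of_int n * x))"
    by (rule sum_pairs_diff[where f = "\<lambda>n. cis (of_int n * x)"])
  also have "\<dots> = of_nat N * (\<Sum>n\<in>{- int N..int N}. of_real (fejer_weight N n) * cis (of_int n * x))"
    unfolding sum_distrib_left
  proof (rule sum.cong[OF refl])
    fix n assume n: "n \<in> {- int N..int N}"
    then have "\<bar>real_of_int n\<bar> / real N \<le> 1"
      using assms by (auto simp: divide_le_eq abs_le_iff)
    then have "real N * fejer_weight N n = real_of_int (int N - \<bar>n\<bar>)"
      using assms by (simp add: fejer_weight_def right_diff_distrib)
    then have "complex_of_real (real N * fejer_weight N n) = of_int (int N - \<bar>n\<bar>)"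
      by (metis of_real_of_int_eq)
    then show "of_int (int N - \<bar>n\<bar>) * cis (of_int n * x)
        = of_nat N * (of_real (fejer_weight N n) * cis (of_int n * x))"
      by simp
  qed
  finally show ?thesis using assms by (simp add: fejer_def)
qed

lemma borel_fejer [measurable]: "fejer N \<in> borel_measurable borel"
  unfolding fejer_def by measurable

lemma fejer_bound: "fejer N x \<le> real N"
proof -
  have "cmod (\<Sum>k<N. cis (real k * x)) \<le> real N"
    by (rule order_trans[OF norm_sum]) simp
  then have "(cmod (\<Sum>k<N. cis (real k * x)))\<^sup>2 \<le> (real N)\<^sup>2" by (rule power_mono) simp
  then show ?thesis by (cases "N = 0") (simp_all add: fejer_def divide_le_eq power2_eq_square)
qed

lemma integral_fejer:
  assumes "N > 0"
  shows "(LINT u|period. fejer N (t - u)) = 2 * pi"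
proof -
  have "complex_of_real (LINT u|period. fejer N (t - u)) = (LINT u|period. complex_of_real (fejer N (t - u)))"
    by (rule integral_complex_of_real[symmetric])
  also have "\<dots> = (LINT u|period. (\<Sum>n\<in>{- int N..int N}. of_real (fejer_weight N n) * cis (of_int n * t) * cis (of_int (- n) * u)))"
    unfolding fejer_eq[OF assms]
    by (intro Bochner_Integration.integral_cong sum.cong refl) (simp add: cis_mult mult.assoc algebra_simps)
  also have "\<dots> = (\<Sum>n\<in>{- int N..int N}. of_real (fejer_weight N n) * cis (of_int n * t) * (LINT u|period. cis (of_int (- n) * u)))"
    by (subst Bochner_Integration.integral_sum)
       (auto intro!: integrable_period[where C = 1] integrable_mult_right)
  also have "\<dots> = (\<Sum>n\<in>{- int N..int N}. if n = 0 then 2 * of_real pi else 0)"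
    unfolding integral_cis_period by (intro sum.cong refl) (auto simp: fejer_weight_def)
  also have "\<dots> = complex_of_real (2 * pi)" by simp
  finally show ?thesis by (simp only: of_real_eq_iff)
qed

text \<open>The sign of the exponent makes \<open>c n\<close> the moment against cis (n t), up to
  the weight. Frequency 0 is left out because nothing is prescribed there.\<close>

definition fejer_mean :: "nat \<Rightarrow> (int \<Rightarrow> complex) \<Rightarrow> real \<Rightarrow> complex" where
  "fejer_mean N c t = (\<Sum>n\<in>{- int N..int N} - {0}. of_real (fejer_weight N n) * c n * cis (- (of_int n * t))) / (2 * of_real pi)"

lemma borel_fejer_mean [measurable]: "fejer_mean N c \<in> borel_measurable borel"
  unfolding fejer_mean_def by measurable

lemma fejer_weight_bounds: "0 \<le> fejer_weight N n" "fejer_weight N n \<le> 1"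
  by (auto simp: fejer_weight_def)

lemma integrable_fejer_mean: "integrable period (fejer_mean N c)"
proof (rule integrable_period)
  fix t
  have "cmod (\<Sum>n\<in>{- int N..int N} - {0}. of_real (fejer_weight N n) * c n * cis (- (of_int n * t)))
      \<le> (\<Sum>n\<in>{- int N..int N} - {0}. cmod (c n))"
    by (rule sum_norm_le)
       (simp add: norm_mult abs_of_nonneg[OF fejer_weight_bounds(1)] fejer_weight_bounds mult_left_le_one_le)
  then show "norm (fejer_mean N c t) \<le> (\<Sum>n\<in>{- int N..int N} - {0}. cmod (c n)) / (2 * pi)"
    by (simp add: fejer_mean_def norm_divide norm_mult divide_right_mono)
qed measurable

text \<open>Duality: the Fejer kernel is a positive kernel of mass \<open>2 \<pi>\<close>, so the Fejer mean of a
  function bounded by 1 is bounded by 1.\<close>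

lemma integral_norm_fejer_mean:
  assumes N: "N > 0"
    and dual: "\<And>I b Q. finite I \<Longrightarrow> 0 \<notin> I \<Longrightarrow> (\<And>t. cmod (\<Sum>n\<in>I. b n * cis (of_int n * t)) \<le> Q)
      \<Longrightarrow> cmod (\<Sum>n\<in>I. b n * c n) \<le> \<epsilon> * Q"
  shows "(LINT t|period. cmod (fejer_mean N c t)) \<le> 2 * \<epsilon>"
proof -
  interpret finite_measure period by (rule finite_measure_period)
  define I where "I = {- int N..int N} - {0}"
  define p where "p = fejer_mean N c"
  have [measurable]: "p \<in> borel_measurable borel" unfolding p_def by measurable
  \<comment> \<open>The multiplier that turns \<open>p\<close> into its modulus; it is 0 where
    \<open>p\<close> vanishes.\<close>
  define \<psi> where "\<psi> = (\<lambda>t. cnj (sgn (p t)))"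
  have [measurable]: "cnj \<in> borel_measurable borel"
    by (intro borel_measurable_continuous_onI continuous_intros)
  have \<psi>_meas [measurable]: "\<psi> \<in> borel_measurable borel"
    unfolding \<psi>_def sgn_div_norm by measurable
  have \<psi>1: "cmod (\<psi> t) \<le> 1" for t by (simp add: \<psi>_def norm_sgn)
  have \<psi>p: "\<psi> t * p t = complex_of_real (cmod (p t))" for t
    by (cases "p t = 0")
       (simp_all add: \<psi>_def sgn_eq complex_norm_square[symmetric] power2_eq_square field_simps)
  \<comment> \<open>These are the nonzero frequencies of the Fejer mean of \<psi>, so that
    integrating \<open>p\<close> against \<psi> is pairing \<open>b\<close> with
    \<open>c\<close>.\<close>
  define b where "b = (\<lambda>n. of_real (fejer_weight N n) * (LINT u|period. \<psi> u * cis (- (of_int n * u))) / (2 * of_real pi))"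
  have int\<psi>: "integrable period (\<lambda>u. \<psi> u * cis (x - of_int n * u))" for n x
    by (rule integrable_period[where C = 1]) (use \<psi>1 in \<open>auto simp: norm_mult\<close>)
  have int\<psi>0: "integrable period (\<lambda>u. \<psi> u * cis (- (of_int n * u)))" for n
    using int\<psi>[of 0 n] by simp
  have intF: "integrable period (\<lambda>u. fejer N (t - u))" for t
    by (rule integrable_period[where C = "real N"]) (simp_all add: fejer_nonneg fejer_bound)
  \<comment> \<open>1 for the Fejer mean of \<psi>, and 1 for the mean value of \<psi> that is
    subtracted by leaving out frequency 0.\<close>
  have Q: "cmod (\<Sum>n\<in>I. b n * cis (of_int n * t)) \<le> 2" for t
  proof -
    have "(\<Sum>n\<in>I. b n * cis (of_int n * t))
        = (\<Sum>n\<in>I. LINT u|period. of_real (fejer_weight N n) * (\<psi> u * cis (of_int n * t - of_int n * u)) / (2 * of_real pi))"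
    proof (rule sum.cong[OF refl])
      fix n
      have "cis (of_int n * t) * (LINT u|period. \<psi> u * cis (- (of_int n * u)))
          = (LINT u|period. cis (of_int n * t) * (\<psi> u * cis (- (of_int n * u))))" by simp
      also have "\<dots> = (LINT u|period. \<psi> u * cis (of_int n * t - of_int n * u))"
        by (intro Bochner_Integration.integral_cong refl) (simp add: cis_mult mult.left_commute)
      finally have eq: "cis (of_int n * t) * (LINT u|period. \<psi> u * cis (- (of_int n * u)))
          = (LINT u|period. \<psi> u * cis (of_int n * t - of_int n * u))" .
      have "b n * cis (of_int n * t) = of_real (fejer_weight N n)
          * (cis (of_int n * t) * (LINT u|period. \<psi> u * cis (- (of_int n * u)))) / (2 * of_real pi)"
        by (simp add: b_def)
      then show "b n * cis (of_int n * t)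
          = (LINT u|period. of_real (fejer_weight N n) * (\<psi> u * cis (of_int n * t - of_int n * u)) / (2 * of_real pi))"
        unfolding eq by simp
    qed
    also have "\<dots> = (LINT u|period. (\<Sum>n\<in>I. of_real (fejer_weight N n) * (\<psi> u * cis (of_int n * t - of_int n * u)) / (2 * of_real pi)))"
      by (subst Bochner_Integration.integral_sum) (auto intro!: int\<psi> integrable_divide integrable_mult_right)
    also have "\<dots> = (LINT u|period. \<psi> u * (of_real (fejer N (t - u)) - 1) / (2 * of_real pi))"
    proof (rule Bochner_Integration.integral_cong[OF refl])
      fix u
      have "{- int N..int N} = insert 0 I" "0 \<notin> I" "finite I" "fejer_weight N 0 = 1"
        by (auto simp: I_def fejer_weight_def)
      then have "complex_of_real (fejer N (t - u)) = 1 + (\<Sum>n\<in>I. of_real (fejer_weight N n) * cis (of_int n * (t - u)))"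
        unfolding fejer_eq[OF N] by simp
      then show "(\<Sum>n\<in>I. of_real (fejer_weight N n) * (\<psi> u * cis (of_int n * t - of_int n * u)) / (2 * of_real pi))
          = \<psi> u * (of_real (fejer N (t - u)) - 1) / (2 * of_real pi)"
        by (simp add: sum_distrib_left sum_divide_distrib right_diff_distrib mult_ac)
    qed
    finally have "cmod (\<Sum>n\<in>I. b n * cis (of_int n * t))
        \<le> (LINT u|period. cmod (\<psi> u * (of_real (fejer N (t - u)) - 1) / (2 * of_real pi)))"
      by (simp only:) (rule integral_norm_bound)
    also have "\<dots> \<le> (LINT u|period. (fejer N (t - u) + 1) / (2 * pi))"
    proof (rule integral_mono_AE')
      show "integrable period (\<lambda>u. (fejer N (t - u) + 1) / (2 * pi))"
        by (intro integrable_divide Bochner_Integration.integrable_add intF integrable_const)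
      show "AE u in period. cmod (\<psi> u * (of_real (fejer N (t - u)) - 1) / (2 * of_real pi)) \<le> (fejer N (t - u) + 1) / (2 * pi)"
      proof (rule AE_I2)
        fix u
        have "cmod (\<psi> u * (of_real (fejer N (t - u)) - 1)) \<le> 1 * (fejer N (t - u) + 1)"
          unfolding norm_mult using \<psi>1 norm_triangle_ineq4[of "complex_of_real (fejer N (t - u))" 1] fejer_nonneg[of N "t - u"]
          by (intro mult_mono) auto
        then show "cmod (\<psi> u * (of_real (fejer N (t - u)) - 1) / (2 * of_real pi)) \<le> (fejer N (t - u) + 1) / (2 * pi)"
          by (simp add: norm_divide norm_mult divide_right_mono)
      qed
      show "AE u in period. 0 \<le> (fejer N (t - u) + 1) / (2 * pi)" by (simp add: fejer_nonneg add_nonneg_nonneg)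
    qed
    also have "\<dots> = ((LINT u|period. fejer N (t - u)) + (LINT u|period. 1)) / (2 * pi)"
      by (simp add: Bochner_Integration.integral_add[OF intF integrable_const] del: lebesgue_integral_const)
    also have "\<dots> = 2" by (simp add: integral_fejer[OF N] measure_period)
    finally show ?thesis .
  qed
  have "complex_of_real (LINT t|period. cmod (p t)) = (LINT t|period. \<psi> t * p t)"
    by (simp add: \<psi>p)
  also have "\<dots> = (LINT t|period. (\<Sum>n\<in>I. of_real (fejer_weight N n) * c n * (\<psi> t * cis (- (of_int n * t))) / (2 * of_real pi)))"
    by (intro Bochner_Integration.integral_cong refl)
       (simp add: p_def fejer_mean_def I_def sum_distrib_left sum_divide_distrib mult_ac)
  also have "\<dots> = (\<Sum>n\<in>I. LINT t|period. of_real (fejer_weight N n) * c n * (\<psi> t * cis (- (of_int n * t))) / (2 * of_real pi))"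
    by (rule Bochner_Integration.integral_sum) (intro int\<psi>0 integrable_divide integrable_mult_right)
  also have "\<dots> = (\<Sum>n\<in>I. b n * c n)"
  proof (rule sum.cong[OF refl])
    fix n
    define L where "L = (LINT u|period. \<psi> u * cis (- (of_int n * u)))"
    have "(LINT t|period. of_real (fejer_weight N n) * c n * (\<psi> t * cis (- (of_int n * t))) / (2 * of_real pi))
        = of_real (fejer_weight N n) * c n * L / (2 * of_real pi)"
      by (simp add: L_def)
    then show "(LINT t|period. of_real (fejer_weight N n) * c n * (\<psi> t * cis (- (of_int n * t))) / (2 * of_real pi))
        = b n * c n"
      by (simp only: b_def L_def[symmetric]) (simp add: mult_ac)
  qed
  finally have "(LINT t|period. cmod (p t)) = cmod (\<Sum>n\<in>I. b n * c n)"
    by (metis Bochner_Integration.integral_nonneg abs_of_nonneg norm_ge_zero norm_of_real)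
  also have "\<dots> \<le> \<epsilon> * 2"
    by (rule dual[OF _ _ Q]) (auto simp: I_def)
  finally show ?thesis by (simp add: p_def)
qed

section \<open>Mean square estimates for trigonometric sums\<close>

lemma integral_square_trig_sum:
  assumes I: "finite I"
  shows "(LINT t|period. (cmod (\<Sum>n\<in>I. a n * cis (- (of_int n * t))))\<^sup>2) = 2 * pi * (\<Sum>n\<in>I. (cmod (a n))\<^sup>2)"
proof -
  have "complex_of_real (LINT t|period. (cmod (\<Sum>n\<in>I. a n * cis (- (of_int n * t))))\<^sup>2)
      = (LINT t|period. (\<Sum>n\<in>I. \<Sum>m\<in>I. a n * cnj (a m) * cis (of_int (m - n) * t)))"
    unfolding integral_complex_of_real[symmetric] complex_norm_square cnj_sum sum_product
  proof (intro Bochner_Integration.integral_cong refl sum.cong)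
    fix t n m
    have "cis (- (of_int n * t)) * cnj (cis (- (of_int m * t))) = cis (of_int (m - n) * t)"
      by (simp add: cis_cnj cis_mult algebra_simps)
    then show "a n * cis (- (of_int n * t)) * cnj (a m * cis (- (of_int m * t))) = a n * cnj (a m) * cis (of_int (m - n) * t)"
      by (simp add: mult_ac)
  qed
  also have "\<dots> = (\<Sum>n\<in>I. \<Sum>m\<in>I. a n * cnj (a m) * (LINT t|period. cis (of_int (m - n) * t)))"
    by (subst Bochner_Integration.integral_sum
        | force intro!: integrable_period[where C = 1] integrable_mult_right Bochner_Integration.integrable_sum sum.cong)+
  also have "\<dots> = (\<Sum>n\<in>I. \<Sum>m\<in>I. if m = n then 2 * of_real pi * (a n * cnj (a n)) else 0)"
    unfolding integral_cis_period by (intro sum.cong refl) auto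
  also have "\<dots> = (\<Sum>n\<in>I. 2 * of_real pi * (a n * cnj (a n)))"
    using I by simp
  also have "\<dots> = complex_of_real (2 * pi * (\<Sum>n\<in>I. (cmod (a n))\<^sup>2))"
    by (simp only: of_real_mult of_real_sum complex_norm_square sum_distrib_left) simp
  finally show ?thesis by (simp only: of_real_eq_iff)
qed

text \<open>The pointwise inequality x \<le> \<delta>/2 + x^2/(2\<delta>) stands in for
  Cauchy-Schwarz under the integral; \<delta> stays free for the later choice of accuracy.\<close>

lemma integral_norm_trig_sum_le:
  assumes I: "finite I" and \<delta>: "\<delta> > 0"
  shows "(LINT t|period. cmod (\<Sum>n\<in>I. a n * cis (- (of_int n * t)))) \<le> pi * \<delta> + pi * (\<Sum>n\<in>I. (cmod (a n))\<^sup>2) / \<delta>"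
proof -
  interpret finite_measure period by (rule finite_measure_period)
  define f where "f = (\<lambda>t. \<Sum>n\<in>I. a n * cis (- (of_int n * t)))"
  have [measurable]: "f \<in> borel_measurable borel" unfolding f_def by measurable
  define C where "C = (\<Sum>n\<in>I. cmod (a n))"
  have bd: "cmod (f t) \<le> C" for t
    unfolding f_def C_def by (rule sum_norm_le) (simp add: norm_mult)
  have sq: "integrable period (\<lambda>t. (cmod (f t))\<^sup>2)"
    by (rule integrable_period[where C = "C\<^sup>2"]) (use bd in \<open>auto intro: power_mono\<close>)
  have "(LINT t|period. cmod (f t)) \<le> (LINT t|period. \<delta> / 2 + (cmod (f t))\<^sup>2 / (2 * \<delta>))"
  proof (rule integral_mono)
    show "integrable period (\<lambda>t. cmod (f t))"
      by (rule integrable_period[where C = C]) (use bd in auto)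
    show "integrable period (\<lambda>t. \<delta> / 2 + (cmod (f t))\<^sup>2 / (2 * \<delta>))"
      by (intro Bochner_Integration.integrable_add integrable_const integrable_divide sq)
    show "cmod (f t) \<le> \<delta> / 2 + (cmod (f t))\<^sup>2 / (2 * \<delta>)" for t
      using \<delta> sum_squares_bound[of \<delta> "cmod (f t)"] by (simp add: field_simps power2_eq_square)
  qed
  also have "\<dots> = \<delta> / 2 * (2 * pi) + (LINT t|period. (cmod (f t))\<^sup>2) / (2 * \<delta>)"
    using sq by (simp add: measure_period)
  also have "\<dots> = pi * \<delta> + pi * (\<Sum>n\<in>I. (cmod (a n))\<^sup>2) / \<delta>"
    unfolding f_def integral_square_trig_sum[OF I] by simp
  finally show ?thesis by (simp add: f_def)
qed

lemma fejer_mean_diff: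
  assumes "0 < N" "N \<le> M"
  shows "fejer_mean N c t - fejer_mean M c t
    = (\<Sum>n\<in>{- int M..int M} - {0}. of_real (fejer_weight N n - fejer_weight M n) * c n / (2 * of_real pi) * cis (- (of_int n * t)))"
proof -
  have "(\<Sum>n\<in>{- int N..int N} - {0}. of_real (fejer_weight N n) * c n * cis (- (of_int n * t)))
      = (\<Sum>n\<in>{- int M..int M} - {0}. of_real (fejer_weight N n) * c n * cis (- (of_int n * t)))"
  proof (rule sum.mono_neutral_left)
    show "\<forall>n\<in>{- int M..int M} - {0} - ({- int N..int N} - {0}). of_real (fejer_weight N n) * c n * cis (- (of_int n * t)) = 0"
    proof
      fix n assume "n \<in> {- int M..int M} - {0} - ({- int N..int N} - {0})"
      then have "int N \<le> \<bar>n\<bar>" by auto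
      then have "real N \<le> \<bar>real_of_int n\<bar>" by (metis of_int_abs of_int_le_iff of_int_of_nat_eq)
      then have "fejer_weight N n = 0" using assms by (simp add: fejer_weight_def le_divide_eq)
      then show "of_real (fejer_weight N n) * c n * cis (- (of_int n * t)) = 0" by simp
    qed
  qed (use assms in auto)
  then show ?thesis
    by (simp add: fejer_mean_def sum_subtractf[symmetric] diff_divide_distrib[symmetric] sum_divide_distrib
        left_diff_distrib)
qed

text \<open>Up to \<open>N\<close> there are at most \<open>N\<close> terms 1/N^2; beyond
  \<open>N\<close> the terms 1/n^2 are dominated by the telescoping 1/(n - 1) - 1/n.\<close>

lemma sum_min_inverse_squares:
  assumes "N > 0"
  shows "(\<Sum>n=1..M. min (1 / (real n)\<^sup>2) (1 / (real N)\<^sup>2)) \<le> 2 / real N"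
proof (cases "M \<le> N")
  case True
  have "(\<Sum>n=1..M. min (1 / (real n)\<^sup>2) (1 / (real N)\<^sup>2)) \<le> (\<Sum>n=1..M. 1 / (real N)\<^sup>2)"
    by (rule sum_mono) simp
  also have "\<dots> = real M * (1 / (real N)\<^sup>2)" by simp
  also have "\<dots> \<le> real N * (1 / (real N)\<^sup>2)" using True by (intro mult_right_mono) auto
  also have "\<dots> \<le> 2 / real N" using assms by (simp add: power2_eq_square divide_right_mono)
  finally show ?thesis .
next
  case False
  have "(\<Sum>n=1..M. min (1 / (real n)\<^sup>2) (1 / (real N)\<^sup>2)) \<le> 2 / real N - 1 / real M" if "N \<le> M" for M
    using that
  proof (induction M rule: dec_induct)
    case base
    have "(\<Sum>n=1..N. min (1 / (real n)\<^sup>2) (1 / (real N)\<^sup>2)) \<le> (\<Sum>n=1..N. 1 / (real N)\<^sup>2)"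
      by (rule sum_mono) simp
    then show ?case using assms by (simp add: power2_eq_square)
  next
    case (step M)
    have "min (1 / (real (Suc M))\<^sup>2) (1 / (real N)\<^sup>2) \<le> 1 / (real (Suc M))\<^sup>2" by simp
    also have "\<dots> \<le> 1 / (real M * real (Suc M))"
      using step(1) assms by (intro divide_left_mono) (auto simp: power2_eq_square)
    also have "\<dots> = 1 / real M - 1 / real (Suc M)"
      using step(1) assms by (simp add: field_simps)
    finally show ?case using step.IH by simp
  qed
  then have "(\<Sum>n=1..M. min (1 / (real n)\<^sup>2) (1 / (real N)\<^sup>2)) \<le> 2 / real N - 1 / real M"
    using False by simp
  also have "\<dots> \<le> 2 / real N" by simp
  finally show ?thesis .
qed

lemma sum_symmetric_int:
  fixes g :: "nat \<Rightarrow> real"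
  shows "(\<Sum>n\<in>{- int M..int M} - {0}. g (nat \<bar>n\<bar>)) = 2 * (\<Sum>n=1..M. g n)"
proof -
  have "{- int M..int M} - {0} = {- int M..-1} \<union> {1..int M}" by auto
  then have "(\<Sum>n\<in>{- int M..int M} - {0}. g (nat \<bar>n\<bar>))
      = (\<Sum>n\<in>{- int M..-1}. g (nat \<bar>n\<bar>)) + (\<Sum>n\<in>{1..int M}. g (nat \<bar>n\<bar>))"
    by (simp only:) (rule sum.union_disjoint, auto)
  also have "(\<Sum>n\<in>{- int M..-1}. g (nat \<bar>n\<bar>)) = (\<Sum>n=1..M. g n)"
    by (rule sum.reindex_bij_witness[of _ "\<lambda>n. - int n" "\<lambda>n. nat (- n)"]) auto
  also have "(\<Sum>n\<in>{1..int M}. g (nat \<bar>n\<bar>)) = (\<Sum>n=1..M. g n)"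
    by (rule sum.reindex_bij_witness[of _ int nat]) auto
  finally show ?thesis by simp
qed

text \<open>The two weights differ by at most min 1 (\<bar>n\<bar>/N). Against coefficients of size
  K/\<bar>n\<bar> the differences have a square sum of order 1/N, uniformly in
  \<open>M\<close>.\<close>

lemma integral_norm_fejer_mean_diff:
  assumes N: "0 < N" "N \<le> M" and c: "\<And>n. cmod (c n) \<le> K / \<bar>real_of_int n\<bar>" and \<delta>: "\<delta> > 0"
  shows "(LINT t|period. cmod (fejer_mean N c t - fejer_mean M c t)) \<le> pi * \<delta> + 4 * K\<^sup>2 / (real N * \<delta>)"
proof -
  define a where "a = (\<lambda>n. of_real (fejer_weight N n - fejer_weight M n) * c n / (2 * of_real pi))"
  have le: "(cmod (a n))\<^sup>2 \<le> (K\<^sup>2 / pi) * min (1 / (real (nat \<bar>n\<bar>))\<^sup>2) (1 / (real N)\<^sup>2)" if n: "n \<noteq> 0" for n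
  proof -
    define x where "x = \<bar>real_of_int n\<bar>"
    have x: "x > 0" using n by (simp add: x_def)
    have "x / real M \<le> x / real N" using N x by (intro divide_left_mono) auto
    moreover have "0 \<le> x / real M" using x by simp
    moreover have gen: "\<bar>max 0 (1 - u) - max 0 (1 - v)\<bar> \<le> 1 \<and> \<bar>max 0 (1 - u) - max 0 (1 - v)\<bar> \<le> u"
      if "0 \<le> v" "v \<le> u" for u v :: real
      using that by (auto simp: max_def)
    ultimately have w: "\<bar>fejer_weight N n - fejer_weight M n\<bar> \<le> 1"
      "\<bar>fejer_weight N n - fejer_weight M n\<bar> \<le> x / real N"
      using gen[of "x / real M" "x / real N"] by (simp_all add: fejer_weight_def x_def)
    have K: "cmod (c n) \<le> K / x" using c[of n] by (simp add: x_def)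
    then have "0 \<le> K / x" using norm_ge_zero order_trans by blast
    then have K0: "0 \<le> K" using x by (simp add: zero_le_divide_iff)
    have "\<bar>fejer_weight N n - fejer_weight M n\<bar> * cmod (c n) \<le> min 1 (x / real N) * (K / x)"
      using w K x K0 by (intro mult_mono) auto
    also have "\<dots> = K * min (1 / x) (1 / real N)"
      using x K0 by (simp add: min_def field_simps)
    finally have "cmod (a n) \<le> K * min (1 / x) (1 / real N) / (2 * pi)"
      by (simp add: a_def norm_mult norm_divide divide_right_mono flip: of_real_diff)
    then have "(cmod (a n))\<^sup>2 \<le> (K * min (1 / x) (1 / real N) / (2 * pi))\<^sup>2" by (rule power_mono) simp
    also have "\<dots> = K\<^sup>2 / (2 * pi)\<^sup>2 * (min (1 / x) (1 / real N))\<^sup>2"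
      by (simp add: power_mult_distrib power_divide)
    also have "\<dots> \<le> K\<^sup>2 / pi * (min (1 / x) (1 / real N))\<^sup>2"
      using pi_gt3 by (intro mult_right_mono divide_left_mono) (auto simp: power2_eq_square)
    also have "(min (1 / x) (1 / real N))\<^sup>2 = min (1 / x\<^sup>2) (1 / (real N)\<^sup>2)"
      using x by (auto simp: min_def power_divide divide_simps power2_eq_square mult_le_cancel_left mult_mono
          abs_le_square_iff[unfolded power2_eq_square, symmetric])
    also have "x = real (nat \<bar>n\<bar>)" by (simp add: x_def)
    finally show ?thesis .
  qed
  have "(\<Sum>n\<in>{- int M..int M} - {0}. (cmod (a n))\<^sup>2)
      \<le> (\<Sum>n\<in>{- int M..int M} - {0}. (K\<^sup>2 / pi) * min (1 / (real (nat \<bar>n\<bar>))\<^sup>2) (1 / (real N)\<^sup>2))"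
    by (intro sum_mono le) auto
  also have "\<dots> = (K\<^sup>2 / pi) * (2 * (\<Sum>n=1..M. min (1 / (real n)\<^sup>2) (1 / (real N)\<^sup>2)))"
    unfolding sum_distrib_left[symmetric]
    by (subst sum_symmetric_int[of "\<lambda>n. min (1 / (real n)\<^sup>2) (1 / (real N)\<^sup>2)" M]) simp
  also have "\<dots> \<le> (K\<^sup>2 / pi) * (2 * (2 / real N))"
    by (intro mult_left_mono sum_min_inverse_squares N) auto
  finally have S: "(\<Sum>n\<in>{- int M..int M} - {0}. (cmod (a n))\<^sup>2) \<le> 4 * K\<^sup>2 / (pi * real N)"
    by (simp add: mult.commute)
  have "(LINT t|period. cmod (fejer_mean N c t - fejer_mean M c t))
      \<le> pi * \<delta> + pi * (\<Sum>n\<in>{- int M..int M} - {0}. (cmod (a n))\<^sup>2) / \<delta>"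
    using integral_norm_trig_sum_le[OF _ \<delta>, of "{- int M..int M} - {0}" a]
    unfolding fejer_mean_diff[OF N] a_def by blast
  also have "\<dots> \<le> pi * \<delta> + pi * (4 * K\<^sup>2 / (pi * real N)) / \<delta>"
    using S \<delta> by (intro add_left_mono divide_right_mono mult_left_mono) auto
  finally show ?thesis by simp
qed

lemma fejer_mean_add: "(\<And>n. n \<noteq> 0 \<Longrightarrow> c n = c1 n + c2 n) \<Longrightarrow> fejer_mean N c t = fejer_mean N c1 t + fejer_mean N c2 t"
  by (simp add: fejer_mean_def add_divide_distrib[symmetric] sum.distrib[symmetric] algebra_simps)

lemma integral_cis_fejer_mean:
  assumes "n \<noteq> 0" and N: "N > 0"
  shows "(LINT t|period. cis (of_int n * t) * fejer_mean N c t) = of_real (fejer_weight N n) * c n"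
proof -
  let ?I = "{- int N..int N} - {0}"
  have "(LINT t|period. cis (of_int n * t) * fejer_mean N c t)
      = (LINT t|period. (\<Sum>m\<in>?I. of_real (fejer_weight N m) * c m * cis (of_int (n - m) * t) / (2 * of_real pi)))"
  proof (intro Bochner_Integration.integral_cong refl)
    fix t
    have "cis (of_int n * t) * cis (- (of_int m * t)) = cis (of_int (n - m) * t)" for m
      by (simp add: cis_mult algebra_simps)
    then show "cis (of_int n * t) * fejer_mean N c t
        = (\<Sum>m\<in>?I. of_real (fejer_weight N m) * c m * cis (of_int (n - m) * t) / (2 * of_real pi))"
      by (simp only: fejer_mean_def sum_distrib_left sum_divide_distrib times_divide_eq_right
          mult.left_commute[of "cis (of_int n * t)"])
  qed
  also have "\<dots> = (\<Sum>m\<in>?I. of_real (fejer_weight N m) * c m * (LINT t|period. cis (of_int (n - m) * t)) / (2 * of_real pi))"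
    by (subst Bochner_Integration.integral_sum)
       (auto intro!: integrable_period[where C = 1] integrable_mult_right integrable_divide)
  also have "\<dots> = (\<Sum>m\<in>?I. if m = n then of_real (fejer_weight N n) * c n else 0)"
    unfolding integral_cis_period by (intro sum.cong refl) auto
  also have "\<dots> = of_real (fejer_weight N n) * c n"
  proof (cases "n \<in> ?I")
    case False
    then have "int N \<le> \<bar>n\<bar>" using assms by auto
    then have "real N \<le> \<bar>real_of_int n\<bar>" by (metis of_int_abs of_int_le_iff of_int_of_nat_eq)
    then have "fejer_weight N n = 0" using N by (simp add: fejer_weight_def le_divide_eq)
    then show ?thesis using False by simp
  qed simp
  finally show ?thesis .
qed

lemma fejer_weight_tendsto: "(\<lambda>N. fejer_weight (Suc N) n) \<longlonglongrightarrow> 1"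
proof -
  have "(\<lambda>N. max 0 (1 - \<bar>real_of_int n\<bar> / real (Suc N))) \<longlonglongrightarrow> max 0 (1 - 0)"
    by (intro tendsto_intros LIMSEQ_Suc[OF lim_const_over_n])
  then show ?thesis by (simp add: fejer_weight_def)
qed

text \<open>The Fejer means of \<open>c1\<close> are Cauchy by the mean square estimate, those of
  \<open>c2\<close> are uniformly small by duality. Hence the Fejer means of \<open>c\<close> are
  Cauchy in L^1, and the moments pass to the limit because the weights tend to 1.\<close>

lemma fourier_coefficients_L1:
  fixes c :: "int \<Rightarrow> complex"
  assumes split: "\<And>\<epsilon>. \<epsilon> > 0 \<Longrightarrow> \<exists>c1 c2 K. (\<forall>n. n \<noteq> 0 \<longrightarrow> c n = c1 n + c2 n) \<and>
      (\<forall>n. cmod (c1 n) \<le> K / \<bar>real_of_int n\<bar>) \<and>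
      (\<forall>I b Q. finite I \<longrightarrow> 0 \<notin> I \<longrightarrow> (\<forall>t. cmod (\<Sum>n\<in>I. b n * cis (of_int n * t)) \<le> Q)
        \<longrightarrow> cmod (\<Sum>n\<in>I. b n * c2 n) \<le> \<epsilon> * Q)"
  obtains \<eta> where "integrable period \<eta>" "\<And>n. n \<noteq> 0 \<Longrightarrow> (LINT t|period. cis (of_int n * t) * \<eta> t) = c n"
proof -
  define p where "p = (\<lambda>N. fejer_mean (Suc N) c)"
  have int_p: "integrable period (p N)" for N unfolding p_def by (rule integrable_fejer_mean)
  have cauchy: "\<exists>N0. \<forall>N\<ge>N0. \<forall>M\<ge>N0. (LINT t|period. cmod (p N t - p M t)) < e" if e: "e > 0" for e
  proof -
    \<comment> \<open>The parts add up to at most 4 \<epsilon> + \<epsilon> + 2 \<epsilon> + 2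
      \<epsilon>, which is below 16 \<epsilon>.\<close>
    define \<epsilon> where "\<epsilon> = e / 16"
    have \<epsilon>: "\<epsilon> > 0" using e by (simp add: \<epsilon>_def)
    obtain c1 c2 K where split': "\<forall>n. n \<noteq> 0 \<longrightarrow> c n = c1 n + c2 n" "\<forall>n. cmod (c1 n) \<le> K / \<bar>real_of_int n\<bar>"
      "\<forall>I b Q. finite I \<longrightarrow> 0 \<notin> I \<longrightarrow> (\<forall>t. cmod (\<Sum>n\<in>I. b n * cis (of_int n * t)) \<le> Q)
        \<longrightarrow> cmod (\<Sum>n\<in>I. b n * c2 n) \<le> \<epsilon> * Q"
      using split[OF \<epsilon>] by (elim exE conjE)
    note c = split'(1)[rule_format] and c1 = split'(2)[rule_format] and c2 = split'(3)[rule_format]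
    obtain N0 :: nat where N0: "4 * K\<^sup>2 / \<epsilon>\<^sup>2 < real N0" using reals_Archimedean2 by blast
    have less: "(LINT t|period. cmod (p N t - p M t)) < e" if "N0 \<le> N" "N \<le> M" for N M
    proof -
      define d1 where "d1 = (\<lambda>t. fejer_mean (Suc N) c1 t - fejer_mean (Suc M) c1 t)"
      define f where "f = (\<lambda>N. fejer_mean (Suc N) c2)"
      have i: "integrable period d1" "integrable period (f N)" for N
        unfolding d1_def f_def by (intro Bochner_Integration.integrable_diff integrable_fejer_mean)+
      have f: "(LINT t|period. cmod (f N t)) \<le> 2 * \<epsilon>" for N
        unfolding f_def by (rule integral_norm_fejer_mean[OF _ c2]) auto
      have tri: "cmod (x + (y - z)) \<le> cmod x + (cmod y + cmod z)" for x y z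
        using norm_triangle_ineq[of x "y - z"] norm_triangle_ineq4[of y z] by linarith
      have "p N t - p M t = d1 t + (f N t - f M t)" for t
        by (simp add: p_def d1_def f_def fejer_mean_add[OF c])
      then have "(LINT t|period. cmod (p N t - p M t)) \<le> (LINT t|period. cmod (d1 t) + (cmod (f N t) + cmod (f M t)))"
        by (intro integral_mono integrable_norm Bochner_Integration.integrable_add Bochner_Integration.integrable_diff int_p i)
           (simp add: tri)
      also have "\<dots> = (LINT t|period. cmod (d1 t)) + ((LINT t|period. cmod (f N t)) + (LINT t|period. cmod (f M t)))"
        using i by simp
      also have "(LINT t|period. cmod (d1 t)) \<le> pi * \<epsilon> + 4 * K\<^sup>2 / (real (Suc N) * \<epsilon>)"
        unfolding d1_def by (rule integral_norm_fejer_mean_diff[OF _ _ c1 \<epsilon>]) (use that in auto)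
      also have "4 * K\<^sup>2 / (real (Suc N) * \<epsilon>) \<le> \<epsilon>"
      proof -
        have "4 * K\<^sup>2 / \<epsilon>\<^sup>2 \<le> real (Suc N)" using N0 that by simp
        then have "4 * K\<^sup>2 \<le> real (Suc N) * \<epsilon>\<^sup>2" using \<epsilon> by (simp add: pos_divide_le_eq)
        then have "4 * K\<^sup>2 \<le> \<epsilon> * (real (Suc N) * \<epsilon>)" by (simp add: power2_eq_square mult_ac)
        then show ?thesis using \<epsilon> by (simp add: pos_divide_le_eq del: of_nat_Suc)
      qed
      also have "pi * \<epsilon> \<le> 4 * \<epsilon>" using pi_less_4 \<epsilon> by (intro mult_right_mono) auto
      finally show ?thesis using f[of N] f[of M] \<epsilon> by (simp add: \<epsilon>_def)
    qed
    show ?thesis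
    proof (intro exI[of _ N0] allI impI)
      fix N M assume "N0 \<le> N" "N0 \<le> M"
      then show "(LINT t|period. cmod (p N t - p M t)) < e"
        using less[of N M] less[of M N] by (cases "N \<le> M") (auto simp: norm_minus_commute)
    qed
  qed
  obtain \<eta> where \<eta>: "integrable period \<eta>" "(\<lambda>N. LINT t|period. cmod (p N t - \<eta> t)) \<longlonglongrightarrow> 0"
    using L1_complete[OF int_p cauchy] by blast
  show ?thesis
  proof (rule that[OF \<eta>(1)])
    fix n :: int assume n: "n \<noteq> 0"
    have int_cis: "integrable period (\<lambda>t. cis (of_int n * t) * f t)" if "integrable period f" for f
    proof (rule Bochner_Integration.integrable_bound[OF that])
      show "(\<lambda>t. cis (of_int n * t) * f t) \<in> borel_measurable period"
        by (rule borel_measurable_times[OF measurable_period borel_measurable_integrable[OF that]]) measurable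
    qed (simp add: norm_mult)
    have "(\<lambda>N. (LINT t|period. cis (of_int n * t) * p N t) - (LINT t|period. cis (of_int n * t) * \<eta> t)) \<longlonglongrightarrow> 0"
    proof (rule Lim_null_comparison[OF always_eventually \<eta>(2)], rule allI)
      fix N
      have "(LINT t|period. cis (of_int n * t) * p N t) - (LINT t|period. cis (of_int n * t) * \<eta> t)
          = (LINT t|period. cis (of_int n * t) * (p N t - \<eta> t))"
        by (simp add: right_diff_distrib int_cis int_p \<eta>)
      also have "cmod \<dots> \<le> (LINT t|period. cmod (cis (of_int n * t) * (p N t - \<eta> t)))"
        by (rule integral_norm_bound)
      finally show "cmod ((LINT t|period. cis (of_int n * t) * p N t) - (LINT t|period. cis (of_int n * t) * \<eta> t))
          \<le> (LINT t|period. cmod (p N t - \<eta> t))"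
        by (simp add: norm_mult)
    qed
    then have "(\<lambda>N. LINT t|period. cis (of_int n * t) * p N t) \<longlonglongrightarrow> (LINT t|period. cis (of_int n * t) * \<eta> t)"
      by (simp add: LIM_zero_cancel)
    moreover have "(\<lambda>N. of_real (fejer_weight (Suc N) n) * c n) \<longlonglongrightarrow> of_real 1 * c n"
      by (intro tendsto_intros fejer_weight_tendsto)
    ultimately show "(LINT t|period. cis (of_int n * t) * \<eta> t) = c n"
      unfolding p_def integral_cis_fejer_mean[OF n zero_less_Suc] using LIMSEQ_unique by fastforce
  qed
qed

section \<open>Uniqueness of Fourier coefficients\<close>

text \<open>The positive and the negative part of \<open>g\<close> are densities of two measures
  that agree and are finite on every half-line, hence are equal. The Borel version \<open>g\<close>
  replaces \<open>h\<close> because the densities are taken over \<open>lborel\<close>.\<close>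

lemma AE_zero_if_integrals_zero:
  fixes h :: "real \<Rightarrow> real"
  assumes h: "integrable lebesgue h" and zero: "\<And>x. (LINT t|lebesgue. indicator {x<..} t * h t) = 0"
  shows "AE t in lebesgue. h t = 0"
proof -
  obtain g where g [measurable]: "g \<in> borel_measurable lborel" and hg: "AE t in lborel. h t = g t"
    using completion_ex_borel_measurable_real[OF borel_measurable_integrable[OF h]] by blast
  have hg': "AE t in lebesgue. h t = g t" by (rule AE_completion[OF hg])
  have "integrable lebesgue g"
    using h by (rule integrable_cong_AE[THEN iffD1, rotated -1])
      (use hg' in \<open>auto intro: borel_measurable_integrable[OF h] measurable_completion\<close>)
  then have int_g: "integrable lborel g" by (simp add: integrable_completion)
  have zero_g: "(LINT t|lborel. indicator {x<..} t * g t) = 0" for x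
  proof -
    have "(LINT t|lborel. indicator {x<..} t * g t) = (LINT t|lebesgue. indicator {x<..} t * g t)"
      by (rule integral_completion[symmetric]) measurable
    also have "\<dots> = (LINT t|lebesgue. indicator {x<..} t * h t)"
    proof (rule integral_cong_AE)
      show "(\<lambda>t. indicator {x<..} t * g t) \<in> borel_measurable lebesgue"
        by (rule measurable_completion) measurable
      show "(\<lambda>t. indicator {x<..} t * h t) \<in> borel_measurable lebesgue"
        by (intro borel_measurable_times borel_measurable_indicator borel_measurable_integrable[OF h]) auto
      show "AE t in lebesgue. indicator {x<..} t * g t = indicator {x<..} t * h t"
        using hg' by eventually_elim simp
    qed
    finally show ?thesis using zero by simp
  qed
  define P where "P = density lborel (\<lambda>t. ennreal (g t))"
  define N where "N = density lborel (\<lambda>t. ennreal (- g t))"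
  have em: "emeasure P {x<..} = (\<integral>\<^sup>+t. ennreal (indicator {x<..} t * g t) \<partial>lborel)"
    "emeasure N {x<..} = (\<integral>\<^sup>+t. ennreal (- (indicator {x<..} t * g t)) \<partial>lborel)" for x
    by (auto simp: P_def N_def emeasure_density indicator_def intro!: nn_integral_cong)
  have int_ind: "integrable lborel (\<lambda>t. indicator {x<..} t * g t)" for x
    using integrable_mult_indicator[OF _ int_g, of "{x<..}"] by simp
  have "P = N"
  proof (rule measure_eqI_lessThan)
    show "emeasure P {x<..} < \<infinity>" for x
      unfolding em using int_ind[of x] by (simp add: real_integrable_def less_top)
    show "emeasure P {x<..} = emeasure N {x<..}" for x
    proof -
      have "emeasure P {x<..} < top" "emeasure N {x<..} < top"
        unfolding em using int_ind[of x] by (simp_all add: real_integrable_def less_top)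
      moreover have "enn2real (emeasure P {x<..}) = enn2real (emeasure N {x<..})"
        using zero_g[of x] unfolding em real_lebesgue_integral_def[OF int_ind] by simp
      ultimately show ?thesis by (metis ennreal_enn2real)
    qed
  qed (simp_all add: P_def N_def)
  then have "AE t in lborel. ennreal (g t) = ennreal (- g t)"
    unfolding P_def N_def by (subst (asm) sigma_finite_measure.density_unique_iff[OF sigma_finite_lborel]) measurable
  then have "AE t in lborel. g t = 0"
    by eventually_elim (metis ennreal_eq_0_iff ennreal_neg linorder_le_cases neg_le_0_iff_le antisym)
  from AE_completion[OF this] hg' show ?thesis by eventually_elim simp
qed

section \<open>Trigonometric polynomials and approximation of arcs\<close>

inductive trig_poly :: "(real \<Rightarrow> complex) \<Rightarrow> bool" where
  monomial: "trig_poly (\<lambda>t. c * cis (of_int n * t))"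
| add: "trig_poly f \<Longrightarrow> trig_poly g \<Longrightarrow> trig_poly (\<lambda>t. f t + g t)"

lemma trig_poly_mult:
  assumes "trig_poly f" "trig_poly g"
  shows "trig_poly (\<lambda>t. f t * g t)"
  using assms(1)
proof induction
  case (monomial c n)
  show ?case
    using assms(2)
  proof induction
    case (monomial d m)
    have "c * cis (of_int n * t) * (d * cis (of_int m * t)) = c * d * cis (of_int (n + m) * t)" for t
    proof -
      have "cis (of_int (n + m) * t) = cis (of_int n * t) * cis (of_int m * t)"
        by (simp add: cis_mult algebra_simps)
      then show ?thesis by (simp only: mult_ac)
    qed
    then show ?case by (simp only: trig_poly.monomial)
  next
    case (add f g)
    then show ?case by (simp add: distrib_left trig_poly.add)
  qed
next
  case (add f g)
  then show ?case by (simp add: distrib_right trig_poly.add)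
qed

text \<open>The link to Stone-Weierstrass, which supplies polynomial functions on the plane: on the
  circle a real linear functional is a combination of \<open>cis t\<close> and
  \<open>cis (- t)\<close>.\<close>

lemma trig_poly_real_polynomial:
  assumes "real_polynomial_function F"
  shows "trig_poly (\<lambda>t. complex_of_real (F (cis t)))"
  using assms
proof induction
  case (linear F)
  have "complex_of_real (F (cis t)) = ((F 1 - \<i> * F \<i>) / 2) * cis (of_int 1 * t) + ((F 1 + \<i> * F \<i>) / 2) * cis (of_int (-1) * t)" for t
  proof -
    interpret F: bounded_linear F by fact
    have "cis t = cos t *\<^sub>R 1 + sin t *\<^sub>R \<i>" by (simp add: complex_eq_iff)
    then have "F (cis t) = cos t * F 1 + sin t * F \<i>" by (simp add: F.add F.scaleR)
    then show ?thesis by (simp add: complex_eq_iff field_simps)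
  qed
  then show ?case by (simp only: trig_poly.intros)
next
  case (const c)
  show ?case using trig_poly.monomial[of "of_real c" 0] by simp
next
  case (add f g)
  then show ?case by (simp add: trig_poly.add)
next
  case (mult f g)
  then show ?case by (simp add: trig_poly_mult)
qed

text \<open>The open interval from 2 \<pi> - 2 w to 2 \<pi> is an arc centred at 2 \<pi> - w. As a
  superlevel set of a cosine, its indicator can be approached by continuous functions of
  \<open>cis t\<close>.\<close>

lemma cos_arc_iff:
  assumes w: "0 < w" "w \<le> pi" and t: "0 \<le> t" "t \<le> 2 * pi"
  shows "cos w < cos (t - (2 * pi - w)) \<longleftrightarrow> 2 * pi - 2 * w < t \<and> t < 2 * pi"
proof -
  define d where "d = t - (2 * pi - w)"
  have pos: "cos w < cos d" if "\<bar>d\<bar> < w"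
    using that w cos_monotone_0_pi[of "\<bar>d\<bar>" w] by simp
  have neg: "cos d \<le> cos w" if "w \<le> \<bar>d\<bar>" "\<bar>d\<bar> \<le> 2 * pi - w"
  proof (cases "\<bar>d\<bar> \<le> pi")
    case True
    then show ?thesis using that w cos_monotone_0_pi_le[of w "\<bar>d\<bar>"] by simp
  next
    case False
    have "cos d = cos (2 * pi - \<bar>d\<bar>)" by (simp add: cos_diff)
    also have "\<dots> \<le> cos w" using that w False by (intro cos_monotone_0_pi_le) auto
    finally show ?thesis .
  qed
  have "2 * pi - 2 * w < t \<and> t < 2 * pi \<longleftrightarrow> \<bar>d\<bar> < w" by (auto simp: d_def)
  moreover have "\<bar>d\<bar> \<le> 2 * pi - w" using w t by (auto simp: d_def)
  ultimately show ?thesis using pos neg unfolding d_def[symmetric] by (meson linorder_not_le)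
qed

lemma integrable_bounded_mult:
  fixes f h :: "real \<Rightarrow> complex"
  assumes h: "integrable lebesgue h" and f: "f \<in> borel_measurable borel" "\<And>t. cmod (f t) \<le> C"
  shows "integrable lebesgue (\<lambda>t. f t * h t)"
proof (rule Bochner_Integration.integrable_bound[OF integrable_mult_right[OF h, of "of_real C"]])
  have "f \<in> borel_measurable lebesgue" by (rule measurable_completion) (use f(1) in simp)
  then show "(\<lambda>t. f t * h t) \<in> borel_measurable lebesgue"
    by (rule borel_measurable_times[OF _ borel_measurable_integrable[OF h]])
  have "cmod (f t) \<le> \<bar>C\<bar>" for t using f(2)[of t] by linarith
  then show "AE t in lebesgue. norm (f t * h t) \<le> norm (of_real C * h t)"
    by (intro AE_I2) (simp add: norm_mult mult_right_mono)
qed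

text \<open>The integrals against \<open>h\<close> vanish for trigonometric polynomials, by
  Stone-Weierstrass for continuous functions of \<open>cis t\<close>, and by dominated convergence
  for arcs ending at 2 \<pi>. Half-lines meet the support in such arcs, in all of it, or in a null
  part, which leads to \<open>AE_zero_if_integrals_zero\<close>.\<close>

lemma AE_zero_if_fourier_zero:
  fixes h :: "real \<Rightarrow> complex"
  assumes h: "integrable lebesgue h" and supp: "\<And>t. t \<notin> {0..2 * pi} \<Longrightarrow> h t = 0"
    and zero: "\<And>n. (LINT t|lebesgue. cis (of_int n * t) * h t) = 0"
  shows "AE t in lebesgue. h t = 0"
proof -
  note int_mult = integrable_bounded_mult[OF h]
  have trig: "integrable lebesgue (\<lambda>t. f t * h t) \<and> (LINT t|lebesgue. f t * h t) = 0" if "trig_poly f" for f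
    using that
  proof induction
    case (monomial c n)
    have "integrable lebesgue (\<lambda>t. cis (of_int n * t) * h t)"
      by (rule int_mult[where C = 1]) auto
    then show ?case by (simp add: mult.assoc zero)
  qed (simp add: distrib_right)
  have cont: "(LINT t|lebesgue. complex_of_real (F (cis t)) * h t) = 0" if F: "continuous_on UNIV F" for F :: "complex \<Rightarrow> real"
  proof -
    have Fm: "(\<lambda>t. complex_of_real (F (cis t))) \<in> borel_measurable borel"
      by (intro borel_measurable_continuous_onI continuous_intros continuous_on_compose2[OF F]) auto
    have "compact (F ` sphere 0 1)"
      by (intro compact_continuous_image continuous_on_subset[OF F] compact_sphere) auto
    then have "bounded (F ` sphere 0 1)" by (rule compact_imp_bounded)
    then obtain C where C: "\<And>z. z \<in> sphere 0 1 \<Longrightarrow> \<bar>F z\<bar> \<le> C"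
      unfolding bounded_iff ball_simps real_norm_def by blast
    have int_F: "integrable lebesgue (\<lambda>t. complex_of_real (F (cis t)) * h t)"
      by (rule int_mult[OF Fm, of C]) (simp add: C)
    have le: "cmod (LINT t|lebesgue. complex_of_real (F (cis t)) * h t) \<le> e * (LINT t|lebesgue. cmod (h t))" if e: "e > 0" for e
    proof -
      obtain g where g: "real_polynomial_function g" "\<And>z. z \<in> sphere 0 1 \<Longrightarrow> \<bar>F z - g z\<bar> < e"
        using Stone_Weierstrass_real_polynomial_function[OF compact_sphere continuous_on_subset[OF F subset_UNIV] e] by blast
      note tg = trig[OF trig_poly_real_polynomial[OF g(1)]]
      have "(LINT t|lebesgue. complex_of_real (F (cis t)) * h t)
          = (LINT t|lebesgue. complex_of_real (F (cis t)) * h t - complex_of_real (g (cis t)) * h t)"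
        using tg int_F by simp
      also have "cmod \<dots> \<le> (LINT t|lebesgue. cmod (complex_of_real (F (cis t)) * h t - complex_of_real (g (cis t)) * h t))"
        by (rule integral_norm_bound)
      also have "\<dots> \<le> (LINT t|lebesgue. e * cmod (h t))"
      proof (rule integral_mono)
        show "integrable lebesgue (\<lambda>t. cmod (complex_of_real (F (cis t)) * h t - complex_of_real (g (cis t)) * h t))"
          using tg int_F by (intro integrable_norm Bochner_Integration.integrable_diff) auto
        show "integrable lebesgue (\<lambda>t. e * cmod (h t))"
          using h by (intro integrable_mult_right integrable_norm)
        show "cmod (complex_of_real (F (cis t)) * h t - complex_of_real (g (cis t)) * h t) \<le> e * cmod (h t)" for t
          using g(2)[of "cis t"]
          by (simp add: left_diff_distrib[symmetric] norm_mult mult_right_mono flip: of_real_diff)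
      qed
      finally show ?thesis by simp
    qed
    have "cmod (LINT t|lebesgue. complex_of_real (F (cis t)) * h t) \<le> 0"
    proof (rule field_le_epsilon)
      fix e :: real assume e: "e > 0"
      define I where "I = (LINT t|lebesgue. cmod (h t))"
      have I: "0 \<le> I" unfolding I_def by (rule Bochner_Integration.integral_nonneg) simp
      have "e / (I + 1) * I \<le> e" using I e by (simp add: divide_le_eq mult_left_mono)
      with le[of "e / (I + 1)"] I e show "cmod (LINT t|lebesgue. complex_of_real (F (cis t)) * h t) \<le> 0 + e"
        by (simp add: I_def[symmetric])
    qed
    then show ?thesis by simp
  qed
  have arc: "(LINT t|lebesgue. of_real (indicator {x<..} t) * h t) = 0" for x
  proof -
    consider "x < 0" | "0 \<le> x" "x < 2 * pi" | "2 * pi \<le> x" by linarith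
    then show ?thesis
    proof cases
      case 1
      then have "of_real (indicator {x<..} t) * h t = cis (of_int 0 * t) * h t" for t
        using supp[of t] by (auto simp: indicator_def)
      then show ?thesis by (simp only: zero)
    next
      case 3
      then have "of_real (indicator {x<..} t) * h t = 0" for t
        using supp[of t] by (auto simp: indicator_def)
      then show ?thesis by (simp only: Bochner_Integration.integral_zero)
    next
      case 2
      define w where "w = (2 * pi - x) / 2"
      have w: "0 < w" "w \<le> pi" using 2 by (auto simp: w_def)
      \<comment> \<open>\<open>{x<..<2 * pi}\<close> is an open arc, centred at \<open>cis (2 * pi - w)\<close>, hence \<open>F\<close> increases to its indicator\<close>
      define F where "F = (\<lambda>k z. min 1 (real k * max 0 (Re (z * cis (- (2 * pi - w))) - cos w)))"
      have F: "F k (cis t) = min 1 (real k * max 0 (cos (t - (2 * pi - w)) - cos w))" for k t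
        unfolding F_def cis_mult by (simp only: cis.simps diff_conv_add_uminus)
      have "(\<lambda>k. LINT t|lebesgue. complex_of_real (F k (cis t)) * h t)
          \<longlonglongrightarrow> (LINT t|lebesgue. of_real (indicator {x<..} t) * h t)"
      proof (rule integral_dominated_convergence[where w = "\<lambda>t. cmod (h t)"])
        have "(\<lambda>t. complex_of_real (F k (cis t))) \<in> borel_measurable borel" for k
          unfolding F by (intro borel_measurable_continuous_onI continuous_intros)
        moreover have "cmod (complex_of_real (F k (cis t))) \<le> 1" for k t
          unfolding F norm_of_real by (auto simp: abs_if min_def intro: order_trans[OF _ mult_nonneg_nonneg])
        ultimately show "(\<lambda>t. complex_of_real (F k (cis t)) * h t) \<in> borel_measurable lebesgue"
          and "AE t in lebesgue. norm (complex_of_real (F k (cis t)) * h t) \<le> cmod (h t)" for k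
          by (auto intro!: borel_measurable_integrable[OF int_mult[of _ 1]] AE_I2 simp: norm_mult mult_left_le_one_le)
        show "(\<lambda>t. of_real (indicator {x<..} t) * h t) \<in> borel_measurable lebesgue"
          by (rule borel_measurable_integrable[OF int_mult[of _ 1]]) (auto simp: indicator_def)
        \<comment> \<open>At 2 \<pi> all \<open>F k\<close> vanish, as they do at 0, while the
          indicator is 1.\<close>
        have "AE t in lebesgue. t \<noteq> 2 * pi"
          by (rule AE_completion) (rule AE_lborel_singleton)
        then show "AE t in lebesgue. (\<lambda>k. complex_of_real (F k (cis t)) * h t)
            \<longlonglongrightarrow> of_real (indicator {x<..} t) * h t"
        proof eventually_elim
          case (elim t)
          show ?case
          proof (cases "t \<in> {0..2 * pi}")
            case False
            then show ?thesis using supp by simp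
          next
            case True
            have x: "x = 2 * pi - 2 * w" by (simp add: w_def field_simps)
            define d where "d = cos (t - (2 * pi - w)) - cos w"
            have iff: "0 < d \<longleftrightarrow> x < t"
              using cos_arc_iff[OF w, of t] True elim by (auto simp: x d_def)
            have "(\<lambda>k. F k (cis t)) \<longlonglongrightarrow> indicator {x<..} t"
            proof (cases "0 < d")
              case True
              have "\<forall>\<^sub>F k in sequentially. F k (cis t) = 1"
              proof -
                obtain K :: nat where K: "1 / d < real K" using reals_Archimedean2 by blast
                have "F k (cis t) = 1" if "k \<ge> K" for k
                proof -
                  have "1 / d \<le> real k" using K that by simp
                  then have "1 \<le> real k * d" using True by (simp add: pos_divide_le_eq)
                  then show ?thesis using True unfolding F d_def[symmetric] by simp
                qed
                then show ?thesis by (auto simp: eventually_sequentially)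
              qed
              then show ?thesis using iff True by (simp add: tendsto_eventually)
            next
              case False
              then have "F k (cis t) = 0" for k unfolding F d_def[symmetric] by simp
              then show ?thesis using iff False by simp
            qed
            then show ?thesis by (intro tendsto_intros)
          qed
        qed
      qed (use h in \<open>auto intro: integrable_norm\<close>)
      moreover have "(LINT t|lebesgue. complex_of_real (F k (cis t)) * h t) = 0" for k
        by (rule cont) (unfold F_def, intro continuous_intros)
      ultimately have "(\<lambda>k::nat. 0) \<longlonglongrightarrow> (LINT t|lebesgue. of_real (indicator {x<..} t) * h t)"
        by simp
      from LIMSEQ_unique[OF this tendsto_const] show ?thesis .
    qed
  qed
  have int_arc: "integrable lebesgue (\<lambda>t. of_real (indicator {x<..} t) * h t)" for x
    by (rule int_mult[where C = 1]) (auto simp: indicator_def)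
  have "AE t in lebesgue. Re (h t) = 0"
  proof (rule AE_zero_if_integrals_zero)
    show "(LINT t|lebesgue. indicator {x<..} t * Re (h t)) = 0" for x
      using arg_cong[OF arc[of x], of Re] integral_Re[OF int_arc[of x]] by simp
  qed (use h in \<open>auto intro: integrable_Re\<close>)
  moreover have "AE t in lebesgue. Im (h t) = 0"
  proof (rule AE_zero_if_integrals_zero)
    show "(LINT t|lebesgue. indicator {x<..} t * Im (h t)) = 0" for x
      using arg_cong[OF arc[of x], of Im] integral_Im[OF int_arc[of x]] by simp
  qed (use h in \<open>auto intro: integrable_Im\<close>)
  ultimately show ?thesis by eventually_elim (simp add: complex_eq_iff)
qed

section \<open>Functions on the circle with summable second derivative\<close>

lemma has_sum_minus:
  fixes f g :: "'i \<Rightarrow> 'a::real_normed_vector"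
  assumes "(f has_sum a) A" "(g has_sum b) A"
  shows "((\<lambda>x. f x - g x) has_sum (a - b)) A"
  using has_sum_add[OF assms(1), of "\<lambda>x. - g x" "- b"] assms(2) by (simp add: has_sum_uminus)

lemma infsum_tail_less:
  fixes k :: "'i \<Rightarrow> real"
  assumes "k summable_on UNIV" "e > 0"
  obtains F where "finite F" "infsum k (- F) < e"
proof -
  obtain F where F: "finite F" "dist (sum k F) (infsum k UNIV) \<le> e / 2"
    using has_sum_finite_approximation[OF has_sum_infsum[OF assms(1)], of "e / 2"] assms(2) by auto
  have "(k has_sum (infsum k UNIV - sum k F)) (UNIV - F)"
    by (intro has_sum_Diff has_sum_infsum assms has_sum_finite F) auto
  then have "infsum k (- F) = infsum k UNIV - sum k F" by (simp add: infsumI Compl_eq_Diff_UNIV)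
  also have "\<dots> \<le> dist (sum k F) (infsum k UNIV)"
    using abs_ge_minus_self[of "sum k F - infsum k UNIV"] by (simp add: dist_real_def)
  also have "\<dots> < e" using F(2) assms(2) by linarith
  finally show ?thesis using that F(1) by blast
qed

lemma norm_iexp_diff_le:
  "cmod (exp (\<i> * of_real x) - 1 - \<i> * of_real x) \<le> x\<^sup>2" "cmod (exp (\<i> * of_real x) - 1 - \<i> * of_real x) \<le> 2 * \<bar>x\<bar>"
proof -
  show "cmod (exp (\<i> * of_real x) - 1 - \<i> * of_real x) \<le> x\<^sup>2"
    using Taylor_exp[of "\<i> * of_real x" 1] by (simp add: norm_mult algebra_simps power2_eq_square)
  have "cmod (exp (\<i> * of_real x) - 1) \<le> \<bar>x\<bar>"
    using Taylor_exp[of "\<i> * of_real x" 0] by (simp add: norm_mult)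
  moreover have "cmod (exp (\<i> * of_real x) - 1 - \<i> * of_real x) \<le> cmod (exp (\<i> * of_real x) - 1) + cmod (\<i> * of_real x)"
    by (rule norm_triangle_ineq4)
  ultimately show "cmod (exp (\<i> * of_real x) - 1 - \<i> * of_real x) \<le> 2 * \<bar>x\<bar>"
    by (simp add: norm_mult)
qed

lemma summable_on_coeff_cis:
  fixes d :: "int \<Rightarrow> complex"
  assumes "(\<lambda>n. cmod (d n)) summable_on I"
  shows "(\<lambda>n. d n * cis (f n)) summable_on I"
  by (rule abs_summable_summable) (use assms in \<open>simp add: norm_mult\<close>)

text \<open>Only the first moment is summable, so the remainder of a term is estimated in two ways:
  quadratically in \<open>h\<close> on a finite set of frequencies, and linearly on the rest, where
  the tail of the moment is small.\<close>

lemma fourier_series_has_vector_derivative: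
  fixes d :: "int \<Rightarrow> complex"
  assumes d0: "(\<lambda>n. cmod (d n)) summable_on UNIV"
    and d1: "(\<lambda>n. \<bar>real_of_int n\<bar> * cmod (d n)) summable_on UNIV"
  shows "((\<lambda>v. \<Sum>\<^sub>\<infinity>n. d n * cis (of_int n * v)) has_vector_derivative
     (\<Sum>\<^sub>\<infinity>n. \<i> * of_int n * d n * cis (of_int n * v))) (at v)"
proof -
  define f where "f = (\<lambda>v. \<Sum>\<^sub>\<infinity>n. d n * cis (of_int n * v))"
  define D where "D = (\<Sum>\<^sub>\<infinity>n. \<i> * of_int n * d n * cis (of_int n * v))"
  have d1': "(\<lambda>n. cmod (\<i> * of_int n * d n)) summable_on UNIV"
    using d1 by (simp add: norm_mult)
  define r where "r = (\<lambda>h n. d n * cis (of_int n * v) * (exp (\<i> * of_real (of_int n * h)) - 1 - \<i> * of_real (of_int n * h)))"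
  have r1: "cmod (r h n) \<le> \<bar>h\<bar> * (2 * (\<bar>real_of_int n\<bar> * cmod (d n)))"
    and r2: "cmod (r h n) \<le> h\<^sup>2 * ((real_of_int n)\<^sup>2 * cmod (d n))" for h n
    using mult_left_mono[OF norm_iexp_diff_le(2)[of "of_int n * h"] norm_ge_zero[of "d n"]]
      mult_left_mono[OF norm_iexp_diff_le(1)[of "of_int n * h"] norm_ge_zero[of "d n"]]
    by (simp_all add: r_def norm_mult abs_mult power_mult_distrib mult_ac)
  have r_sum: "(\<lambda>n. cmod (r h n)) summable_on I" for h I
  proof (rule summable_on_subset[of _ UNIV])
    show "(\<lambda>n. cmod (r h n)) summable_on UNIV"
      by (rule summable_on_comparison_test[OF _ r1]) (auto intro!: summable_on_cmult_right d1)
  qed simp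
  have eq: "f (v + h) - f v - h *\<^sub>R D = (\<Sum>\<^sub>\<infinity>n. r h n)" for h
  proof (rule infsumI[symmetric])
    have "((\<lambda>n. d n * cis (of_int n * (v + h)) - d n * cis (of_int n * v) - of_real h * (\<i> * of_int n * d n * cis (of_int n * v)))
        has_sum (f (v + h) - f v - of_real h * D)) UNIV"
      unfolding f_def D_def
      by (intro has_sum_minus has_sum_cmult_right has_sum_infsum summable_on_coeff_cis d0 d1')
    moreover have "d n * cis (of_int n * (v + h)) - d n * cis (of_int n * v) - of_real h * (\<i> * of_int n * d n * cis (of_int n * v)) = r h n" for n
    proof -
      have "cis (of_int n * (v + h)) = cis (of_int n * v) * exp (\<i> * of_real (of_int n * h))"
        by (simp add: cis_conv_exp exp_add[symmetric] algebra_simps)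
      then show ?thesis by (simp add: r_def algebra_simps)
    qed
    ultimately show "(r h has_sum (f (v + h) - f v - h *\<^sub>R D)) UNIV" by (simp add: scaleR_conv_of_real)
  qed
  have "((\<lambda>h. norm (f (v + h) - f v - h *\<^sub>R D) / norm h) \<longlongrightarrow> 0) (at 0)"
  proof (rule tendstoI)
    fix e :: real assume e: "e > 0"
    obtain F where F: "finite F" "infsum (\<lambda>n. 2 * (\<bar>real_of_int n\<bar> * cmod (d n))) (- F) < e / 2"
      using infsum_tail_less[OF summable_on_cmult_right[OF d1, of 2], of "e / 2"] e by auto
    define M where "M = (\<Sum>n\<in>F. (real_of_int n)\<^sup>2 * cmod (d n))"
    have M: "0 \<le> M" unfolding M_def by (intro sum_nonneg) simp
    define \<delta> where "\<delta> = e / 2 / (M + 1)"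
    have \<delta>: "\<delta> > 0" using e M by (simp add: \<delta>_def)
    have "norm (f (v + h) - f v - h *\<^sub>R D) < e * \<bar>h\<bar>" if h: "h \<noteq> 0" "\<bar>h\<bar> < \<delta>" for h
    proof -
      have "cmod (\<Sum>\<^sub>\<infinity>n. r h n) \<le> (\<Sum>\<^sub>\<infinity>n. cmod (r h n))" by (rule norm_infsum_bound[OF r_sum])
      also have "\<dots> = infsum (\<lambda>n. cmod (r h n)) (F \<union> - F)" by simp
      also have "\<dots> = (\<Sum>n\<in>F. cmod (r h n)) + infsum (\<lambda>n. cmod (r h n)) (- F)"
        using F(1) by (subst infsum_Un_disjoint) (auto intro: r_sum)
      also have "\<dots> \<le> h\<^sup>2 * M + infsum (\<lambda>n. \<bar>h\<bar> * (2 * (\<bar>real_of_int n\<bar> * cmod (d n)))) (- F)"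
      proof (rule add_mono)
        show "(\<Sum>n\<in>F. cmod (r h n)) \<le> h\<^sup>2 * M" unfolding M_def sum_distrib_left by (rule sum_mono[OF r2])
        show "infsum (\<lambda>n. cmod (r h n)) (- F) \<le> infsum (\<lambda>n. \<bar>h\<bar> * (2 * (\<bar>real_of_int n\<bar> * cmod (d n)))) (- F)"
          by (intro infsum_mono r_sum r1 summable_on_cmult_right summable_on_subset[OF d1]) auto
      qed
      also have "\<dots> = \<bar>h\<bar> * (\<bar>h\<bar> * M + infsum (\<lambda>n. 2 * (\<bar>real_of_int n\<bar> * cmod (d n))) (- F))"
        unfolding infsum_cmult_right' by (simp add: distrib_left power2_eq_square flip: mult.assoc)
      also have "\<dots> < \<bar>h\<bar> * e"
      proof (rule mult_strict_left_mono)
        have "\<bar>h\<bar> * M \<le> \<delta> * (M + 1)" using h M by (intro mult_mono) auto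
        also have "\<dots> = e / 2" using nonzero_eq_divide_eq[of "M + 1" \<delta> "e / 2"] \<delta>_def M by linarith
        finally show "\<bar>h\<bar> * M + infsum (\<lambda>n. 2 * (\<bar>real_of_int n\<bar> * cmod (d n))) (- F) < e"
          using F(2) by linarith
      qed (use h in simp)
      finally show ?thesis unfolding eq by (simp add: mult.commute)
    qed
    then have "dist (norm (f (v + h) - f v - h *\<^sub>R D) / norm h) 0 < e" if "h \<noteq> 0" "\<bar>h\<bar> < \<delta>" for h
      using that by (simp add: divide_less_eq)
    then show "\<forall>\<^sub>F h in at 0. dist (norm (f (v + h) - f v - h *\<^sub>R D) / norm h) 0 < e"
      using \<delta> by (auto simp: eventually_at)
  qed
  then show ?thesis
    unfolding f_def[symmetric] D_def[symmetric] has_vector_derivative_def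
    by (simp add: has_derivative_at bounded_linear_scaleR_left)
qed

lemma square_summable_moments:
  fixes a :: "int \<Rightarrow> complex"
  assumes a: "(\<lambda>n. (real_of_int n)\<^sup>2 * cmod (a n)) summable_on UNIV"
  shows "(\<lambda>n. cmod (a n)) summable_on UNIV" "(\<lambda>n. \<bar>real_of_int n\<bar> * cmod (a n)) summable_on UNIV"
proof -
  have one: "1 \<le> \<bar>real_of_int n\<bar>" if "n \<noteq> 0" for n
    using that by (metis abs_ge_self int_one_le_iff_zero_less of_int_1 of_int_abs of_int_le_iff zero_less_abs_iff)
  have sq: "\<bar>real_of_int n\<bar> \<le> (real_of_int n)\<^sup>2" for n
  proof (cases "n = 0")
    case False
    then show ?thesis using mult_left_mono[OF one[OF False], of "\<bar>real_of_int n\<bar>"] by (simp add: power2_eq_square)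
  qed simp
  show "(\<lambda>n. \<bar>real_of_int n\<bar> * cmod (a n)) summable_on UNIV"
    by (rule summable_on_comparison_test[OF a]) (auto intro: mult_right_mono sq)
  have "(\<lambda>n. cmod (a n)) summable_on (UNIV - {0})"
  proof (rule summable_on_comparison_test[OF summable_on_subset[OF a]])
    show "cmod (a n) \<le> (real_of_int n)\<^sup>2 * cmod (a n)" if "n \<in> UNIV - {0}" for n
      using mult_right_mono[OF order_trans[OF one sq], of n "cmod (a n)"] that by simp
  qed auto
  then have "(\<lambda>n. cmod (a n)) summable_on (insert 0 (UNIV - {0}))"
    by (simp only: summable_on_insert_iff)
  then show "(\<lambda>n. cmod (a n)) summable_on UNIV" by (simp add: insert_UNIV)
qed

text \<open>Differentiating termwise twice uses up exactly the two powers of \<open>n\<close>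
  granted by the class.\<close>

lemma circle_second_derivative:
  assumes "has_circle_coeffs \<Phi> a"
  shows "vector_derivative (\<lambda>u. vector_derivative (\<lambda>v. \<Phi> (exp (\<i> * of_real v))) (at u)) (at t)
    = (\<Sum>\<^sub>\<infinity>n. - (of_int n)\<^sup>2 * a n * cis (of_int n * t))"
proof -
  have a2: "(\<lambda>n. (real_of_int n)\<^sup>2 * cmod (a n)) summable_on UNIV"
    and sum: "\<And>z. cmod z = 1 \<Longrightarrow> ((\<lambda>n. a n * z powi n) has_sum \<Phi> z) UNIV"
    using assms by (auto simp: has_circle_coeffs_def)
  have "\<Phi> (exp (\<i> * of_real v)) = (\<Sum>\<^sub>\<infinity>n. a n * cis (of_int n * v))" for v
    using infsumI[OF sum[of "cis v"]] by (simp add: cis_conv_exp[symmetric] cis_power_int)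
  then have first: "vector_derivative (\<lambda>v. \<Phi> (exp (\<i> * of_real v))) (at u) = (\<Sum>\<^sub>\<infinity>n. \<i> * of_int n * a n * cis (of_int n * u))" for u
    using vector_derivative_at[OF fourier_series_has_vector_derivative[OF square_summable_moments[OF a2]]] by simp
  have "((\<lambda>u. \<Sum>\<^sub>\<infinity>n. (\<i> * of_int n * a n) * cis (of_int n * u)) has_vector_derivative
     (\<Sum>\<^sub>\<infinity>n. \<i> * of_int n * (\<i> * of_int n * a n) * cis (of_int n * t))) (at t)"
  proof (rule fourier_series_has_vector_derivative)
    show "(\<lambda>n. cmod (\<i> * of_int n * a n)) summable_on UNIV"
      using square_summable_moments(2)[OF a2] by (simp add: norm_mult)
    have "\<bar>real_of_int n\<bar> * cmod (\<i> * of_int n * a n) = (real_of_int n)\<^sup>2 * cmod (a n)" for n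
      by (simp add: norm_mult power2_eq_square flip: mult.assoc)
    then show "(\<lambda>n. \<bar>real_of_int n\<bar> * cmod (\<i> * of_int n * a n)) summable_on UNIV"
      using a2 by (simp only:)
  qed
  moreover have "\<i> * x * (\<i> * x * y) = - x\<^sup>2 * y" for x y
  proof -
    have "\<i> * x * (\<i> * x * y) = (\<i> * \<i>) * (x * x) * y" by (simp only: mult_ac)
    then show ?thesis by (simp add: power2_eq_square)
  qed
  ultimately show ?thesis
    unfolding first by (simp only: vector_derivative_at)
qed

text \<open>The partial sums converge uniformly, with error at most the tail \<open>T F\<close> of
  the coefficient sum. This makes \<open>G\<close> continuous, hence measurable, and allows
  integration term by term against \<eta>.\<close>

lemma has_sum_integral_fourier:
  fixes d :: "int \<Rightarrow> complex" and \<eta> :: "real \<Rightarrow> complex"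
  assumes d: "(\<lambda>n. cmod (d n)) summable_on UNIV" and \<eta>: "set_integrable lebesgue S \<eta>"
  shows "((\<lambda>n. d n * (LINT t:S|lebesgue. cis (of_int n * t) * \<eta> t)) has_sum
     (LINT t:S|lebesgue. (\<Sum>\<^sub>\<infinity>n. d n * cis (of_int n * t)) * \<eta> t)) UNIV"
proof -
  define G where "G = (\<lambda>t. \<Sum>\<^sub>\<infinity>n. d n * cis (of_int n * t))"
  define P where "P = (\<lambda>F t. \<Sum>n\<in>F. d n * cis (of_int n * t))"
  define T where "T = (\<lambda>F. infsum (\<lambda>n. cmod (d n)) UNIV - (\<Sum>n\<in>F. cmod (d n)))"
  define h where "h = (\<lambda>t. indicator S t *\<^sub>R \<eta> t)"
  have h: "integrable lebesgue h" using \<eta> by (simp add: h_def set_integrable_def)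
  have T0: "(T \<longlongrightarrow> 0) (finite_subsets_at_top UNIV)"
    unfolding T_def using has_sum_infsum[OF d] by (auto simp: has_sum_def intro!: tendsto_eq_intros)
  have GP: "cmod (G t - P F t) \<le> T F" if "finite F" for F t
  proof -
    have "((\<lambda>n. d n * cis (of_int n * t)) has_sum (G t - P F t)) (UNIV - F)"
      unfolding G_def P_def using that
      by (intro has_sum_Diff has_sum_infsum summable_on_coeff_cis d has_sum_finite) auto
    moreover have "((\<lambda>n. cmod (d n)) has_sum T F) (UNIV - F)"
      unfolding T_def using that by (intro has_sum_Diff has_sum_infsum d has_sum_finite) auto
    ultimately show ?thesis by (rule norm_infsum_le) (simp add: norm_mult)
  qed
  have "continuous_on UNIV G"
  proof (rule uniform_limit_theorem)
    show "uniform_limit UNIV P G (finite_subsets_at_top UNIV)"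
      unfolding uniform_limit_iff
    proof safe
      fix e :: real assume "e > 0"
      with T0 have "\<forall>\<^sub>F F in finite_subsets_at_top UNIV. dist (T F) 0 < e" by (rule tendstoD)
      moreover have "\<forall>\<^sub>F F in finite_subsets_at_top (UNIV :: int set). finite F"
        by (intro eventually_finite_subsets_at_top_weakI) auto
      ultimately show "\<forall>\<^sub>F F in finite_subsets_at_top UNIV. \<forall>t\<in>UNIV. dist (P F t) (G t) < e"
      proof eventually_elim
        case (elim F)
        show ?case
        proof
          fix t
          have "dist (P F t) (G t) \<le> T F" using GP[OF elim(2), of t] by (simp add: dist_norm norm_minus_commute)
          also have "\<dots> < e" using elim(1) by (simp add: dist_real_def)
          finally show "dist (P F t) (G t) < e" .
        qed
      qed
    qed
    show "\<forall>\<^sub>F F in finite_subsets_at_top UNIV. continuous_on UNIV (P F)"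
      unfolding P_def by (intro always_eventually allI continuous_intros)
  qed simp
  then have G_meas: "G \<in> borel_measurable borel" by (rule borel_measurable_continuous_onI)
  have P_meas: "P F \<in> borel_measurable borel" for F unfolding P_def by measurable
  note int_mult = integrable_bounded_mult[OF h]
  have set: "(LINT t:S|lebesgue. f t * \<eta> t) = (LINT t|lebesgue. f t * h t)" for f
    by (simp add: set_lebesgue_integral_def h_def)
  have cis_int: "integrable lebesgue (\<lambda>t. cis (of_int n * t) * h t)" for n
    by (rule int_mult[where C = 1]) auto
  have int_P: "integrable lebesgue (\<lambda>t. P F t * h t)" for F
    unfolding P_def sum_distrib_right mult.assoc
    by (intro Bochner_Integration.integrable_sum integrable_mult_right cis_int)
  have P_int: "(LINT t|lebesgue. P F t * h t) = (\<Sum>n\<in>F. d n * (LINT t|lebesgue. cis (of_int n * t) * h t))" for F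
    unfolding P_def sum_distrib_right mult.assoc
    by (subst Bochner_Integration.integral_sum) (auto intro: integrable_mult_right cis_int)
  have int_G: "integrable lebesgue (\<lambda>t. G t * h t)"
    by (rule int_mult[OF G_meas, where C = "T {}"]) (use GP[of "{}"] in \<open>simp add: P_def\<close>)
  have "((\<lambda>F. (LINT t|lebesgue. P F t * h t) - (LINT t|lebesgue. G t * h t)) \<longlongrightarrow> 0) (finite_subsets_at_top UNIV)"
  proof (rule Lim_null_comparison)
    show "((\<lambda>F. T F * (LINT t|lebesgue. cmod (h t))) \<longlongrightarrow> 0) (finite_subsets_at_top UNIV)"
      using tendsto_mult_left_zero[OF T0] .
    show "\<forall>\<^sub>F F in finite_subsets_at_top UNIV. norm ((LINT t|lebesgue. P F t * h t) - (LINT t|lebesgue. G t * h t))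
        \<le> T F * (LINT t|lebesgue. cmod (h t))"
    proof (rule eventually_finite_subsets_at_top_weakI)
      fix F :: "int set" assume F: "finite F"
      have "(LINT t|lebesgue. P F t * h t) - (LINT t|lebesgue. G t * h t) = (LINT t|lebesgue. P F t * h t - G t * h t)"
        by (rule Bochner_Integration.integral_diff[symmetric, OF int_P int_G])
      also have "norm \<dots> \<le> (LINT t|lebesgue. norm (P F t * h t - G t * h t))" by (rule integral_norm_bound)
      also have "\<dots> \<le> (LINT t|lebesgue. T F * cmod (h t))"
      proof (rule integral_mono)
        show "norm (P F t * h t - G t * h t) \<le> T F * cmod (h t)" for t
          using GP[OF F, of t] by (simp add: left_diff_distrib[symmetric] norm_mult mult_right_mono norm_minus_commute)
      qed (intro integrable_norm Bochner_Integration.integrable_diff int_P int_G integrable_mult_right h)+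
      finally show "norm ((LINT t|lebesgue. P F t * h t) - (LINT t|lebesgue. G t * h t))
        \<le> T F * (LINT t|lebesgue. cmod (h t))" by simp
    qed
  qed
  then have "((\<lambda>F. LINT t|lebesgue. P F t * h t) \<longlongrightarrow> (LINT t|lebesgue. G t * h t)) (finite_subsets_at_top UNIV)"
    by (rule LIM_zero_cancel)
  then show ?thesis
    unfolding has_sum_def set P_int G_def .
qed

section \<open>The trace formula\<close>

lemma circle_coeffs: "\<Phi> \<in> circle_class \<Longrightarrow> has_circle_coeffs \<Phi> (circle_coeffs \<Phi>)"
  unfolding circle_class_def circle_coeffs_def mem_Collect_eq by (rule someI_ex[where P = "has_circle_coeffs \<Phi>"])

context onb
begin

lemma has_sum_bop_fun:
  assumes V: "unitary_bop V" and \<Phi>: "\<Phi> \<in> circle_class"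
  shows "((\<lambda>n. circle_coeffs \<Phi> n *\<^sub>C unitary_powi V n) has_sum (bop_fun \<Phi> V :: 'h bop)) UNIV"
  unfolding bop_fun_def
proof (rule has_sum_infsum, rule abs_summable_summable)
  have "(\<lambda>n. cmod (circle_coeffs \<Phi> n)) summable_on UNIV"
    using circle_coeffs[OF \<Phi>] unfolding has_circle_coeffs_def
    by (rule square_summable_moments(1)[OF conjunct1])
  then show "(\<lambda>n. norm (circle_coeffs \<Phi> n *\<^sub>C unitary_powi V n)) summable_on UNIV"
    by (rule summable_on_comparison_test)
       (auto simp: norm_scaleC_bop intro!: mult_right_le_one_le norm_unitary_powi V)
qed

end

text \<open>The monomials are the test functions of the uniqueness proof.\<close>

lemma powi_circle_class: "(\<lambda>z. z powi n) \<in> circle_class"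
proof -
  have "has_circle_coeffs (\<lambda>z. z powi n) (\<lambda>m. if m = n then 1 else 0)"
    unfolding has_circle_coeffs_def
  proof (intro conjI allI impI)
    show "(\<lambda>m. (real_of_int m)\<^sup>2 * cmod (if m = n then 1 else 0)) summable_on UNIV"
      by (rule finite_nonzero_values_imp_summable_on) (rule finite_subset[of _ "{n}"], auto)
    show "((\<lambda>m. (if m = n then 1 else 0) * z powi m) has_sum z powi n) UNIV" for z :: complex
      by (rule has_sum_finite_neutralI[of "{n}"]) auto
  qed
  then show ?thesis unfolding circle_class_def by blast
qed

lemma powi_second_derivative:
  "vector_derivative (\<lambda>u. vector_derivative (\<lambda>v. exp (\<i> * of_real v) powi n) (at u)) (at t)
    = - (of_int n)\<^sup>2 * cis (of_int n * t)"
proof -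
  note d = cis_int_has_vector_derivative[of n]
  have eq: "exp (\<i> * of_real v) powi n = cis (of_int n * v)" for v
    by (simp add: cis_conv_exp[symmetric] cis_power_int)
  have "vector_derivative (\<lambda>u. \<i> * of_int n * cis (of_int n * u)) (at t) = \<i> * of_int n * (\<i> * of_int n * cis (of_int n * t))"
    by (intro vector_derivative_at has_vector_derivative_mult_right d)
  also have "\<dots> = (\<i> * \<i>) * (of_int n * of_int n) * cis (of_int n * t)" by (simp only: mult_ac)
  finally show ?thesis
    unfolding eq vector_derivative_at[OF d] by (simp add: power2_eq_square)
qed

context unitary_path
begin

text \<open>A trace bound dominates the operator norm, so \<open>taylor_bound\<close> summed over
  \<open>n\<close> gives differentiability in operator norm with a quadratic error.\<close>

lemma has_vector_derivative_bop_fun: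
  assumes \<Phi>: "\<Phi> \<in> circle_class"
  obtains G where "((\<lambda>n. circle_coeffs \<Phi> n *\<^sub>C powi_deriv U0 n) has_sum G) UNIV"
    "((\<lambda>s. bop_fun \<Phi> (path s)) has_vector_derivative G) (at 0)"
proof -
  define a where "a = circle_coeffs \<Phi>"
  have a2: "(\<lambda>n. (real_of_int n)\<^sup>2 * cmod (a n)) summable_on UNIV"
    using circle_coeffs[OF \<Phi>] by (simp add: has_circle_coeffs_def a_def)
  define R where "R = (\<lambda>h n. a n *\<^sub>C (unitary_powi (flow h * U0) n - unitary_powi U0 n - h *\<^sub>R powi_deriv U0 n))"
  have R: "trace_bound (R h n) (h\<^sup>2 * taylor_const * ((real_of_int n)\<^sup>2 * cmod (a n)))" if "\<bar>h\<bar> \<le> 1" for h n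
    using trace_bound_scaleC[OF taylor_bound[OF unitary_U0 that], of "a n" n] by (simp add: R_def mult_ac)
  define G where "G = (\<Sum>\<^sub>\<infinity>n. a n *\<^sub>C powi_deriv U0 n)"
  have powers: "((\<lambda>n. a n *\<^sub>C unitary_powi V n) has_sum bop_fun \<Phi> V) UNIV" if "unitary_bop V" for V :: "'h bop"
    unfolding a_def by (rule has_sum_bop_fun[OF that \<Phi>])
  have sumR: "R h summable_on UNIV" if "\<bar>h\<bar> \<le> 1" for h
  proof (rule abs_summable_summable, rule summable_on_comparison_test)
    show "(\<lambda>n. h\<^sup>2 * taylor_const * ((real_of_int n)\<^sup>2 * cmod (a n))) summable_on UNIV"
      by (intro summable_on_cmult_right a2)
  qed (use norm_le_trace_bound[OF R[OF that]] in auto)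
  \<comment> \<open>At h = 1 the linear term is the increment minus the remainder, and both of these
    series are already known to converge.\<close>
  have "(\<lambda>n. (a n *\<^sub>C unitary_powi (flow 1 * U0) n - a n *\<^sub>C unitary_powi U0 n) - R 1 n) summable_on UNIV"
    using has_sum_minus[OF has_sum_minus[OF powers powers] has_sum_infsum[OF sumR[of 1]]]
      unitary_mult[OF unitary_flow unitary_U0] unitary_U0
    by (auto intro: has_sum_imp_summable)
  moreover have "(a n *\<^sub>C unitary_powi (flow 1 * U0) n - a n *\<^sub>C unitary_powi U0 n) - R 1 n = a n *\<^sub>C powi_deriv U0 n" for n
    by (simp add: R_def complex_vector.scale_right_diff_distrib)
  ultimately have G: "((\<lambda>n. a n *\<^sub>C powi_deriv U0 n) has_sum G) UNIV"
    by (simp add: G_def)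
  have "((\<lambda>s. bop_fun \<Phi> (path s)) has_vector_derivative G) (at 0)"
  proof (rule has_vector_derivativeI_quadratic)
    fix h :: real assume h: "\<bar>h\<bar> \<le> 1"
    have "((\<lambda>n. a n *\<^sub>C unitary_powi (path h) n - a n *\<^sub>C unitary_powi U0 n - h *\<^sub>R (a n *\<^sub>C powi_deriv U0 n))
        has_sum (bop_fun \<Phi> (path h) - bop_fun \<Phi> U0 - h *\<^sub>R G)) UNIV"
      by (intro has_sum_minus powers unitary_path unitary_U0 has_sum_bounded_linear[OF bounded_linear_scaleR_right G])
    moreover have "a n *\<^sub>C unitary_powi (path h) n - a n *\<^sub>C unitary_powi U0 n - h *\<^sub>R (a n *\<^sub>C powi_deriv U0 n) = R h n" for n
      by (simp add: R_def path_def complex_vector.scale_right_diff_distrib scaleR_scaleC scaleC_scaleC mult.commute)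
    ultimately have sum: "(R h has_sum (bop_fun \<Phi> (path h) - bop_fun \<Phi> U0 - h *\<^sub>R G)) UNIV" by simp
    have "trace_bound (bop_fun \<Phi> (path h) - bop_fun \<Phi> U0 - h *\<^sub>R G)
        (\<Sum>\<^sub>\<infinity>n. h\<^sup>2 * taylor_const * ((real_of_int n)\<^sup>2 * cmod (a n)))"
      by (rule trace_bound_has_sum[OF sum has_sum_infsum R[OF h]]) (intro summable_on_cmult_right a2)
    from norm_le_trace_bound[OF this[unfolded infsum_cmult_right']]
    show "norm (bop_fun \<Phi> (path (0 + h)) - bop_fun \<Phi> (path 0) - h *\<^sub>R G)
        \<le> taylor_const * (\<Sum>\<^sub>\<infinity>n. (real_of_int n)\<^sup>2 * cmod (a n)) * h\<^sup>2"
      by (simp add: mult_ac)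
  qed
  with G show ?thesis unfolding a_def by (rule that)
qed

definition taylor_rem :: "(complex \<Rightarrow> complex) \<Rightarrow> 'h bop" where
  "taylor_rem \<Phi> = bop_fun \<Phi> (path 1) - bop_fun \<Phi> U0 - vector_derivative (\<lambda>s. bop_fun \<Phi> (path s)) (at 0)"

lemma taylor_rem_trace:
  assumes \<Phi>: "\<Phi> \<in> circle_class"
  shows "\<exists>K. trace_bound (taylor_rem \<Phi>) K"
    and "((\<lambda>n. circle_coeffs \<Phi> n * taylor_trace n 1) has_sum trace (taylor_rem \<Phi>)) UNIV"
proof -
  obtain G where G: "((\<lambda>n. circle_coeffs \<Phi> n *\<^sub>C powi_deriv U0 n) has_sum G) UNIV"
    "((\<lambda>s. bop_fun \<Phi> (path s)) has_vector_derivative G) (at 0)"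
    using has_vector_derivative_bop_fun[OF \<Phi>] by blast
  define R where "R = (\<lambda>n. circle_coeffs \<Phi> n *\<^sub>C (unitary_powi (path 1) n - unitary_powi U0 n - 1 *\<^sub>R powi_deriv U0 n))"
  define k where "k = (\<lambda>n. taylor_const * ((real_of_int n)\<^sup>2 * cmod (circle_coeffs \<Phi> n)))"
  have k: "k summable_on UNIV"
    unfolding k_def using circle_coeffs[OF \<Phi>] by (intro summable_on_cmult_right) (simp add: has_circle_coeffs_def)
  have "(R has_sum taylor_rem \<Phi>) UNIV"
    unfolding R_def taylor_rem_def vector_derivative_at[OF G(2)] complex_vector.scale_right_diff_distrib
    by (intro has_sum_minus has_sum_bop_fun unitary_path unitary_U0 \<Phi>) (simp add: G(1))
  moreover have R: "trace_bound (R n) (k n)" for n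
    using trace_bound_scaleC[OF taylor_bound[OF unitary_U0, of 1 n], of "circle_coeffs \<Phi> n"]
    by (simp add: R_def k_def path_def mult_ac)
  ultimately show "\<exists>K. trace_bound (taylor_rem \<Phi>) K"
    and "((\<lambda>n. circle_coeffs \<Phi> n * taylor_trace n 1) has_sum trace (taylor_rem \<Phi>)) UNIV"
    using trace_bound_has_sum[OF _ has_sum_infsum[OF k] R] trace_has_sum[OF _ k R]
    by (auto simp: R_def taylor_trace_def trace_scaleC)
qed

lemma taylor_trace_coeff: "taylor_trace n 1 = - (of_int n)\<^sup>2 * coeff n"
proof (cases "n = 0")
  case True
  \<comment> \<open>For n = 0 the factor n^2 in \<open>taylor_bound\<close> makes the bound 0, so
    the trace vanishes.\<close>
  have "trace_bound (unitary_powi (path 1) n - unitary_powi U0 n - 1 *\<^sub>R powi_deriv U0 n) 0"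
    using taylor_bound[OF unitary_U0, of 1 n] True by (simp add: path_def)
  from cmod_trace_le[OF this] show ?thesis using True by (simp add: taylor_trace_def)
qed (simp add: coeff_def)

text \<open>Carries the function found on \<open>period\<close> over to \<open>lebesgue\<close>. The
  integrals agree because the integrands, cut off to the period, are Borel measurable.\<close>

lemma spectral_shift_exists:
  obtains \<eta> where "set_integrable lebesgue {0..2 * pi} \<eta>"
    "\<And>n. n \<noteq> 0 \<Longrightarrow> (LINT t:{0..2 * pi}|lebesgue. cis (of_int n * t) * \<eta> t) = coeff n"
proof -
  obtain \<eta> where \<eta>: "integrable period \<eta>" "\<And>n. n \<noteq> 0 \<Longrightarrow> (LINT t|period. cis (of_int n * t) * \<eta> t) = coeff n"
  proof (rule fourier_coefficients_L1[of coeff])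
    fix \<epsilon> :: real assume "\<epsilon> > 0"
    show "\<exists>c1 c2 K. (\<forall>n. n \<noteq> 0 \<longrightarrow> coeff n = c1 n + c2 n) \<and> (\<forall>n. cmod (c1 n) \<le> K / \<bar>real_of_int n\<bar>) \<and>
      (\<forall>I b Q. finite I \<longrightarrow> 0 \<notin> I \<longrightarrow> (\<forall>t. cmod (\<Sum>n\<in>I. b n * cis (of_int n * t)) \<le> Q)
        \<longrightarrow> cmod (\<Sum>n\<in>I. b n * c2 n) \<le> \<epsilon> * Q)"
    proof (rule coeff_split[OF \<open>\<epsilon> > 0\<close>])
      fix c1 c2 K
      assume c: "\<And>n. n \<noteq> 0 \<Longrightarrow> coeff n = c1 n + c2 n" "\<And>n. cmod (c1 n) \<le> K / \<bar>real_of_int n\<bar>"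
        "\<And>I b Q. finite I \<Longrightarrow> 0 \<notin> I \<Longrightarrow> (\<And>t. cmod (\<Sum>n\<in>I. b n * cis (of_int n * t)) \<le> Q)
          \<Longrightarrow> cmod (\<Sum>n\<in>I. b n * c2 n) \<le> \<epsilon> * Q"
      show ?thesis
      proof (rule exI[of _ c1], rule exI[of _ c2], rule exI[of _ K], intro conjI allI impI)
        fix I b Q assume I: "finite I" "0 \<notin> I" "\<forall>t. cmod (\<Sum>n\<in>I. b n * cis (of_int n * t)) \<le> Q"
        show "cmod (\<Sum>n\<in>I. b n * c2 n) \<le> \<epsilon> * Q" by (rule c(3)[OF I(1,2) I(3)[rule_format]])
      qed (fact c)+
    qed
  qed blast
  have meas: "(\<lambda>t. indicator {0..2 * pi} t *\<^sub>R (f t * \<eta> t)) \<in> borel_measurable lborel" if "f \<in> borel_measurable borel" for f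
  proof -
    have "(\<lambda>t. f t * \<eta> t) \<in> borel_measurable period"
      by (rule borel_measurable_times[OF measurable_period[OF that] borel_measurable_integrable[OF \<eta>(1)]])
    then show ?thesis
      unfolding period_def by (subst (asm) borel_measurable_restrict_space_iff) (auto simp: mult.commute)
  qed
  show ?thesis
  proof (rule that[of \<eta>])
    have "integrable lborel (\<lambda>t. indicator {0..2 * pi} t *\<^sub>R \<eta> t)"
      using \<eta>(1) unfolding period_def by (subst (asm) integrable_restrict_space) auto
    then show "set_integrable lebesgue {0..2 * pi} \<eta>"
      unfolding set_integrable_def using meas[of "\<lambda>_. 1"] by (subst integrable_completion) auto
    fix n :: int assume n: "n \<noteq> 0"
    have "(LINT t:{0..2 * pi}|lebesgue. cis (of_int n * t) * \<eta> t)
        = (LINT t|lborel. indicator {0..2 * pi} t *\<^sub>R (cis (of_int n * t) * \<eta> t))"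
      unfolding set_lebesgue_integral_def by (rule integral_completion[OF meas]) measurable
    also have "\<dots> = (LINT t|period. cis (of_int n * t) * \<eta> t)"
      unfolding period_def by (rule integral_restrict_space[symmetric]) simp
    finally show "(LINT t:{0..2 * pi}|lebesgue. cis (of_int n * t) * \<eta> t) = coeff n" using \<eta>(2)[OF n] by simp
  qed
qed

text \<open>The second derivative multiplies the \<open>n\<close>-th coefficient by -n^2, the factor
  by which \<open>coeff\<close> was divided.\<close>

lemma trace_formula_of_coeff:
  assumes \<Phi>: "\<Phi> \<in> circle_class" and \<eta>: "set_integrable lebesgue {0..2 * pi} \<eta>"
    and coeff: "\<And>n. n \<noteq> 0 \<Longrightarrow> (LINT t:{0..2 * pi}|lebesgue. cis (of_int n * t) * \<eta> t) = coeff n"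
  shows "trace (taylor_rem \<Phi>) = (LINT t:{0..2 * pi}|lebesgue.
     vector_derivative (\<lambda>u. vector_derivative (\<lambda>v. \<Phi> (exp (\<i> * of_real v))) (at u)) (at t) * \<eta> t)"
proof (rule has_sum_unique[OF taylor_rem_trace(2)[OF \<Phi>]])
  define a where "a = circle_coeffs \<Phi>"
  have a: "has_circle_coeffs \<Phi> a" unfolding a_def by (rule circle_coeffs[OF \<Phi>])
  have "(\<lambda>n. cmod (- (of_int n)\<^sup>2 * a n)) summable_on UNIV"
    using a by (simp add: has_circle_coeffs_def norm_mult norm_power)
  from has_sum_integral_fourier[OF this \<eta>]
  have "((\<lambda>n. - (of_int n)\<^sup>2 * a n * (LINT t:{0..2 * pi}|lebesgue. cis (of_int n * t) * \<eta> t)) has_sum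
     (LINT t:{0..2 * pi}|lebesgue. (\<Sum>\<^sub>\<infinity>n. - (of_int n)\<^sup>2 * a n * cis (of_int n * t)) * \<eta> t)) UNIV" .
  moreover have "- (of_int n)\<^sup>2 * a n * (LINT t:{0..2 * pi}|lebesgue. cis (of_int n * t) * \<eta> t) = a n * taylor_trace n 1" for n
  proof (cases "n = 0")
    case False
    show ?thesis unfolding coeff[OF False] taylor_trace_coeff by (simp add: mult_ac)
  qed (simp add: taylor_trace_coeff)
  ultimately show "((\<lambda>n. circle_coeffs \<Phi> n * taylor_trace n 1) has_sum (LINT t:{0..2 * pi}|lebesgue.
     vector_derivative (\<lambda>u. vector_derivative (\<lambda>v. \<Phi> (exp (\<i> * of_real v))) (at u)) (at t) * \<eta> t)) UNIV"
    unfolding circle_second_derivative[OF a] a_def by (simp only:)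
qed

end

text \<open>Subtracting the mean value \<open>c\<close> removes the moment at 0 and changes no
  other, so that all moments of \<open>h\<close> vanish.\<close>

lemma AE_constant_if_coefficients_zero:
  fixes \<zeta> :: "real \<Rightarrow> complex"
  assumes \<zeta>: "set_integrable lebesgue {0..2 * pi} \<zeta>"
    and zero: "\<And>n. n \<noteq> 0 \<Longrightarrow> (LINT t:{0..2 * pi}|lebesgue. cis (of_int n * t) * \<zeta> t) = 0"
  shows "\<exists>c. AE t in lebesgue. t \<in> {0..2 * pi} \<longrightarrow> \<zeta> t = c"
proof -
  define c where "c = (LINT t:{0..2 * pi}|lebesgue. \<zeta> t) / (2 * of_real pi)"
  define h where "h = (\<lambda>t. indicator {0..2 * pi} t *\<^sub>R (\<zeta> t - c))"
  have bounded: "set_integrable lebesgue {0..2 * pi} (\<lambda>t. cis (of_int n * t) * c)" for n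
  proof -
    have "continuous_on {0..2 * pi} (\<lambda>t. cis (of_int n * t) * c)" by (intro continuous_intros)
    then show ?thesis by (rule absolutely_integrable_continuous_real)
  qed
  have cis_\<zeta>: "set_integrable lebesgue {0..2 * pi} (\<lambda>t. cis (of_int n * t) * \<zeta> t)" for n
    using integrable_bounded_mult[OF \<zeta>[unfolded set_integrable_def], of "\<lambda>t. cis (of_int n * t)" 1]
    by (simp add: set_integrable_def)
  have cis_c: "(LINT t:{0..2 * pi}|lebesgue. cis (of_int n * t) * c) = (if n = 0 then 2 * of_real pi else 0) * c" for n
  proof -
    have "(LINT t:{0..2 * pi}|lebesgue. cis (of_int n * t) * c) = (LINT t:{0..2 * pi}|lebesgue. cis (of_int n * t)) * c"
      by (simp add: set_lebesgue_integral_def flip: mult_scaleR_left)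
    also have "(LINT t:{0..2 * pi}|lebesgue. cis (of_int n * t)) = (LINT t|lborel. indicator {0..2 * pi} t *\<^sub>R cis (of_int n * t))"
      unfolding set_lebesgue_integral_def by (rule integral_completion) measurable
    also have "\<dots> = (LINT t|period. cis (of_int n * t))"
      unfolding period_def by (rule integral_restrict_space[symmetric]) simp
    finally show ?thesis by (simp add: integral_cis_period)
  qed
  have "AE t in lebesgue. h t = 0"
  proof (rule AE_zero_if_fourier_zero)
    show "integrable lebesgue h"
      using set_integral_diff(1)[OF \<zeta> bounded[of 0]] by (simp add: h_def set_integrable_def)
    show "h t = 0" if "t \<notin> {0..2 * pi}" for t using that by (simp add: h_def)
    fix n :: int
    have "(LINT t|lebesgue. cis (of_int n * t) * h t) = (LINT t:{0..2 * pi}|lebesgue. cis (of_int n * t) * \<zeta> t - cis (of_int n * t) * c)"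
      unfolding set_lebesgue_integral_def h_def
      by (intro Bochner_Integration.integral_cong refl) (simp add: right_diff_distrib)
    also have "\<dots> = (LINT t:{0..2 * pi}|lebesgue. cis (of_int n * t) * \<zeta> t) - (LINT t:{0..2 * pi}|lebesgue. cis (of_int n * t) * c)"
      by (rule set_integral_diff(2)[OF cis_\<zeta> bounded])
    also have "\<dots> = 0"
    proof (cases "n = 0")
      case True
      then show ?thesis unfolding cis_c by (simp add: c_def)
    next
      case False
      then show ?thesis unfolding cis_c zero[OF False] by simp
    qed
    finally show "(LINT t|lebesgue. cis (of_int n * t) * h t) = 0" .
  qed
  then have "AE t in lebesgue. t \<in> {0..2 * pi} \<longrightarrow> \<zeta> t = c"
    by eventually_elim (auto simp: h_def)
  then show ?thesis ..
qed

theorem theorem4p3: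
  fixes U U0 A :: "'h::nonzero_complex_hilbert bop"
    and Us :: "real \<Rightarrow> 'h bop"
    and R :: "(complex \<Rightarrow> complex) \<Rightarrow> 'h bop"
    and trace_formula :: "(real \<Rightarrow> complex) \<Rightarrow> bool"
  assumes "\<nexists>B :: 'h set. finite B \<and> cspan B = UNIV"
    and "\<exists>D :: 'h set. countable D \<and> closure D = UNIV"
    and "unitary_bop U" and "unitary_bop U0"
    and "hilbert_schmidt (U - U0)"
    and "hilbert_schmidt A" and "selfadjoint_bop A"
    and "U = exp (\<i> *\<^sub>C A) * U0"
  defines "Us \<equiv> \<lambda>s. exp (\<i> *\<^sub>C (s *\<^sub>R A)) * U0"
    and "R \<equiv> \<lambda>\<Phi>. bop_fun \<Phi> U - bop_fun \<Phi> U0 - vector_derivative (\<lambda>s. bop_fun \<Phi> (Us s)) (at 0)"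
    and "trace_formula \<equiv> \<lambda>\<eta>. \<forall>\<Phi>\<in>circle_class.
           bop_trace (R \<Phi>) =
             (LINT t:{0..2 * pi}|lebesgue.
                vector_derivative (\<lambda>u. vector_derivative (\<lambda>v. \<Phi> (exp (\<i> * of_real v))) (at u)) (at t) * \<eta> t)"
  shows "(\<forall>\<Phi>\<in>circle_class. trace_class (R \<Phi>)) \<and>
         (\<exists>\<eta>. \<eta> absolutely_integrable_on {0..2 * pi} \<and> trace_formula \<eta> \<and>
            (\<forall>\<eta>'. \<eta>' absolutely_integrable_on {0..2 * pi} \<and> trace_formula \<eta>' \<longrightarrow>
               (\<exists>c. AE t in lebesgue. t \<in> {0..2 * pi} \<longrightarrow> \<eta>' t = \<eta> t + c)))"
proof -
  \<comment> \<open>The basis inside \<open>bop_trace\<close>, so that \<open>trace\<close> becomes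
    \<open>bop_trace\<close>. That a basis exists at all is part of the Hilbert-Schmidt property of
    \<open>A\<close>.\<close>
  define B where "B = (SOME B :: 'h set. is_onb B)"
  have "is_onb B"
    using \<open>hilbert_schmidt A\<close> unfolding B_def hilbert_schmidt_def by (meson someI_ex)
  then interpret onb B by unfold_locales
  interpret unitary_path B A U0
    using assms by unfold_locales (auto simp: HS_hilbert_schmidt selfadjoint_bop_def)
  have scale: "\<i> *\<^sub>C (s *\<^sub>R A) = s *\<^sub>R gen" for s
    by (simp add: gen_def scaleR_scaleC scaleC_scaleC mult.commute)
  have Us: "Us = path"
    by (simp add: Us_def path_def flow_def scale fun_eq_iff)
  have U: "U = path 1"
    using \<open>U = exp (\<i> *\<^sub>C A) * U0\<close> by (simp add: path_def flow_def gen_def)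
  have R: "R = taylor_rem"
    by (simp add: R_def taylor_rem_def Us U fun_eq_iff)
  have bop_trace: "bop_trace T = trace T" for T
    unfolding bop_trace_def trace_def B_def[symmetric] ..
  obtain \<eta> where \<eta>: "set_integrable lebesgue {0..2 * pi} \<eta>"
    "\<And>n. n \<noteq> 0 \<Longrightarrow> (LINT t:{0..2 * pi}|lebesgue. cis (of_int n * t) * \<eta> t) = coeff n"
  proof (rule spectral_shift_exists)
    fix \<eta> :: "real \<Rightarrow> complex"
    assume "set_integrable lebesgue {0..2 * pi} \<eta>"
      "\<And>n. n \<noteq> 0 \<Longrightarrow> (LINT t:{0..2 * pi}|lebesgue. cis (of_int n * t) * \<eta> t) = coeff n"
    then show thesis by (rule that)
  qed
  have formula: "trace_formula \<eta>"
    unfolding trace_formula_def R bop_trace using trace_formula_of_coeff[OF _ \<eta>] by blast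
  show ?thesis
  proof (intro conjI ballI exI[of _ \<eta>] allI impI)
    show "trace_class (R \<Phi>)" if "\<Phi> \<in> circle_class" for \<Phi>
      using taylor_rem_trace(1)[OF that] trace_class_trace_bound unfolding R by blast
    fix \<eta>' assume \<eta>': "\<eta>' absolutely_integrable_on {0..2 * pi} \<and> trace_formula \<eta>'"
    have diff: "set_integrable lebesgue {0..2 * pi} (\<lambda>t. \<eta>' t - \<eta> t)"
      using set_integral_diff(1)[OF conjunct1[OF \<eta>'] \<eta>(1)] .
    \<comment> \<open>Testing both formulas with z^n equates the moments of \<eta> and \<eta>' up to
      the factor -n^2, which is nonzero.\<close>
    have "(LINT t:{0..2 * pi}|lebesgue. cis (of_int n * t) * (\<eta>' t - \<eta> t)) = 0" if n: "n \<noteq> 0" for n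
    proof -
      have int: "set_integrable lebesgue {0..2 * pi} (\<lambda>t. - (of_int n)\<^sup>2 * cis (of_int n * t) * f t)"
        if f: "set_integrable lebesgue {0..2 * pi} f" for f :: "real \<Rightarrow> complex"
        using integrable_bounded_mult[OF f[unfolded set_integrable_def],
            of "\<lambda>t. - (of_int n)\<^sup>2 * cis (of_int n * t)" "(of_int n)\<^sup>2"]
        by (simp add: set_integrable_def norm_mult norm_power)
      have moment: "bop_trace (R (\<lambda>z. z powi n)) = (LINT t:{0..2 * pi}|lebesgue. - (of_int n)\<^sup>2 * cis (of_int n * t) * f t)"
        if "trace_formula f" for f
        using bspec[OF that[unfolded trace_formula_def] powi_circle_class[of n]] unfolding powi_second_derivative .
      have "(LINT t:{0..2 * pi}|lebesgue. - (of_int n)\<^sup>2 * cis (of_int n * t) * \<eta>' t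
          - - (of_int n)\<^sup>2 * cis (of_int n * t) * \<eta> t) = 0"
        unfolding set_integral_diff(2)[OF int[OF conjunct1[OF \<eta>']] int[OF \<eta>(1)]]
          moment[OF conjunct2[OF \<eta>'], symmetric] moment[OF formula, symmetric] by (rule diff_self)
      moreover have "- (of_int n)\<^sup>2 * cis (of_int n * t) * \<eta>' t - - (of_int n)\<^sup>2 * cis (of_int n * t) * \<eta> t
          = - (of_int n)\<^sup>2 * (cis (of_int n * t) * (\<eta>' t - \<eta> t))" for t
        by (simp add: algebra_simps)
      ultimately have "- (of_int n)\<^sup>2 * (LINT t:{0..2 * pi}|lebesgue. cis (of_int n * t) * (\<eta>' t - \<eta> t)) = 0"
        by (simp only: set_integral_mult_right)
      then show ?thesis using n by simp
    qed
    from AE_constant_if_coefficients_zero[OF diff this]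
    obtain c where "AE t in lebesgue. t \<in> {0..2 * pi} \<longrightarrow> \<eta>' t - \<eta> t = c" ..
    then have "AE t in lebesgue. t \<in> {0..2 * pi} \<longrightarrow> \<eta>' t = \<eta> t + c"
      by eventually_elim (auto simp: algebra_simps)
    then show "\<exists>c. AE t in lebesgue. t \<in> {0..2 * pi} \<longrightarrow> \<eta>' t = \<eta> t + c" ..
  qed (rule \<eta>(1), rule formula)
qed

end
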